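(* Let $\varepsilon\in(0,1]$ and suppose that $b$ belongs to $\mathrm{osc}_{(\exp L)^{1/\varepsilon}}$ on the unit ball $\mathbb{B}_n\subset\mathbb{C}^n$. Let $P$ be the Bergman projection on $\mathbb{B}_n$. There exists $C>0$ such that for all bounded, compactly supported functions $f$ on $\mathbb{B}_n$ and all $\lambda>0$, $$\left|\left\{z\in\mathbb{B}_n:|[\bar b,P]f(z)|>\lambda\right\}\right|\le C\,\|b\|_{\mathrm{osc}_{(\exp L)^{1/\varepsilon}}}\int_{\mathbb{B}_n}\frac{|f(z)|}{\lambda}\left(1+\log^+\left(\frac{|f(z)|\,\|b\|_{\mathrm{osc}_{(\exp L)^{1/\varepsilon}}}}{\lambda}\right)\right)^{\varepsilon}dV(z).$$
   Context: $V$ is Lebesgue measure, $|E|=V(E)$, $\log^+t=\max\{0,\log t\}$, $\langle b\rangle_A=\frac1{|A|}\int_Ab\,dV$. The Bergman projection is $Pf(z)=c_n\int_{\mathbb{B}_n}\frac{f(w)}{(1-\langle z,w\rangle)^{n+1}}\,dV(w)$, $c_n=n!/\pi^n$, and $[\bar b,P]f=\bar b\,Pf-P(\bar bf)$. Oscillation space: for $1\le r<\infty$, a locally integrable function $b$ on $\mathbb{B}_n$ belongs to $\mathrm{osc}_{(\exp L)^r}$ if there is $c>0$ with $\sup_{K\in\mathcal{D}}\frac1{|\widehat K|}\int_{\widehat K}\exp\left(\left|\frac{b-\langle b\rangle_{\widehat K}}{c}\right|^r\right)dV<\infty$; the norm $\|b\|_{\mathrm{osc}_{(\exp L)^r}}$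 is the infimum of the $c>0$ for which $\sup_{K\in\mathcal{D}}\frac1{|\widehat K|}\int_{\widehat K}\left[\exp\left(\left|\frac{b-\langle b\rangle_{\widehat K}}{c}\right|^r\right)-1\right]dV\le1$. Dyadic structure: let $d_\beta(z,w)=\frac12\log\frac{1+|\varphi_z(w)|}{1-|\varphi_z(w)|}$ be the Bergman distance ($\varphi_z$ the involutive automorphism of $\mathbb{B}_n$ interchanging $0$ and $z$). Fix $\theta_0>0$ chosen large enough so that $(n+1)\theta_0>1$, and let $\delta=e^{-2\theta_0}$. On $\partial\mathbb{B}_n$ with quasi-metric $\rho(z,w)=|1-\langle z,w\rangle|$ fix finitely many dyadic systems $\mathcal{Q}_1,\dots,\mathcal{Q}_N$ ($N$ depending only on $n$); each $\mathcal{Q}_\ell$ consists of Borel sets $Q_j^k$ ($k$ the generation) which for fixed $k$ partition $\partial\mathbb{B}_n$, any two of which are nested or disjoint, and with $Q_j^k$ comparable to a $\rho$-ball of radius $\delta^k$. Let $P_kz$ be the radial projection of $z\neq 0$ onto $\{d_\beta(\cdot,0)=k\theta_0\}$ and $S_j^k=P_k(Q_j^k)$. The kubes of $\mathcal{D}_\ell$ are $K_1^0=\{d_\beta(z,0)<\theta_0\}$ and, for $k\ge1$, $K_j^k=\{z:k\theta_0\le d_\beta(z,0)<(k+1)\theta_0,\ P_kz\in S_j^k\}$, each with a center $c_j^k\in K_j^k$. $K_j^{k+1}$ is a child of $K_i^k$ if $P_k(c_j^{k+1})\in K_i^k$; $\mathcal{D}(K)$ is the set of descendants of $K$ (including $K$),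 and the dyadic tent is $\widehat K=\bigcup_{J\in\mathcal{D}(K)}J$. Set $\mathcal{D}=\bigcup_{\ell=1}^N\mathcal{D}_\ell$. Known properties: in each $\mathcal{D}_\ell$ the kubes partition $\mathbb{B}_n$; tents are nested or disjoint; $|\widehat K_j^k|\sim|K_j^k|\sim e^{-2(n+1)\theta_0k}$; each kube has at most $e^{2n\theta_0}$ children; and with $T_z=\{w\in\mathbb{B}_n:|1-\langle z,w\rangle/|z||<1-|z|\}$ ($T_0=\mathbb{B}_n$), every $T_z$ is contained in some $\widehat K$, $K\in\mathcal{D}$, of comparable measure, and every $\widehat K$ is contained in some $T_{z'}$ of comparable measure. *)

theory Defs
  imports "HOL-Analysis.Analysis"
begin

text \<open>The space of \<open>n\<close> complex variables is \<^typ>\<open>complex^'n\<close> with \<open>n = CARD('n)\<close>; its norm is the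
  Euclidean one, so the unit ball is \<open>ball 0 1\<close> and its boundary \<open>sphere 0 1\<close>.\<close>

definition herm :: "complex^'n::finite \<Rightarrow> complex^'n \<Rightarrow> complex" where
  "herm z w = (\<Sum>i\<in>UNIV. z $ i * cnj (w $ i))"

text \<open>The involutive automorphism interchanging \<open>0\<close> and \<open>z\<close>. Here \<open>p\<close> is the orthogonal projection
  of \<open>w\<close> onto the complex line through \<open>z\<close>; for \<open>z = 0\<close> division by zero gives \<open>p = 0\<close>, so
  that the automorphism is \<open>w \<mapsto> - w\<close>, as it should be.\<close>

definition ball_aut :: "complex^'n::finite \<Rightarrow> complex^'n \<Rightarrow> complex^'n" where
  "ball_aut z w =
    (let p = (herm w z / herm z z) *s z
     in (1 / (1 - herm w z)) *s (z - p - sqrt (1 - (norm z)\<^sup>2) *\<^sub>R (w - p)))"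

definition bergman_dist :: "complex^'n::finite \<Rightarrow> complex^'n \<Rightarrow> real" where
  "bergman_dist z w = 1/2 * ln ((1 + norm (ball_aut z w)) / (1 - norm (ball_aut z w)))"

definition bergman_proj :: "(complex^'n::finite \<Rightarrow> complex) \<Rightarrow> complex^'n \<Rightarrow> complex" where
  "bergman_proj f z =
    of_real (fact CARD('n) / pi ^ CARD('n)) *
    (LINT w:ball 0 1|lebesgue. f w / (1 - herm z w) ^ (CARD('n) + 1))"

definition bergman_commutator ::
    "(complex^'n::finite \<Rightarrow> complex) \<Rightarrow> (complex^'n \<Rightarrow> complex) \<Rightarrow> complex^'n \<Rightarrow> complex" where
  "bergman_commutator a f z = a z * bergman_proj f z - bergman_proj (\<lambda>w. a w * f w) z"

definition rho_ball :: "complex^'n::finite \<Rightarrow> real \<Rightarrow> (complex^'n) set" where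
  "rho_ball \<zeta> r = {\<eta> \<in> sphere 0 1. cmod (1 - herm \<zeta> \<eta>) < r}"

text \<open>Radial projection onto the Bergman sphere of radius \<open>k\<theta>\<close> about the origin, for nonzero
  arguments; points of \<open>sphere 0 1\<close> are projected as well.\<close>

definition radial_proj :: "real \<Rightarrow> nat \<Rightarrow> complex^'n::finite \<Rightarrow> complex^'n" where
  "radial_proj \<theta> k z =
    (THE w. w \<in> ball 0 1 \<and> (\<exists>t\<ge>0. w = t *\<^sub>R z) \<and> bergman_dist w 0 = real k * \<theta>)"

text \<open>A system \<open>\<Q>\<close> assigns to every generation \<open>k\<close> a family \<open>\<Q> k\<close> of subsets of the boundary. The sets
  are not indexed: since the members of \<open>\<Q> k\<close> are nonempty and disjoint, distinct ones give
  distinct kubes, and a kube determines its generation.\<close>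

definition kubes ::
    "real \<Rightarrow> (nat \<Rightarrow> (complex^'n::finite) set set) \<Rightarrow> nat \<Rightarrow> (complex^'n) set set" where
  "kubes \<theta> \<Q> k =
    (if k = 0 then {{z \<in> ball 0 1. bergman_dist z 0 < \<theta>}}
     else (\<lambda>Q. {z \<in> ball 0 1. real k * \<theta> \<le> bergman_dist z 0 \<and> bergman_dist z 0 < (real k + 1) * \<theta> \<and>
                  radial_proj \<theta> k z \<in> radial_proj \<theta> k ` Q}) ` \<Q> k)"

text \<open>Pairs (child, parent); \<open>cen K\<close> is the center of the kube \<open>K\<close>.\<close>

definition kube_child :: "real \<Rightarrow> (nat \<Rightarrow> (complex^'n::finite) set set) \<Rightarrow>
    ((complex^'n) set \<Rightarrow> complex^'n) \<Rightarrow> ((complex^'n) set \<times> (complex^'n) set) set" where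
  "kube_child \<theta> \<Q> cen =
    {(J, K). \<exists>k. K \<in> kubes \<theta> \<Q> k \<and> J \<in> kubes \<theta> \<Q> (Suc k) \<and> radial_proj \<theta> k (cen J) \<in> K}"

definition tent :: "real \<Rightarrow> (nat \<Rightarrow> (complex^'n::finite) set set) \<Rightarrow>
    ((complex^'n) set \<Rightarrow> complex^'n) \<Rightarrow> (complex^'n) set \<Rightarrow> (complex^'n) set" where
  "tent \<theta> \<Q> cen K = \<Union>{J. (J, K) \<in> (kube_child \<theta> \<Q> cen)\<^sup>*}"

definition tents :: "real \<Rightarrow> (nat \<Rightarrow> (complex^'n::finite) set set) \<Rightarrow>
    ((complex^'n) set \<Rightarrow> complex^'n) \<Rightarrow> (complex^'n) set set" where
  "tents \<theta> \<Q> cen = {tent \<theta> \<Q> cen K | K k. K \<in> kubes \<theta> \<Q> k}"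

definition carleson_tent :: "complex^'n::finite \<Rightarrow> (complex^'n) set" where
  "carleson_tent z =
    (if z = 0 then ball 0 1
     else {w \<in> ball 0 1. cmod (1 - herm z w / of_real (norm z)) < 1 - norm z})"

definition comparable :: "real \<Rightarrow> real \<Rightarrow> real \<Rightarrow> bool" where
  "comparable A x y \<longleftrightarrow> x \<le> A * y \<and> y \<le> A * x"

text \<open>The systems are \<open>\<Q> l\<close> for \<open>l < N\<close>, and \<open>cen l\<close> gives the centers of the kubes of the
  \<open>l\<close>-th system. The assumptions from \<open>kubes_partition\<close> on are the standard properties of the
  structure. The bound on the number of children is up to a multiplicative constant: without one,
  it could not hold unless \<open>exp (2n\<theta>)\<close> is an integer, since there are about \<open>exp (2n\<theta>k)\<close> kubes
  of generation \<open>k\<close>.\<close>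

locale bergman_dyadic =
  fixes \<theta> :: real
    and N :: nat
    and \<Q> :: "nat \<Rightarrow> nat \<Rightarrow> (complex^'n::finite) set set"
    and cen :: "nat \<Rightarrow> (complex^'n) set \<Rightarrow> complex^'n"
  assumes theta_pos: "\<theta> > 0"
    and theta_large: "(real CARD('n) + 1) * \<theta> > 1"
    and sphere_partition: "\<And>l k. l < N \<Longrightarrow> partition_on (sphere 0 1) (\<Q> l k)"
    and sphere_borel: "\<And>l k Q. l < N \<Longrightarrow> Q \<in> \<Q> l k \<Longrightarrow> Q \<in> sets borel"
    and sphere_nested: "\<And>l k k' Q Q'. l < N \<Longrightarrow> Q \<in> \<Q> l k \<Longrightarrow> Q' \<in> \<Q> l k' \<Longrightarrow>
        Q \<subseteq> Q' \<or> Q' \<subseteq> Q \<or> Q \<inter> Q' = {}"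
    and sphere_balls: "\<exists>a>0. \<exists>A>0. \<forall>l<N. \<forall>k. \<forall>Q\<in>\<Q> l k. \<exists>\<zeta>\<in>sphere 0 1.
        rho_ball \<zeta> (a * exp (- 2 * \<theta>) ^ k) \<subseteq> Q \<and> Q \<subseteq> rho_ball \<zeta> (A * exp (- 2 * \<theta>) ^ k)"
    and cen_in: "\<And>l k K. l < N \<Longrightarrow> K \<in> kubes \<theta> (\<Q> l) k \<Longrightarrow> cen l K \<in> K"
    and kubes_partition: "\<And>l. l < N \<Longrightarrow> partition_on (ball 0 1) (\<Union>k. kubes \<theta> (\<Q> l) k)"
    and tents_nested: "\<And>l S S'. l < N \<Longrightarrow> S \<in> tents \<theta> (\<Q> l) (cen l) \<Longrightarrow>
        S' \<in> tents \<theta> (\<Q> l) (cen l) \<Longrightarrow> S \<subseteq> S' \<or> S' \<subseteq> S \<or> S \<inter> S' = {}"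
    and tent_measure: "\<exists>A>0. \<forall>l<N. \<forall>k. \<forall>K\<in>kubes \<theta> (\<Q> l) k.
        comparable A (measure lebesgue (tent \<theta> (\<Q> l) (cen l) K)) (measure lebesgue K) \<and>
        comparable A (measure lebesgue K) (exp (- 2 * (real CARD('n) + 1) * \<theta> * real k))"
    and children_bound: "\<exists>A>0. \<forall>l<N. \<forall>k. \<forall>K\<in>kubes \<theta> (\<Q> l) k.
        finite {J. (J, K) \<in> kube_child \<theta> (\<Q> l) (cen l)} \<and>
        real (card {J. (J, K) \<in> kube_child \<theta> (\<Q> l) (cen l)}) \<le> A * exp (2 * real CARD('n) * \<theta>)"
    and carleson_in_tent: "\<exists>A>0. \<forall>z\<in>ball 0 1. \<exists>l<N. \<exists>S\<in>tents \<theta> (\<Q> l) (cen l).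
        carleson_tent z \<subseteq> S \<and> comparable A (measure lebesgue (carleson_tent z)) (measure lebesgue S)"
    and tent_in_carleson: "\<exists>A>0. \<forall>l<N. \<forall>S\<in>tents \<theta> (\<Q> l) (cen l). \<exists>z\<in>ball 0 1.
        S \<subseteq> carleson_tent z \<and> comparable A (measure lebesgue S) (measure lebesgue (carleson_tent z))"

definition all_tents :: "real \<Rightarrow> nat \<Rightarrow> (nat \<Rightarrow> nat \<Rightarrow> (complex^'n::finite) set set) \<Rightarrow>
    (nat \<Rightarrow> (complex^'n) set \<Rightarrow> complex^'n) \<Rightarrow> (complex^'n) set set" where
  "all_tents \<theta> N \<Q> cen = (\<Union>l<N. tents \<theta> (\<Q> l) (cen l))"

definition mean_on :: "(complex^'n::finite) set \<Rightarrow> (complex^'n \<Rightarrow> complex) \<Rightarrow> complex" where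
  "mean_on S b = (1 / measure lebesgue S) *\<^sub>R (LINT w:S|lebesgue. b w)"

definition locally_integrable_ball :: "(complex^'n::finite \<Rightarrow> complex) \<Rightarrow> bool" where
  "locally_integrable_ball b \<longleftrightarrow>
    (\<forall>S. compact S \<and> S \<subseteq> ball 0 1 \<longrightarrow> set_integrable lebesgue S b)"

text \<open>In the following two definitions \<open>\<T>\<close> is the family of all dyadic tents. Their integrals are
  those of nonnegative functions, with values in the extended nonnegative reals. One of the tents is
  the whole ball; the condition for it forces \<open>b\<close> to be integrable over the ball, so the
  means are genuine for every \<open>b\<close> in the space.\<close>

definition osc_exp :: "real \<Rightarrow> (complex^'n::finite) set set \<Rightarrow> (complex^'n \<Rightarrow> complex) set" where
  "osc_exp r \<T> = {b. locally_integrable_ball b \<and>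
    (\<exists>c>0. (SUP S\<in>\<T>.
        (\<integral>\<^sup>+w\<in>S. ennreal (exp ((norm (b w - mean_on S b) / c) powr r)) \<partial>lebesgue)
          / emeasure lebesgue S) < \<infinity>)}"

definition osc_exp_norm ::
    "real \<Rightarrow> (complex^'n::finite) set set \<Rightarrow> (complex^'n \<Rightarrow> complex) \<Rightarrow> real" where
  "osc_exp_norm r \<T> b = Inf {c. 0 < c \<and>
    (SUP S\<in>\<T>.
        (\<integral>\<^sup>+w\<in>S. ennreal (exp ((norm (b w - mean_on S b) / c) powr r) - 1) \<partial>lebesgue)
          / emeasure lebesgue S) \<le> 1}"

definition bounded_compact_support :: "(complex^'n::finite \<Rightarrow> complex) \<Rightarrow> bool" where
  "bounded_compact_support f \<longleftrightarrow>
    f \<in> borel_measurable (lebesgue_on (ball 0 1)) \<and>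
    bounded (f ` ball 0 1) \<and>
    (\<exists>S. compact S \<and> S \<subseteq> ball 0 1 \<and> (\<forall>z\<in>ball 0 1 - S. f z = 0))"

definition log_plus :: "real \<Rightarrow> real" where
  "log_plus t = max 0 (ln t)"

end

(*
The Bergman kernel at (z, w) is bounded by the sum, over all dyadic tents S containing both points, of
1 / |S|: both points lie in a Carleson tent of measure comparable to |1 - <z, w>|^(n + 1). Hence the
commutator is dominated by finitely many operators F |-> sum over S containing z of the average over S
of |b(z) - b(w)| F(w), one for each dyadic system. Normalise b to have norm 1 and put
Phi(t) = t (1 + log^+ t)^epsilon.

Stop at the maximal tents over which the average of Phi(F) exceeds 1; they have total measure at most
the integral of Phi(F). In the stopped tree, telescoping the means of b along the chain of tents gives
|b(z) - b(w)| <= C (1 + t(z)) (1 + t(w)) times factors growing slowly in the numbers of generations from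
S to z and to w, where t is the oscillation of b in the last tent of a point, so that exp(t^(1/epsilon))
has bounded averages. By the Young-type inequality
(1 + t) F <= 4 sqrt(Phi(F)) sqrt(Phi(F) + exp(t^(1/epsilon))), the operator is then of the form
beta A(W h) with h = sqrt(Phi(F)), where beta^2 and W^2 have bounded averages over the kubes of the
stopped tree. The measure of the points of a tent lying j generations below it decays geometrically
in j, so a Schur test bounds the L^2 norm of beta A(W h) by that of h, and Chebyshev's inequality
gives the weak-type bound with the integral of h^2 = Phi(F).
*)
theory Submission
  imports Defs
begin

text \<open>The obstacle is that \<open>F\<close> lies only in the Orlicz class of Phi, below L^2,
  and that \<open>|b(z) - b(w)|\<close> is unbounded and depends on both points. Passing to the
  square root \<open>h\<close> of Phi(F) turns the endpoint into an L^2 bound, provided the weight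
  \<open>W\<close>, with \<open>W\<close>^2 equal to Phi(F) + exp(t^(1/epsilon)), has bounded
  averages of its square. The exponential part has them by the hypothesis on \<open>b\<close>, the
  part Phi(F) only because of the stopping. \<open>F\<close> itself is never modified: for points in
  a maximal heavy tent, that tent simply becomes the last one. Comparing \<open>b\<close> with its
  mean over the last tent of a point, and not over the tent \<open>S\<close> of the sum, makes the
  weights functions of the point alone, so that one factorisation serves all generations. The price
  is linear growth in the number of generations, which the geometric decay absorbs. In the Schur
  test the squares of the weights need control only on the part of each tent where it is the last
  one; whole tents follow from sparseness.\<close>

section \<open>Schur test on sparse trees\<close>

text \<open>\<open>T k\<close> plays the role of the tents of generation \<open>k\<close>, and \<open>g x\<close> is the generation of the last
  tent that contains \<open>x\<close>, that is, of the kube of \<open>x\<close>. The exponent 8 leaves room for the weights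
  \<open>a ^ (6 * (g x - k))\<close> that appear when the Cauchy-Schwarz inequality is applied twice.\<close>

locale sparse_tree = finite_measure M for M :: "'a measure" +
  fixes g :: "'a \<Rightarrow> nat"
    and T :: "nat \<Rightarrow> 'a set set"
    and a D :: real
  assumes a_gt_1: "1 < a"
    and D_ge_1: "1 \<le> D"
    and finite_T: "finite (T k)"
    and disjoint_T: "disjoint (T k)"
    and Union_T: "\<Union>(T k) = {x \<in> space M. k \<le> g x}"
    and sets_T: "S \<in> T k \<Longrightarrow> S \<in> sets M"
    and measure_T_pos: "S \<in> T k \<Longrightarrow> 0 < measure M S"
    and parent: "S \<in> T (Suc k) \<Longrightarrow> \<exists>S'\<in>T k. S \<subseteq> S' \<and> measure M S' \<le> D * measure M S"
    and sparse: "S \<in> T k \<Longrightarrow> a ^ 8 * measure M (S \<inter> {x. Suc k \<le> g x}) \<le> measure M S"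
begin

lemma T_in_space: "S \<in> T k \<Longrightarrow> x \<in> S \<Longrightarrow> x \<in> space M"
  using sets.sets_into_space sets_T by blast

lemma T_le_g: "S \<in> T k \<Longrightarrow> x \<in> S \<Longrightarrow> k \<le> g x"
  using Union_T[of k] by blast

lemma T_cover:
  assumes "x \<in> space M" "k \<le> g x"
  obtains S where "S \<in> T k" "x \<in> S"
  using Union_T[of k] assms by blast

lemma T_unique: "S \<in> T k \<Longrightarrow> S' \<in> T k \<Longrightarrow> x \<in> S \<Longrightarrow> x \<in> S' \<Longrightarrow> S = S'"
  using disjoint_T[of k] by (auto simp: disjoint_def)

lemma g_level_measurable [measurable]: "Measurable.pred M (\<lambda>x. k \<le> g x)"
proof -
  have "{x \<in> space M. k \<le> g x} \<in> sets M"
    unfolding Union_T[symmetric] using finite_T sets_T by (intro sets.finite_Union) auto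
  then show ?thesis by (simp add: pred_def)
qed

lemma g_measurable [measurable]: "g \<in> measurable M (count_space UNIV)"
proof (rule measurableI)
  show "g -` A \<inter> space M \<in> sets M" if "A \<in> sets (count_space UNIV)" for A
  proof -
    have "g -` A \<inter> space M = (\<Union>k\<in>A. {x \<in> space M. k \<le> g x} - {x \<in> space M. Suc k \<le> g x})"
      by (auto simp: not_less_eq_eq)
    also have "\<dots> \<in> sets M"
      by (intro sets.countable_UN') auto
    finally show ?thesis .
  qed
qed simp

lemma emeasure_T_pos: "S \<in> T k \<Longrightarrow> 0 < emeasure M S"
  using measure_T_pos by (simp add: emeasure_eq_measure)

lemma sum_T_eq:
  fixes \<phi> :: "'a set \<Rightarrow> 'b::semiring_1"
  assumes "S \<in> T k" "x \<in> S"
  shows "(\<Sum>S\<in>T k. indicator S x * \<phi> S) = \<phi> S"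
proof -
  have "(\<Sum>S\<in>T k. indicator S x * \<phi> S) = (\<Sum>S'\<in>{S}. indicator S' x * \<phi> S')"
    using assms T_unique finite_T by (intro sum.mono_neutral_right) (auto simp: indicator_def)
  then show ?thesis using assms by simp
qed

lemma parent_unique_superset:
  assumes "S' \<in> T (Suc k)" "S \<in> T k" "x \<in> S" "x \<in> S'"
  shows "S' \<subseteq> S" "measure M S \<le> D * measure M S'"
  using parent[OF assms(1)] T_unique[OF _ assms(2)] assms by blast+

text \<open>By \<open>parent\<close>, a next-generation tent through a point of \<open>S\<close>
  lies in some tent of generation \<open>k\<close>, which disjointness identifies as
  \<open>S\<close>.\<close>

lemma children_decomposition:
  assumes "S \<in> T k"
  shows "S \<inter> {x. Suc k \<le> g x} = \<Union>{S' \<in> T (Suc k). S' \<subseteq> S}" (is "?L = ?R")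
proof (intro subset_antisym subsetI)
  fix x assume x: "x \<in> ?L"
  then obtain S' where "S' \<in> T (Suc k)" "x \<in> S'"
    using T_cover[of x "Suc k"] T_in_space assms by blast
  then show "x \<in> ?R" using parent_unique_superset assms x by blast
next
  fix x assume "x \<in> ?R"
  then show "x \<in> ?L" using T_le_g by blast
qed

lemma nn_integral_Union_T:
  assumes "\<C> \<subseteq> T k" "f \<in> borel_measurable M"
  shows "(\<integral>\<^sup>+x. f x * indicator (\<Union>\<C>) x \<partial>M) = (\<Sum>S\<in>\<C>. \<integral>\<^sup>+x. f x * indicator S x \<partial>M)"
proof -
  have fin: "finite \<C>" using assms(1) finite_T finite_subset by blast
  have S: "\<And>S. S \<in> \<C> \<Longrightarrow> S \<in> sets M" using assms sets_T by auto
  have "indicator (\<Union>\<C>) x = (\<Sum>S\<in>\<C>. indicator S x :: ennreal)" for x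
  proof (cases "x \<in> \<Union>\<C>")
    case True
    then obtain S where S: "S \<in> \<C>" "x \<in> S" by blast
    have "(\<Sum>S\<in>\<C>. indicator S x :: ennreal) = (\<Sum>S\<in>{S}. indicator S x)"
      using S T_unique[of S k _ x] assms fin by (intro sum.mono_neutral_right) (auto simp: indicator_def)
    then show ?thesis using True S by simp
  qed (auto simp: indicator_def)
  then show ?thesis
    using assms(2) S by (simp add: sum_distrib_left nn_integral_sum)
qed

lemma emeasure_children:
  assumes "S \<in> T k"
  shows "(\<Sum>S'\<in>{S' \<in> T (Suc k). S' \<subseteq> S}. emeasure M S') \<le> ennreal ((1 / a) ^ 8) * emeasure M S"
proof -
  have "(\<Sum>S'\<in>{S' \<in> T (Suc k). S' \<subseteq> S}. emeasure M S')
      = (\<Sum>S'\<in>{S' \<in> T (Suc k). S' \<subseteq> S}. \<integral>\<^sup>+x. 1 * indicator S' x \<partial>M)"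
    using sets_T by (intro sum.cong) auto
  also have "\<dots> = (\<integral>\<^sup>+x. 1 * indicator (S \<inter> {x. Suc k \<le> g x}) x \<partial>M)"
    unfolding children_decomposition[OF assms] by (rule nn_integral_Union_T[symmetric]) auto
  also have "\<dots> = emeasure M (S \<inter> {x. Suc k \<le> g x})"
  proof -
    have "S \<inter> {x. Suc k \<le> g x} = S \<inter> {x \<in> space M. Suc k \<le> g x}"
      using T_in_space assms by blast
    also have "\<dots> \<in> sets M" using sets_T[OF assms] by measurable
    finally show ?thesis by simp
  qed
  also have "\<dots> \<le> ennreal ((1 / a) ^ 8 * measure M S)"
    using sparse[OF assms] a_gt_1
    by (simp add: emeasure_eq_measure power_one_over field_simps ennreal_leI)
  also have "\<dots> = ennreal ((1 / a) ^ 8) * emeasure M S"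
    using a_gt_1 by (simp add: emeasure_eq_measure ennreal_mult)
  finally show ?thesis .
qed

text \<open>Induction on \<open>j\<close> through the children of \<open>S\<close>: each step costs
  a factor \<open>(1 / a) ^ 8\<close> in total measure, and the hypothesis is applied only to the
  tents reached at the end, which are the last tents of the points in question.\<close>

lemma level_set_decay:
  assumes V [measurable]: "V \<in> borel_measurable M"
    and B: "\<And>k S. S \<in> T k \<Longrightarrow> (\<integral>\<^sup>+x. V x * indicator (S \<inter> {x. g x = k}) x \<partial>M) \<le> B * emeasure M S"
    and "S \<in> T k"
  shows "(\<integral>\<^sup>+x. V x * indicator (S \<inter> {x. g x = k + j}) x \<partial>M)
    \<le> ennreal ((1 / a) ^ (8 * j)) * B * emeasure M S"
  using assms(3)
proof (induction j arbitrary: k S)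
  case 0
  then show ?case using B by simp
next
  case (Suc j)
  let ?C = "{S' \<in> T (Suc k). S' \<subseteq> S}"
  have "(\<integral>\<^sup>+x. V x * indicator (S \<inter> {x. g x = k + Suc j}) x \<partial>M)
      = (\<integral>\<^sup>+x. (V x * indicator {x. g x = Suc k + j} x) * indicator (\<Union>?C) x \<partial>M)"
    unfolding children_decomposition[OF Suc.prems, symmetric]
    by (intro nn_integral_cong) (auto simp: indicator_def)
  also have "\<dots> = (\<Sum>S'\<in>?C. \<integral>\<^sup>+x. (V x * indicator {x. g x = Suc k + j} x) * indicator S' x \<partial>M)"
    by (rule nn_integral_Union_T) auto
  also have "\<dots> = (\<Sum>S'\<in>?C. \<integral>\<^sup>+x. V x * indicator (S' \<inter> {x. g x = Suc k + j}) x \<partial>M)"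
    by (intro sum.cong nn_integral_cong) (auto simp: indicator_def)
  also have "\<dots> \<le> (\<Sum>S'\<in>?C. ennreal ((1 / a) ^ (8 * j)) * B * emeasure M S')"
    using Suc.IH[of _ "Suc k"] by (intro sum_mono) auto
  also have "\<dots> = ennreal ((1 / a) ^ (8 * j)) * B * (\<Sum>S'\<in>?C. emeasure M S')"
    by (simp add: sum_distrib_left)
  also have "\<dots> \<le> ennreal ((1 / a) ^ (8 * j)) * B * (ennreal ((1 / a) ^ 8) * emeasure M S)"
    by (intro mult_left_mono emeasure_children Suc.prems) auto
  also have "\<dots> = ennreal ((1 / a) ^ (8 * j) * (1 / a) ^ 8) * B * emeasure M S"
    using a_gt_1 by (subst ennreal_mult) (auto simp: ac_simps)
  also have "(1 / a) ^ (8 * j) * (1 / a) ^ 8 = (1 / a) ^ (8 * Suc j)"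
    by (simp add: power_add[symmetric] add.commute)
  finally show ?case .
qed

abbreviation c\<^sub>a :: real where "c\<^sub>a \<equiv> 1 / (1 - (1 / a)\<^sup>2)"

lemma geometric_ennreal: "(\<Sum>j. ennreal ((1 / a) ^ (2 * j))) = ennreal c\<^sub>a"
proof -
  have "(1 / a)\<^sup>2 < 1" using a_gt_1 by (simp add: power_one_over field_simps)
  then have "(\<lambda>j. ((1 / a)\<^sup>2) ^ j) sums c\<^sub>a"
    using geometric_sums[of "(1 / a)\<^sup>2"] by (simp add: a_gt_1)
  then show ?thesis
    using a_gt_1 by (intro suminf_ennreal_eq) (auto simp: power_mult)
qed

text \<open>Split by the number \<open>j\<close> of generations between \<open>S\<close> and the
  last tent of the point: the weight \<open>a ^ (6 * j)\<close> meets the decay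
  \<open>(1 / a) ^ (8 * j)\<close>, and the remaining \<open>(1 / a) ^ (2 * j)\<close> sums to
  \<open>c\<^sub>a\<close>.\<close>

lemma weighted_tent_integral:
  assumes V [measurable]: "V \<in> borel_measurable M"
    and B: "\<And>k S. S \<in> T k \<Longrightarrow> (\<integral>\<^sup>+x. V x * indicator (S \<inter> {x. g x = k}) x \<partial>M) \<le> B * emeasure M S"
    and S: "S \<in> T k"
  shows "(\<integral>\<^sup>+x. ennreal (a ^ (6 * (g x - k))) * V x * indicator S x \<partial>M) \<le> ennreal c\<^sub>a * B * emeasure M S"
proof -
  have [measurable]: "S \<in> sets M" using S sets_T by blast
  have eq: "ennreal (a ^ (6 * (g x - k))) * V x * indicator S x
      = (\<Sum>j. ennreal (a ^ (6 * j)) * (V x * indicator (S \<inter> {x. g x = k + j}) x))" for x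
  proof (cases "x \<in> S")
    case True
    then have "k \<le> g x" using T_le_g S by blast
    then have "(\<Sum>j. ennreal (a ^ (6 * j)) * (V x * indicator (S \<inter> {x. g x = k + j}) x))
        = (\<Sum>j\<in>{g x - k}. ennreal (a ^ (6 * j)) * (V x * indicator (S \<inter> {x. g x = k + j}) x))"
      by (intro suminf_finite) (auto simp: indicator_def)
    then show ?thesis using True \<open>k \<le> g x\<close> by simp
  qed simp
  have "(\<integral>\<^sup>+x. ennreal (a ^ (6 * (g x - k))) * V x * indicator S x \<partial>M)
      = (\<Sum>j. \<integral>\<^sup>+x. ennreal (a ^ (6 * j)) * (V x * indicator (S \<inter> {x. g x = k + j}) x) \<partial>M)"
    unfolding eq by (intro nn_integral_suminf) auto
  also have "\<dots> = (\<Sum>j. ennreal (a ^ (6 * j)) * (\<integral>\<^sup>+x. V x * indicator (S \<inter> {x. g x = k + j}) x \<partial>M))"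
    by (intro suminf_cong nn_integral_cmult) auto
  also have "\<dots> \<le> (\<Sum>j. ennreal (a ^ (6 * j)) * (ennreal ((1 / a) ^ (8 * j)) * B * emeasure M S))"
    using level_set_decay[OF V B S] by (intro suminf_le mult_left_mono) auto
  also have "\<dots> = (\<Sum>j. ennreal ((1 / a) ^ (2 * j)) * (B * emeasure M S))"
  proof (intro suminf_cong)
    fix j
    have "a ^ (6 * j) * (1 / a) ^ (8 * j) = (1 / a) ^ (2 * j)"
    proof -
      have "8 * j = 6 * j + 2 * j" by simp
      then show ?thesis using a_gt_1 by (simp only: power_add) (simp add: power_one_over)
    qed
    moreover have "ennreal (a ^ (6 * j) * (1 / a) ^ (8 * j)) = ennreal (a ^ (6 * j)) * ennreal ((1 / a) ^ (8 * j))"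
      using a_gt_1 by (intro ennreal_mult) auto
    ultimately show "ennreal (a ^ (6 * j)) * (ennreal ((1 / a) ^ (8 * j)) * B * emeasure M S)
        = ennreal ((1 / a) ^ (2 * j)) * (B * emeasure M S)"
      by (simp add: mult.assoc)
  qed
  also have "\<dots> = ennreal c\<^sub>a * B * emeasure M S"
    by (simp add: geometric_ennreal mult.assoc)
  finally show ?thesis .
qed

lemma generation_sum_le: "(\<Sum>k. if k \<le> m then ennreal ((1 / a) ^ (2 * (m - k))) else 0) \<le> ennreal c\<^sub>a"
proof -
  have "(\<Sum>k. if k \<le> m then ennreal ((1 / a) ^ (2 * (m - k))) else 0)
      = (\<Sum>k\<le>m. ennreal ((1 / a) ^ (2 * (m - k))))"
    by (subst suminf_finite[of "{..m}"]) auto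
  also have "\<dots> = (\<Sum>j\<le>m. ennreal ((1 / a) ^ (2 * j)))"
    by (rule sum.nat_diff_reindex[of _ "Suc m", simplified lessThan_Suc_atMost, simplified])
  also have "\<dots> \<le> (\<Sum>j. ennreal ((1 / a) ^ (2 * j)))"
    by (intro sum_le_suminf) auto
  finally show ?thesis by (simp add: geometric_ennreal)
qed

lemma suminf_Cauchy_Schwarz:
  fixes u v :: "nat \<Rightarrow> ennreal"
  shows "(\<Sum>k. u k * v k)\<^sup>2 \<le> (\<Sum>k. (u k)\<^sup>2) * (\<Sum>k. (v k)\<^sup>2)"
  using Cauchy_Schwarz_nn_integral[of u "count_space UNIV" v] by (simp add: nn_integral_count_space_nat)

text \<open>The exponent 2 in both weights is the one that \<open>linear_le_power\<close> produces
  when the linear growth of the telescoped means is traded for a power of \<open>a\<close>.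
  Truncated subtraction is harmless: a tent of generation \<open>k\<close> contains only points of
  generation at least \<open>k\<close>.\<close>

definition tent_op :: "('a \<Rightarrow> ennreal) \<Rightarrow> 'a \<Rightarrow> ennreal" where
  "tent_op f x = (\<Sum>k. \<Sum>S\<in>T k. indicator S x * (ennreal (a ^ (2 * (g x - k))) *
     ((\<integral>\<^sup>+y. ennreal (a ^ (2 * (g y - k))) * f y * indicator S y \<partial>M) / emeasure M S)))"

lemma tent_op_measurable [measurable]: "tent_op f \<in> borel_measurable M"
  unfolding tent_op_def
  by (intro borel_measurable_suminf_order borel_measurable_sum borel_measurable_times_ennreal
      borel_measurable_indicator sets_T) measurable

text \<open>Cauchy-Schwarz in the generations, after writing \<open>a ^ (2 * i)\<close> as
  \<open>(1 / a) ^ i\<close> times \<open>a ^ (3 * i)\<close>: the squares of the first factors sum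
  to at most \<open>c\<^sub>a\<close>, those of the second give the exponent 6. Within one
  generation at most one term is nonzero, so squaring passes through the sum.\<close>

lemma tent_op_sq_le:
  "(tent_op f x)\<^sup>2 \<le> ennreal c\<^sub>a * (\<Sum>k. \<Sum>S\<in>T k. indicator S x * (ennreal (a ^ (6 * (g x - k))) *
     ((\<integral>\<^sup>+y. ennreal (a ^ (2 * (g y - k))) * f y * indicator S y \<partial>M) / emeasure M S)\<^sup>2))"
proof -
  define A where "A k S = (\<integral>\<^sup>+y. ennreal (a ^ (2 * (g y - k))) * f y * indicator S y \<partial>M) / emeasure M S" for k S
  define u where "u k = (if k \<le> g x then ennreal ((1 / a) ^ (g x - k)) else 0)" for k
  define v where "v k = (\<Sum>S\<in>T k. indicator S x * (ennreal (a ^ (3 * (g x - k))) * A k S))" for k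
  have split: "(\<Sum>S\<in>T k. indicator S x * (ennreal (a ^ (2 * (g x - k))) * A k S)) = u k * v k
     \<and> (v k)\<^sup>2 = (\<Sum>S\<in>T k. indicator S x * (ennreal (a ^ (6 * (g x - k))) * (A k S)\<^sup>2))" for k
  proof (cases "x \<in> space M \<and> k \<le> g x")
    case True
    then obtain S where S: "S \<in> T k" "x \<in> S" using T_cover by blast
    have "a ^ (2 * (g x - k)) = (1 / a) ^ (g x - k) * a ^ (3 * (g x - k))"
    proof -
      have "3 * (g x - k) = (g x - k) + 2 * (g x - k)" by simp
      then show ?thesis using a_gt_1 by (simp only: power_add) (simp add: power_one_over)
    qed
    then have 1: "ennreal (a ^ (2 * (g x - k))) = ennreal ((1 / a) ^ (g x - k)) * ennreal (a ^ (3 * (g x - k)))"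
      using a_gt_1 by (simp add: ennreal_mult)
    have "a ^ (6 * (g x - k)) = (a ^ (3 * (g x - k)))\<^sup>2"
      by (simp add: power_mult[symmetric])
    then have 2: "ennreal (a ^ (6 * (g x - k))) = (ennreal (a ^ (3 * (g x - k))))\<^sup>2"
      using a_gt_1 by (simp add: ennreal_power)
    show ?thesis
      unfolding v_def sum_T_eq[OF S] 1 2 using True by (simp add: u_def power_mult_distrib mult.assoc)
  next
    case False
    then have "x \<notin> S" if "S \<in> T k" for S using that T_le_g T_in_space by blast
    then show ?thesis by (simp add: v_def)
  qed
  have "(tent_op f x)\<^sup>2 = (\<Sum>k. u k * v k)\<^sup>2"
    unfolding tent_op_def A_def[symmetric] using split by simp
  also have "\<dots> \<le> (\<Sum>k. (u k)\<^sup>2) * (\<Sum>k. (v k)\<^sup>2)"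
    by (rule suminf_Cauchy_Schwarz)
  also have "(\<Sum>k. (u k)\<^sup>2) = (\<Sum>k. if k \<le> g x then ennreal ((1 / a) ^ (2 * (g x - k))) else 0)"
    using a_gt_1 by (intro suminf_cong) (auto simp: u_def ennreal_power power_mult[symmetric] mult.commute)
  also have "\<dots> * (\<Sum>k. (v k)\<^sup>2) \<le> ennreal c\<^sub>a * (\<Sum>k. (v k)\<^sup>2)"
    by (intro mult_right_mono generation_sum_le) auto
  finally show ?thesis using split by (simp add: A_def)
qed

text \<open>Cauchy-Schwarz in the integral with the same splitting: \<open>W\<close> takes
  \<open>a ^ (3 * j)\<close> and is absorbed by the hypothesis, while \<open>h\<close> keeps
  \<open>(1 / a) ^ j\<close>, which later makes the sum over generations converge. The factor
  \<open>emeasure M S\<close> on the left is the one that the integral of \<open>\<beta>\<close>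
  squared will contribute.\<close>

lemma average_sq_le:
  assumes [measurable]: "W \<in> borel_measurable M" "h \<in> borel_measurable M" and S: "S \<in> T k"
    and W: "(\<integral>\<^sup>+x. ennreal (a ^ (6 * (g x - k))) * (W x)\<^sup>2 * indicator S x \<partial>M) \<le> C * emeasure M S"
  shows "((\<integral>\<^sup>+y. ennreal (a ^ (2 * (g y - k))) * (W y * h y) * indicator S y \<partial>M) / emeasure M S)\<^sup>2 * emeasure M S
    \<le> C * (\<integral>\<^sup>+y. ennreal ((1 / a) ^ (2 * (g y - k))) * (h y)\<^sup>2 * indicator S y \<partial>M)"
proof -
  have [measurable]: "S \<in> sets M" using S sets_T by blast
  define I where "I = (\<integral>\<^sup>+y. ennreal ((1 / a) ^ (2 * (g y - k))) * (h y)\<^sup>2 * indicator S y \<partial>M)"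
  let ?u = "\<lambda>y. ennreal (a ^ (3 * (g y - k))) * W y * indicator S y"
  let ?v = "\<lambda>y. ennreal ((1 / a) ^ (g y - k)) * h y * indicator S y"
  have split: "ennreal (a ^ (2 * j)) = ennreal (a ^ (3 * j)) * ennreal ((1 / a) ^ j)" for j
  proof -
    have "3 * j = 2 * j + j" by simp
    then have "a ^ (2 * j) = a ^ (3 * j) * (1 / a) ^ j"
      using a_gt_1 by (simp only: power_add) (simp add: power_one_over)
    then show ?thesis using a_gt_1 by (simp add: ennreal_mult)
  qed
  have "(\<integral>\<^sup>+y. ennreal (a ^ (2 * (g y - k))) * (W y * h y) * indicator S y \<partial>M) = (\<integral>\<^sup>+y. ?u y * ?v y \<partial>M)"
    unfolding split by (intro nn_integral_cong) (auto simp: indicator_def ac_simps)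
  then have "(\<integral>\<^sup>+y. ennreal (a ^ (2 * (g y - k))) * (W y * h y) * indicator S y \<partial>M)\<^sup>2
      \<le> (\<integral>\<^sup>+y. (?u y)\<^sup>2 \<partial>M) * (\<integral>\<^sup>+y. (?v y)\<^sup>2 \<partial>M)"
    by (simp only:) (rule Cauchy_Schwarz_nn_integral; measurable)
  also have "(\<integral>\<^sup>+y. (?u y)\<^sup>2 \<partial>M) = (\<integral>\<^sup>+x. ennreal (a ^ (6 * (g x - k))) * (W x)\<^sup>2 * indicator S x \<partial>M)"
    using a_gt_1 by (intro nn_integral_cong)
      (auto simp: indicator_def power_mult_distrib ennreal_power power_mult[symmetric])
  also have "(\<integral>\<^sup>+y. (?v y)\<^sup>2 \<partial>M) = I"
    unfolding I_def using a_gt_1 by (intro nn_integral_cong)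
      (auto simp: indicator_def power_mult_distrib ennreal_power power_mult[symmetric] mult.commute)
  also have "(\<integral>\<^sup>+x. ennreal (a ^ (6 * (g x - k))) * (W x)\<^sup>2 * indicator S x \<partial>M) * I \<le> C * emeasure M S * I"
    by (intro mult_right_mono W) auto
  finally have *: "(\<integral>\<^sup>+y. ennreal (a ^ (2 * (g y - k))) * (W y * h y) * indicator S y \<partial>M)\<^sup>2 \<le> C * emeasure M S * I"
    (is "?J\<^sup>2 \<le> _") .
  have pos: "emeasure M S \<noteq> 0" "emeasure M S \<noteq> \<infinity>"
    using emeasure_T_pos[OF S] by auto
  have "(?J / emeasure M S)\<^sup>2 * emeasure M S = ?J\<^sup>2 / emeasure M S"
    using pos by (simp add: power2_eq_square ennreal_times_divide ennreal_divide_times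
      mult_divide_eq_ennreal divide_mult_eq)
  also have "\<dots> \<le> C * emeasure M S * I / emeasure M S"
    using * by (rule divide_right_mono_ennreal)
  also have "\<dots> = C * I"
    using pos by (metis ennreal_mult_divide_eq infinity_ennreal_def mult.assoc mult.commute)
  finally show ?thesis by (simp add: I_def)
qed

text \<open>The four factors \<open>c\<^sub>a\<close> come from the sum over the generations around
  \<open>x\<close>, from the weighted integrals of \<open>\<beta>\<close> and of \<open>W\<close>,
  and from the sum over the generations around \<open>y\<close>.\<close>

proposition tent_op_Schur:
  assumes [measurable]: "\<beta> \<in> borel_measurable M" "W \<in> borel_measurable M" "h \<in> borel_measurable M"
    and \<beta>: "\<And>k S. S \<in> T k \<Longrightarrow> (\<integral>\<^sup>+x. (\<beta> x)\<^sup>2 * indicator (S \<inter> {x. g x = k}) x \<partial>M) \<le> B * emeasure M S"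
    and W: "\<And>k S. S \<in> T k \<Longrightarrow> (\<integral>\<^sup>+x. (W x)\<^sup>2 * indicator (S \<inter> {x. g x = k}) x \<partial>M) \<le> B * emeasure M S"
  shows "(\<integral>\<^sup>+x. (\<beta> x * tent_op (\<lambda>y. W y * h y) x)\<^sup>2 \<partial>M)
    \<le> ennreal c\<^sub>a * (ennreal c\<^sub>a * B * (ennreal c\<^sub>a * B * (ennreal c\<^sub>a * (\<integral>\<^sup>+x. (h x)\<^sup>2 \<partial>M))))"
proof -
  define A where "A k S = (\<integral>\<^sup>+y. ennreal (a ^ (2 * (g y - k))) * (W y * h y) * indicator S y \<partial>M) / emeasure M S" for k S
  define I where "I k S = (\<integral>\<^sup>+y. ennreal ((1 / a) ^ (2 * (g y - k))) * (h y)\<^sup>2 * indicator S y \<partial>M)" for k S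
  have tent: "(A k S)\<^sup>2 * (\<integral>\<^sup>+x. ennreal (a ^ (6 * (g x - k))) * (\<beta> x)\<^sup>2 * indicator S x \<partial>M)
     \<le> ennreal c\<^sub>a * B * (ennreal c\<^sub>a * B * I k S)" if S: "S \<in> T k" for k S
  proof -
    have "(\<integral>\<^sup>+x. ennreal (a ^ (6 * (g x - k))) * (\<beta> x)\<^sup>2 * indicator S x \<partial>M) \<le> ennreal c\<^sub>a * B * emeasure M S"
      by (rule weighted_tent_integral[OF _ \<beta> S]) auto
    then have "(A k S)\<^sup>2 * (\<integral>\<^sup>+x. ennreal (a ^ (6 * (g x - k))) * (\<beta> x)\<^sup>2 * indicator S x \<partial>M)
      \<le> (A k S)\<^sup>2 * (ennreal c\<^sub>a * B * emeasure M S)"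
      by (intro mult_left_mono) auto
    also have "\<dots> = ennreal c\<^sub>a * B * ((A k S)\<^sup>2 * emeasure M S)" by (simp only: ac_simps)
    also have "\<dots> \<le> ennreal c\<^sub>a * B * (ennreal c\<^sub>a * B * I k S)"
      unfolding A_def I_def
      by (intro mult_left_mono average_sq_le S weighted_tent_integral[OF _ W S]) auto
    finally show ?thesis .
  qed
  have "(\<integral>\<^sup>+x. (\<beta> x * tent_op (\<lambda>y. W y * h y) x)\<^sup>2 \<partial>M)
      \<le> (\<integral>\<^sup>+x. ennreal c\<^sub>a * (\<Sum>k. \<Sum>S\<in>T k. (A k S)\<^sup>2 * (ennreal (a ^ (6 * (g x - k))) * (\<beta> x)\<^sup>2 * indicator S x)) \<partial>M)"
  proof (intro nn_integral_mono)
    fix x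
    have "(\<beta> x * tent_op (\<lambda>y. W y * h y) x)\<^sup>2 = (\<beta> x)\<^sup>2 * (tent_op (\<lambda>y. W y * h y) x)\<^sup>2"
      by (simp add: power_mult_distrib)
    also have "\<dots> \<le> (\<beta> x)\<^sup>2 * (ennreal c\<^sub>a * (\<Sum>k. \<Sum>S\<in>T k. indicator S x * (ennreal (a ^ (6 * (g x - k))) * (A k S)\<^sup>2)))"
      unfolding A_def by (intro mult_left_mono tent_op_sq_le) auto
    also have "\<dots> = ennreal c\<^sub>a * (\<Sum>k. \<Sum>S\<in>T k. (\<beta> x)\<^sup>2 * (indicator S x * (ennreal (a ^ (6 * (g x - k))) * (A k S)\<^sup>2)))"
      by (simp only: ennreal_suminf_cmult sum_distrib_left[symmetric] mult.left_commute[of "(\<beta> x)\<^sup>2" "ennreal c\<^sub>a"])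
    finally show "(\<beta> x * tent_op (\<lambda>y. W y * h y) x)\<^sup>2 \<le> ennreal c\<^sub>a * (\<Sum>k. \<Sum>S\<in>T k. (A k S)\<^sup>2 * (ennreal (a ^ (6 * (g x - k))) * (\<beta> x)\<^sup>2 * indicator S x))"
      by (simp add: ac_simps)
  qed
  also have "\<dots> = ennreal c\<^sub>a * (\<Sum>k. \<Sum>S\<in>T k. (A k S)\<^sup>2 * (\<integral>\<^sup>+x. ennreal (a ^ (6 * (g x - k))) * (\<beta> x)\<^sup>2 * indicator S x \<partial>M))"
  proof -
    have m [measurable]: "(\<lambda>x. ennreal (a ^ (6 * (g x - k))) * (\<beta> x)\<^sup>2 * indicator S x) \<in> borel_measurable M"
      if "S \<in> T k" for k S
      using sets_T[OF that] by measurable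
    have m2: "(\<lambda>x. \<Sum>S\<in>T k. (A k S)\<^sup>2 * (ennreal (a ^ (6 * (g x - k))) * (\<beta> x)\<^sup>2 * indicator S x)) \<in> borel_measurable M" for k
      by (intro borel_measurable_sum borel_measurable_times_ennreal m) auto
    show ?thesis
      using m m2 by (simp add: nn_integral_cmult nn_integral_suminf nn_integral_sum)
  qed
  also have "\<dots> \<le> ennreal c\<^sub>a * (\<Sum>k. \<Sum>S\<in>T k. ennreal c\<^sub>a * B * (ennreal c\<^sub>a * B * I k S))"
    using tent by (intro mult_left_mono suminf_le sum_mono) auto
  also have "\<dots> = ennreal c\<^sub>a * (ennreal c\<^sub>a * B * (ennreal c\<^sub>a * B * (\<Sum>k. \<Sum>S\<in>T k. I k S)))"
    by (simp add: sum_distrib_left[symmetric])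
  also have "(\<Sum>k. \<Sum>S\<in>T k. I k S) \<le> ennreal c\<^sub>a * (\<integral>\<^sup>+x. (h x)\<^sup>2 \<partial>M)"
  proof -
    \<comment> \<open>The tents of one generation are disjoint and cover exactly the points with
      \<open>k \<le> g y\<close>, so each generation gives a single integral; the decay left with
      \<open>h\<close> is then summed over \<open>k\<close>.\<close>
    have "(\<Sum>S\<in>T k. I k S) = (\<integral>\<^sup>+y. (ennreal ((1 / a) ^ (2 * (g y - k))) * (h y)\<^sup>2) * indicator (\<Union>(T k)) y \<partial>M)" for k
      unfolding I_def by (rule nn_integral_Union_T[symmetric]) auto
    also have "(\<integral>\<^sup>+y. (ennreal ((1 / a) ^ (2 * (g y - k))) * (h y)\<^sup>2) * indicator (\<Union>(T k)) y \<partial>M)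
        = (\<integral>\<^sup>+y. (if k \<le> g y then ennreal ((1 / a) ^ (2 * (g y - k))) else 0) * (h y)\<^sup>2 \<partial>M)" for k
      unfolding Union_T by (intro nn_integral_cong) (auto simp: indicator_def)
    finally have "(\<Sum>k. \<Sum>S\<in>T k. I k S)
        = (\<integral>\<^sup>+y. (\<Sum>k. if k \<le> g y then ennreal ((1 / a) ^ (2 * (g y - k))) else 0) * (h y)\<^sup>2 \<partial>M)"
      by (simp add: nn_integral_suminf[symmetric] ennreal_suminf_multc)
    also have "\<dots> \<le> (\<integral>\<^sup>+y. ennreal c\<^sub>a * (h y)\<^sup>2 \<partial>M)"
      by (intro nn_integral_mono mult_right_mono generation_sum_le) auto
    finally show ?thesis by (simp add: nn_integral_cmult)
  qed
  finally show ?thesis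
    by (meson mult_left_mono order_trans zero_le)
qed

end

section \<open>Weak-type estimate for the oscillation operator\<close>

definition llog :: "real \<Rightarrow> real \<Rightarrow> real" where
  "llog \<epsilon> u = u * (1 + log_plus u) powr \<epsilon>"

lemma log_plus_nonneg: "0 \<le> log_plus u"
  by (simp add: log_plus_def)

lemma log_plus_measurable [measurable]: "log_plus \<in> borel_measurable borel"
  unfolding log_plus_def[abs_def] by measurable

lemma llog_measurable [measurable]: "llog \<epsilon> \<in> borel_measurable borel"
  unfolding llog_def[abs_def] by measurable

lemma le_exp_log_plus: "u \<le> exp (log_plus u)"
proof (cases "0 < u")
  case True
  then have "u = exp (ln u)" by simp
  also have "\<dots> \<le> exp (log_plus u)" by (simp add: log_plus_def)
  finally show ?thesis .
next
  case False
  then show ?thesis using exp_ge_zero[of "log_plus u"] by linarith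
qed

lemma le_llog:
  assumes "0 \<le> u" "0 < \<epsilon>"
  shows "u \<le> llog \<epsilon> u"
proof -
  have "1 \<le> (1 + log_plus u) powr \<epsilon>"
    using log_plus_nonneg[of u] assms by (intro ge_one_powr_ge_zero) auto
  then show ?thesis
    using assms mult_left_mono[of 1 "(1 + log_plus u) powr \<epsilon>" u] by (simp add: llog_def)
qed

lemma llog_nonneg: "0 \<le> u \<Longrightarrow> 0 \<le> llog \<epsilon> u"
  by (simp add: llog_def)

lemma llog_mono:
  assumes "0 \<le> u" "u \<le> v" "0 < \<epsilon>"
  shows "llog \<epsilon> u \<le> llog \<epsilon> v"
proof -
  have "log_plus u \<le> log_plus v"
    \<comment> \<open>By convention \<open>ln 0 = 0\<close>, so \<open>log_plus\<close> vanishes at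
      0 and monotonicity of the logarithm is needed for positive arguments only.\<close>
    using assms by (cases "u = 0") (auto simp: log_plus_def intro!: max.coboundedI2 ln_mono)
  then show ?thesis
    unfolding llog_def using assms log_plus_nonneg[of u] by (intro mult_mono powr_mono2) auto
qed

text \<open>A substitute for homogeneity, used to pull constants out of Phi. One factor
  \<open>\<kappa>\<close> comes from the argument, the other from the logarithmic factor, by
  \<open>1 + ln \<kappa> \<le> \<kappa>\<close> and \<open>\<epsilon> \<le> 1\<close>.\<close>

lemma llog_mult_le:
  assumes \<kappa>: "1 \<le> \<kappa>" and u: "0 \<le> u" and \<epsilon>: "0 < \<epsilon>" "\<epsilon> \<le> 1"
  shows "llog \<epsilon> (\<kappa> * u) \<le> \<kappa>\<^sup>2 * llog \<epsilon> u"
proof (cases "u = 0")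
  case False
  then have u0: "0 < u" using u by simp
  have lk: "0 \<le> ln \<kappa>" "1 + ln \<kappa> \<le> \<kappa>" using \<kappa> ln_le_minus_one[of \<kappa>] by auto
  have lp: "0 \<le> log_plus u" by (rule log_plus_nonneg)
  have "log_plus (\<kappa> * u) \<le> ln \<kappa> + log_plus u"
    using \<kappa> u0 lk by (auto simp: log_plus_def ln_mult)
  moreover have "0 \<le> ln \<kappa> * log_plus u" using lk lp by simp
  ultimately have "1 + log_plus (\<kappa> * u) \<le> (1 + ln \<kappa>) * (1 + log_plus u)"
    by (simp add: algebra_simps)
  also have "\<dots> \<le> \<kappa> * (1 + log_plus u)"
    using lk lp by (intro mult_right_mono) auto
  finally have "(1 + log_plus (\<kappa> * u)) powr \<epsilon> \<le> (\<kappa> * (1 + log_plus u)) powr \<epsilon>"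
    using \<epsilon> log_plus_nonneg[of "\<kappa> * u"] by (intro powr_mono2) auto
  also have "\<dots> = \<kappa> powr \<epsilon> * (1 + log_plus u) powr \<epsilon>"
    by (rule powr_mult)
  also have "\<dots> \<le> \<kappa> * (1 + log_plus u) powr \<epsilon>"
    using \<kappa> \<epsilon> powr_mono[of \<epsilon> 1 \<kappa>] by (intro mult_right_mono) auto
  finally have "\<kappa> * u * (1 + log_plus (\<kappa> * u)) powr \<epsilon> \<le> \<kappa> * u * (\<kappa> * (1 + log_plus u) powr \<epsilon>)"
    using \<kappa> u by (intro mult_left_mono) auto
  then show ?thesis by (simp add: llog_def power2_eq_square mult_ac)
qed (simp add: llog_def)

lemma sq_le_exp_half:
  assumes "0 \<le> (s::real)"
  shows "s\<^sup>2 \<le> 8 * exp (s / 2)"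
proof -
  have "1 + s / 2 + (s / 2)\<^sup>2 / 2 \<le> exp (s / 2)"
    using assms exp_lower_Taylor_quadratic[of "s / 2"] by simp
  then show ?thesis using assms by (simp add: power_divide)
qed

lemma le_powr_self:
  assumes "1 \<le> (t::real)" "1 \<le> p"
  shows "t \<le> t powr p"
  using powr_mono[of 1 p t] assms by simp

text \<open>Turns exponential bounds on the oscillation into first-moment bounds; for
  \<open>t < 1\<close> the right-hand side is already at least 1.\<close>

lemma le_exp_powr:
  assumes "0 \<le> (t::real)" "1 \<le> p"
  shows "t \<le> exp (t powr p)"
proof (cases "1 \<le> t")
  case True
  then have "t \<le> t powr p" using assms le_powr_self by simp
  also have "\<dots> \<le> exp (t powr p)" using exp_ge_add_one_self[of "t powr p"] by linarith
  finally show ?thesis .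
next
  case False
  moreover have "1 \<le> exp (t powr p)" by simp
  ultimately show ?thesis by linarith
qed

text \<open>Bounds the square of the outer weight \<open>1 + top_osc x\<close> by the exponential
  whose averages are controlled.\<close>

lemma one_plus_sq_le_exp:
  assumes "0 \<le> (t::real)" "1 \<le> p"
  shows "(1 + t)\<^sup>2 \<le> 32 * exp (t powr p)"
proof (cases "1 \<le> t")
  case True
  let ?s = "t powr p"
  have "t \<le> ?s" using True assms le_powr_self by simp
  then have "(1 + t)\<^sup>2 \<le> (2 * ?s)\<^sup>2" using True by (intro power_mono) auto
  also have "\<dots> \<le> 32 * exp (?s / 2)" using sq_le_exp_half[of ?s] by (simp add: power_mult_distrib)
  also have "\<dots> \<le> 32 * exp ?s" by simp
  finally show ?thesis .
next
  case False
  then have "(1 + t)\<^sup>2 \<le> 2\<^sup>2" using assms by (intro power_mono) auto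
  also have "(2::real)\<^sup>2 \<le> 32 * 1" by simp
  also have "\<dots> \<le> 32 * exp (t powr p)" by (intro mult_left_mono) auto
  finally show ?thesis .
qed

text \<open>If \<open>t\<close> is at most twice \<open>(1 + log_plus u) powr \<epsilon>\<close>, then the first square root alone
  controls the left-hand side; otherwise \<open>u\<close> is at most the root of \<open>exp (t powr (1 / \<epsilon>))\<close>.\<close>

lemma young_llog_exp:
  assumes u: "0 \<le> u" and t: "0 \<le> t" and \<epsilon>: "0 < \<epsilon>" "\<epsilon> \<le> 1"
  shows "(1 + t) * u \<le> 4 * (sqrt (llog \<epsilon> u + exp (t powr (1 / \<epsilon>))) * sqrt (llog \<epsilon> u))"
proof -
  define L where "L = 1 + log_plus u"
  define s where "s = t powr (1 / \<epsilon>)"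
  have L: "1 \<le> L" using log_plus_nonneg by (simp add: L_def)
  have L1: "1 \<le> L powr \<epsilon>" using L \<epsilon> by (intro ge_one_powr_ge_zero) auto
  have p: "1 \<le> 1 / \<epsilon>" using \<epsilon> by simp
  have uu: "u \<le> llog \<epsilon> u" using le_llog u \<epsilon> by simp
  have "((1 + t) * u)\<^sup>2 \<le> 16 * ((llog \<epsilon> u + exp s) * llog \<epsilon> u)"
  proof (cases "t \<le> 2 * L powr \<epsilon>")
    case True
    then have "1 + t \<le> 3 * L powr \<epsilon>" using L1 by linarith
    then have "(1 + t) * u \<le> 3 * L powr \<epsilon> * u" using u by (intro mult_right_mono) auto
    then have "(1 + t) * u \<le> 3 * llog \<epsilon> u" by (simp add: llog_def L_def mult_ac)
    then have "((1 + t) * u)\<^sup>2 \<le> (3 * llog \<epsilon> u)\<^sup>2" using u t by (intro power_mono) auto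
    also have "\<dots> = 9 * (llog \<epsilon> u * llog \<epsilon> u)" by (simp add: power2_eq_square)
    also have "\<dots> \<le> 16 * ((llog \<epsilon> u + exp s) * llog \<epsilon> u)"
      using llog_nonneg[OF u, of \<epsilon>] by (intro mult_mono mult_right_mono) auto
    finally show ?thesis .
  next
    case False
    then have t2: "2 * L powr \<epsilon> < t" by simp
    then have t1: "2 \<le> t" using L1 by linarith
    \<comment> \<open>Here \<open>\<epsilon> \<le> 1\<close> enters: the power
      \<open>1 / \<epsilon>\<close> turns the 2 of the case distinction into at least 2, so that
      \<open>s\<close> dominates \<open>2 * L\<close> and \<open>u\<close> is controlled by
      \<open>exp (s / 2)\<close>.\<close>
    have "(2 * L powr \<epsilon>) powr (1 / \<epsilon>) \<le> s"
      unfolding s_def using t2 \<epsilon> L1 by (intro powr_mono2) auto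
    moreover have "(2 * L powr \<epsilon>) powr (1 / \<epsilon>) = 2 powr (1 / \<epsilon>) * L"
      using L \<epsilon> by (simp add: powr_mult powr_powr)
    moreover have "2 * L \<le> 2 powr (1 / \<epsilon>) * L"
      using L le_powr_self[of 2 "1 / \<epsilon>"] p by (intro mult_right_mono) auto
    ultimately have sL: "2 * L \<le> s" by linarith
    have "u \<le> exp (L - 1)" using le_exp_log_plus by (simp add: L_def)
    also have "\<dots> \<le> exp (s / 2 - 1)" using sL by simp
    also have "\<dots> = exp (s / 2) / exp 1" by (simp add: exp_diff)
    also have "\<dots> \<le> exp (s / 2) / 2" using exp_ge_add_one_self[of 1] by (intro divide_left_mono) auto
    finally have ue: "u \<le> exp (s / 2) / 2" .
    have "t \<le> s" unfolding s_def using t1 p le_powr_self by simp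
    \<comment> \<open>From \<open>2 \<le> t\<close> follows \<open>1 + t \<le> 3 / 2 * t\<close>.
      The square of \<open>s\<close> uses one half of the exponent and one factor \<open>u\<close>
      the other half; the second \<open>u\<close> goes into
      \<open>llog \<epsilon> u\<close>.\<close>
    then have "(1 + t)\<^sup>2 \<le> (3 / 2 * s)\<^sup>2" using t1 by (intro power_mono) auto
    also have "\<dots> = 9 / 4 * s\<^sup>2" by (simp add: power_mult_distrib power_divide)
    also have "\<dots> \<le> 18 * exp (s / 2)" using sq_le_exp_half[of s] by (simp add: s_def)
    finally have "(1 + t)\<^sup>2 * u \<le> 18 * exp (s / 2) * (exp (s / 2) / 2)"
      using ue u by (intro mult_mono) auto
    also have "\<dots> = 9 * exp s" by (simp add: mult.assoc exp_add[symmetric])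
    finally have "(1 + t)\<^sup>2 * u \<le> 9 * exp s" .
    from mult_mono[OF this uu] have "(1 + t)\<^sup>2 * u * u \<le> 9 * exp s * llog \<epsilon> u"
      using u by simp
    also have "\<dots> \<le> 16 * exp s * llog \<epsilon> u"
      using llog_nonneg[OF u, of \<epsilon>] by (intro mult_right_mono) auto
    also have "\<dots> \<le> 16 * ((llog \<epsilon> u + exp s) * llog \<epsilon> u)"
      using llog_nonneg[OF u, of \<epsilon>] by (simp add: algebra_simps)
    finally show ?thesis by (simp add: power_mult_distrib power2_eq_square mult_ac)
  qed
  then have "(1 + t) * u \<le> sqrt (16 * ((llog \<epsilon> u + exp s) * llog \<epsilon> u))"
    by (rule real_le_rsqrt)
  then show ?thesis by (simp add: real_sqrt_mult s_def)
qed

section \<open>Oscillation relative to the last tent of a point\<close>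

context sparse_tree
begin

text \<open>This is the smallest tent around \<open>x\<close>, the end of its chain of
  tents.\<close>

definition top_tent :: "'a \<Rightarrow> 'a set" where
  "top_tent x = (THE S. S \<in> T (g x) \<and> x \<in> S)"

lemma top_tent_eq: "S \<in> T (g x) \<Longrightarrow> x \<in> S \<Longrightarrow> top_tent x = S"
  unfolding top_tent_def using T_unique by (intro the_equality) auto

lemma top_tent:
  assumes "x \<in> space M"
  shows "top_tent x \<in> T (g x)" "x \<in> top_tent x"
proof -
  obtain S where "S \<in> T (g x)" "x \<in> S" using T_cover assms by blast
  then show "top_tent x \<in> T (g x)" "x \<in> top_tent x" using top_tent_eq by auto
qed

text \<open>The last tent is constant on each of the countably many pieces
  \<open>S \<inter> {x. g x = k}\<close> with \<open>S\<close> in \<open>T k\<close>.\<close>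

lemma top_tent_measurable:
  assumes "\<And>S k. S \<in> T k \<Longrightarrow> (\<lambda>x. \<phi> S x) \<in> borel_measurable M"
  shows "(\<lambda>x. \<phi> (top_tent x) x) \<in> borel_measurable M"
proof (rule measurable_piecewise_restrict[where C = "\<Union>k. (\<lambda>S. S \<inter> {x \<in> space M. g x = k}) ` T k"])
  show "countable (\<Union>k. (\<lambda>S. S \<inter> {x \<in> space M. g x = k}) ` T k)"
    using finite_T by (intro countable_UN countable_image) (auto simp: countable_finite)
  show "space M \<subseteq> \<Union>(\<Union>k. (\<lambda>S. S \<inter> {x \<in> space M. g x = k}) ` T k)"
    using top_tent by blast
  fix \<Omega> assume "\<Omega> \<in> (\<Union>k. (\<lambda>S. S \<inter> {x \<in> space M. g x = k}) ` T k)"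
  then obtain k S where S: "S \<in> T k" and \<Omega>: "\<Omega> = S \<inter> {x \<in> space M. g x = k}" by blast
  show "\<Omega> \<inter> space M \<in> sets M"
    unfolding \<Omega> using sets_T[OF S] by measurable
  have "(\<lambda>x. \<phi> S x) \<in> borel_measurable (restrict_space M \<Omega>)"
    using assms[OF S] by (rule measurable_restrict_space1)
  moreover have "\<phi> (top_tent x) x = \<phi> S x" if "x \<in> space (restrict_space M \<Omega>)" for x
    using that top_tent_eq S by (auto simp: space_restrict_space \<Omega>)
  ultimately show "(\<lambda>x. \<phi> (top_tent x) x) \<in> borel_measurable (restrict_space M \<Omega>)"
    using measurable_cong by (metis (mono_tags, lifting))
qed

end

text \<open>The constants \<open>m S\<close> are arbitrary, with the means of \<open>b\<close> in
  mind. The exponential bound passes to subfamilies of tents, so that the same \<open>b\<close>,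
  \<open>m\<close>, \<open>p\<close> and \<open>B\<close> serve the stopped tree.\<close>

locale oscillation_on_tree = sparse_tree +
  fixes b :: "'a \<Rightarrow> complex" and m :: "'a set \<Rightarrow> complex" and p B :: real
  assumes b_measurable [measurable]: "b \<in> borel_measurable M"
    and p_ge_1: "1 \<le> p" and B_nonneg: "0 \<le> B"
    and exp_osc: "S \<in> T k \<Longrightarrow>
      (\<integral>\<^sup>+x. ennreal (exp (norm (b x - m S) powr p)) * indicator S x \<partial>M) \<le> ennreal B * emeasure M S"
begin

abbreviation J :: real where "J \<equiv> B + D * B"

abbreviation top_osc :: "'a \<Rightarrow> real" where
  "top_osc x \<equiv> norm (b x - m (top_tent x))"

lemma top_osc_measurable [measurable]: "top_osc \<in> borel_measurable M"
  by (rule top_tent_measurable) measurable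

text \<open>Integrate the triangle inequality over the smaller tent. The oscillation about
  \<open>m S'\<close> contributes \<open>B\<close>; that about \<open>m S\<close> is integrated over
  all of \<open>S\<close>, at the cost of the factor \<open>D\<close>.\<close>

lemma mean_jump:
  assumes "S' \<in> T (Suc k)" "S \<in> T k" "S' \<subseteq> S" "measure M S \<le> D * measure M S'"
  shows "norm (m S' - m S) \<le> J"
proof -
  have [measurable]: "S \<in> sets M" "S' \<in> sets M" using assms sets_T by auto
  have "ennreal (norm (m S' - m S)) * emeasure M S' = (\<integral>\<^sup>+x. ennreal (norm (m S' - m S)) * indicator S' x \<partial>M)"
    by (rule nn_integral_cmult_indicator[symmetric]) simp
  also have "\<dots> \<le> (\<integral>\<^sup>+x. ennreal (exp (norm (b x - m S') powr p)) * indicator S' x +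
      ennreal (exp (norm (b x - m S) powr p)) * indicator S x \<partial>M)"
  proof (intro nn_integral_mono)
    fix x
    have "norm (m S' - m S) \<le> norm (b x - m S') + norm (b x - m S)"
      using norm_triangle_ineq4[of "b x - m S" "b x - m S'"] by simp
    also have "\<dots> \<le> exp (norm (b x - m S') powr p) + exp (norm (b x - m S) powr p)"
      using p_ge_1 by (intro add_mono le_exp_powr) auto
    finally show "ennreal (norm (m S' - m S)) * indicator S' x \<le>
        ennreal (exp (norm (b x - m S') powr p)) * indicator S' x +
        ennreal (exp (norm (b x - m S) powr p)) * indicator S x"
      using assms(3) by (auto simp: indicator_def ennreal_plus[symmetric] intro!: ennreal_leI simp del: ennreal_plus)
  qed
  also have "\<dots> = (\<integral>\<^sup>+x. ennreal (exp (norm (b x - m S') powr p)) * indicator S' x \<partial>M) +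
      (\<integral>\<^sup>+x. ennreal (exp (norm (b x - m S) powr p)) * indicator S x \<partial>M)"
    by (intro nn_integral_add) auto
  also have "\<dots> \<le> ennreal B * emeasure M S' + ennreal B * emeasure M S"
    using assms by (intro add_mono exp_osc)
  also have "\<dots> = ennreal (B * measure M S' + B * measure M S)"
    using B_nonneg by (simp add: emeasure_eq_measure ennreal_mult)
  also have "\<dots> \<le> ennreal (J * measure M S')"
    using mult_left_mono[OF assms(4) B_nonneg] by (intro ennreal_leI) (simp add: algebra_simps)
  finally have "norm (m S' - m S) * measure M S' \<le> J * measure M S'"
    using B_nonneg D_ge_1 by (simp add: emeasure_eq_measure ennreal_mult[symmetric] ennreal_le_iff)
  then show ?thesis using measure_T_pos[OF assms(1)] by simp
qed

lemma mean_chain: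
  assumes "S \<in> T k" "S' \<in> T (k + i)" "x \<in> S" "x \<in> S'"
  shows "norm (m S' - m S) \<le> J * real i"
  using assms
proof (induction i arbitrary: S')
  case 0
  then have "S' = S" using T_unique by auto
  then show ?case by simp
next
  case (Suc i)
  then have S': "S' \<in> T (Suc (k + i))" by simp
  obtain S1 where S1: "S1 \<in> T (k + i)" "S' \<subseteq> S1" "measure M S1 \<le> D * measure M S'"
    using parent[OF S'] by blast
  have "norm (m S' - m S1) \<le> J" using mean_jump S' S1 by blast
  moreover have "norm (m S1 - m S) \<le> J * real i" using Suc S1 by blast
  ultimately show ?case
    using norm_triangle_ineq[of "m S' - m S1" "m S1 - m S"] by (simp add: algebra_simps)
qed

text \<open>Chosen so that \<open>J \<le> growth * (a\<^sup>2 - 1)\<close>, the slope that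
  Bernoulli's inequality for \<open>(1 + (a\<^sup>2 - 1)) ^ i\<close> can absorb.\<close>

definition growth :: real where
  "growth = max 1 (J / (a\<^sup>2 - 1))"

lemma linear_le_power: "1 + J * real i \<le> growth * a ^ (2 * i)"
proof -
  have a: "0 < a\<^sup>2 - 1" using a_gt_1 by (simp add: power_gt1)
  have "J \<le> growth * (a\<^sup>2 - 1)"
    using a by (simp add: growth_def pos_divide_le_eq[symmetric])
  then have "1 + J * real i \<le> growth * 1 + growth * (a\<^sup>2 - 1) * real i"
    by (intro add_mono mult_right_mono) (auto simp: growth_def)
  also have "\<dots> = growth * (1 + real i * (a\<^sup>2 - 1))" by (simp add: algebra_simps)
  also have "\<dots> \<le> growth * (1 + (a\<^sup>2 - 1)) ^ i"
    using a by (intro mult_left_mono Bernoulli_inequality) (auto simp: growth_def)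
  finally show ?thesis by (simp add: power_mult)
qed

text \<open>Both values are compared with \<open>m S\<close>, each through the mean over its own
  last tent. The sum is then deliberately weakened to a product, by
  \<open>u + v \<le> (1 + u) * (1 + v)\<close>, so that the bound separates into a function of
  \<open>x\<close> and one of \<open>y\<close>.\<close>

lemma pointwise_osc:
  assumes S: "S \<in> T k" "x \<in> S" "y \<in> S"
  shows "norm (b x - b y) \<le> growth\<^sup>2 * ((1 + top_osc x) * a ^ (2 * (g x - k)) * ((1 + top_osc y) * a ^ (2 * (g y - k))))"
proof -
  have one: "norm (b z - m S) \<le> top_osc z + J * real (g z - k)" if "z \<in> S" for z
  proof -
    have z: "z \<in> space M" "k \<le> g z" using that S T_in_space T_le_g by blast+
    have "norm (m (top_tent z) - m S) \<le> J * real (g z - k)"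
      using mean_chain[of S k "top_tent z" "g z - k" z] top_tent[OF z(1)] S that z by simp
    then show ?thesis
      using norm_triangle_ineq[of "b z - m (top_tent z)" "m (top_tent z) - m S"] by simp
  qed
  have fac: "1 + top_osc z + J * real (g z - k) \<le> growth * ((1 + top_osc z) * a ^ (2 * (g z - k)))" for z
  proof -
    have "1 + top_osc z + J * real (g z - k) \<le> (1 + top_osc z) * (1 + J * real (g z - k))"
      using B_nonneg D_ge_1 by (simp add: algebra_simps)
    also have "\<dots> \<le> (1 + top_osc z) * (growth * a ^ (2 * (g z - k)))"
      by (intro mult_left_mono linear_le_power) auto
    finally show ?thesis by (simp add: mult_ac)
  qed
  have J0: "0 \<le> J" using B_nonneg D_ge_1 by simp
  have tJ0: "0 \<le> 1 + top_osc z + J * real i" for z i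
    using mult_nonneg_nonneg[OF J0 of_nat_0_le_iff[of i]] by (simp add: add_nonneg_nonneg)
  have "norm (b x - b y) \<le> norm (b x - m S) + norm (b y - m S)"
    using norm_triangle_ineq4[of "b x - m S" "b y - m S"] by simp
  also have "\<dots> \<le> (top_osc x + J * real (g x - k)) + (top_osc y + J * real (g y - k))"
    using one S by (intro add_mono) auto
  also have "\<dots> \<le> (1 + top_osc x + J * real (g x - k)) * (1 + top_osc y + J * real (g y - k))"
  proof -
    have "u + v \<le> (1 + u) * (1 + v)" if "0 \<le> u" "0 \<le> v" for u v :: real
      using that mult_nonneg_nonneg[OF that] by (simp add: algebra_simps)
    from this[of "top_osc x + J * real (g x - k)" "top_osc y + J * real (g y - k)"]
      mult_nonneg_nonneg[OF J0 of_nat_0_le_iff]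
    show ?thesis by (simp add: add.assoc)
  qed
  also have "\<dots> \<le> (growth * ((1 + top_osc x) * a ^ (2 * (g x - k)))) * (growth * ((1 + top_osc y) * a ^ (2 * (g y - k))))"
    using a_gt_1 by (intro mult_mono fac tJ0) (auto simp: growth_def)
  finally show ?thesis by (simp add: power2_eq_square mult_ac)
qed

definition osc_op :: "('a \<Rightarrow> real) \<Rightarrow> 'a \<Rightarrow> ennreal" where
  "osc_op F x = (\<Sum>k. \<Sum>S\<in>T k. indicator S x *
     ((\<integral>\<^sup>+y. ennreal (norm (b x - b y) * F y) * indicator S y \<partial>M) / emeasure M S))"

context
  fixes F :: "'a \<Rightarrow> real" and \<epsilon> :: real
  assumes F_measurable [measurable]: "F \<in> borel_measurable M"
    and F_nonneg: "\<And>x. 0 \<le> F x"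
    and \<epsilon>: "0 < \<epsilon>" "\<epsilon> \<le> 1" "p = 1 / \<epsilon>"
begin

abbreviation W :: "'a \<Rightarrow> ennreal" where
  "W y \<equiv> ennreal (sqrt (llog \<epsilon> (F y) + exp (top_osc y powr p)))"

abbreviation h :: "'a \<Rightarrow> ennreal" where
  "h y \<equiv> ennreal (sqrt (llog \<epsilon> (F y)))"

text \<open>In \<open>pointwise_osc\<close> the factor \<open>1 + top_osc y\<close> meets
  \<open>F y\<close>, and \<open>young_llog_exp\<close> replaces their product by
  \<open>W y * h y\<close>; the factor \<open>1 + top_osc x\<close> stays outside as the weight of
  the Schur test.\<close>

lemma osc_op_le:
  assumes x: "x \<in> space M"
  shows "osc_op F x \<le> ennreal (4 * growth\<^sup>2) * (ennreal (1 + top_osc x) * tent_op (\<lambda>y. W y * h y) x)"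
proof -
  have main: "(\<integral>\<^sup>+y. ennreal (norm (b x - b y) * F y) * indicator S y \<partial>M)
      \<le> ennreal (4 * growth\<^sup>2) * (ennreal (1 + top_osc x) * (ennreal (a ^ (2 * (g x - k))) *
         (\<integral>\<^sup>+y. ennreal (a ^ (2 * (g y - k))) * (W y * h y) * indicator S y \<partial>M)))"
    if S: "S \<in> T k" "x \<in> S" for S k
  proof -
    have [measurable]: "S \<in> sets M" using S sets_T by blast
    have "ennreal (norm (b x - b y) * F y) * indicator S y
      \<le> ennreal (4 * growth\<^sup>2) * (ennreal (1 + top_osc x) * (ennreal (a ^ (2 * (g x - k))) *
         (ennreal (a ^ (2 * (g y - k))) * (W y * h y) * indicator S y)))" for y
    proof (cases "y \<in> S")
      case True
      let ?i = "a ^ (2 * (g x - k))" and ?j = "a ^ (2 * (g y - k))"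
      let ?r = "sqrt (llog \<epsilon> (F y) + exp (top_osc y powr p)) * sqrt (llog \<epsilon> (F y))"
      have ll: "0 \<le> llog \<epsilon> (F y)" using F_nonneg llog_nonneg by blast
      have "norm (b x - b y) * F y \<le> growth\<^sup>2 * ((1 + top_osc x) * ?i * ((1 + top_osc y) * ?j)) * F y"
        using pointwise_osc[OF S True] F_nonneg by (intro mult_right_mono) auto
      also have "\<dots> = growth\<^sup>2 * ((1 + top_osc x) * ?i) * ?j * ((1 + top_osc y) * F y)"
        by (simp only: mult_ac)
      also have "\<dots> \<le> growth\<^sup>2 * ((1 + top_osc x) * ?i) * ?j * (4 * ?r)"
        using young_llog_exp[of "F y" "top_osc y" \<epsilon>] F_nonneg \<epsilon> a_gt_1
        by (intro mult_left_mono) auto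
      also have "\<dots> = (4 * growth\<^sup>2) * ((1 + top_osc x) * (?i * (?j * ?r)))"
        by (simp only: mult_ac)
      finally have "ennreal (norm (b x - b y) * F y) \<le> ennreal ((4 * growth\<^sup>2) * ((1 + top_osc x) * (?i * (?j * ?r))))"
        by (rule ennreal_leI)
      also have "\<dots> = ennreal (4 * growth\<^sup>2) * (ennreal (1 + top_osc x) * (ennreal ?i * (ennreal ?j * (W y * h y))))"
        using a_gt_1 ll by (simp add: ennreal_mult del: ennreal_plus)
      finally show ?thesis using True by (simp del: ennreal_plus)
    qed simp
    then have "(\<integral>\<^sup>+y. ennreal (norm (b x - b y) * F y) * indicator S y \<partial>M)
      \<le> (\<integral>\<^sup>+y. ennreal (4 * growth\<^sup>2) * (ennreal (1 + top_osc x) * (ennreal (a ^ (2 * (g x - k))) *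
         (ennreal (a ^ (2 * (g y - k))) * (W y * h y) * indicator S y))) \<partial>M)"
      by (intro nn_integral_mono)
    also have "\<dots> = ennreal (4 * growth\<^sup>2) * (ennreal (1 + top_osc x) * (ennreal (a ^ (2 * (g x - k))) *
         (\<integral>\<^sup>+y. ennreal (a ^ (2 * (g y - k))) * (W y * h y) * indicator S y \<partial>M)))"
      by (simp add: nn_integral_cmult del: ennreal_plus)
    finally show ?thesis .
  qed
  have "osc_op F x \<le> (\<Sum>k. \<Sum>S\<in>T k. ennreal (4 * growth\<^sup>2) * (ennreal (1 + top_osc x) * (indicator S x *
      (ennreal (a ^ (2 * (g x - k))) *
         ((\<integral>\<^sup>+y. ennreal (a ^ (2 * (g y - k))) * (W y * h y) * indicator S y \<partial>M) / emeasure M S)))))"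
    unfolding osc_op_def
  proof (intro suminf_le sum_mono)
    fix k S assume S: "S \<in> T k"
    show "indicator S x * ((\<integral>\<^sup>+y. ennreal (norm (b x - b y) * F y) * indicator S y \<partial>M) / emeasure M S)
      \<le> ennreal (4 * growth\<^sup>2) * (ennreal (1 + top_osc x) * (indicator S x *
      (ennreal (a ^ (2 * (g x - k))) *
         ((\<integral>\<^sup>+y. ennreal (a ^ (2 * (g y - k))) * (W y * h y) * indicator S y \<partial>M) / emeasure M S))))"
    proof (cases "x \<in> S")
      case True
      show ?thesis
        using divide_right_mono_ennreal[OF main[OF S True], of "emeasure M S"] True
        by (simp add: ennreal_times_divide del: ennreal_plus)
    qed simp
  qed auto
  also have "\<dots> = ennreal (4 * growth\<^sup>2) * (ennreal (1 + top_osc x) * tent_op (\<lambda>y. W y * h y) x)"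
    unfolding tent_op_def by (simp only: ennreal_suminf_cmult sum_distrib_left[symmetric])
  finally show ?thesis .
qed

text \<open>On this level set the last tent of every point is \<open>S\<close> itself, so
  \<open>top_osc\<close> is the oscillation that \<open>exp_osc\<close> controls.\<close>

lemma top_exp_integral:
  assumes S: "S \<in> T k"
  shows "(\<integral>\<^sup>+x. ennreal (exp (top_osc x powr p)) * indicator (S \<inter> {x. g x = k}) x \<partial>M) \<le> ennreal B * emeasure M S"
proof -
  have "(\<integral>\<^sup>+x. ennreal (exp (top_osc x powr p)) * indicator (S \<inter> {x. g x = k}) x \<partial>M)
     \<le> (\<integral>\<^sup>+x. ennreal (exp (norm (b x - m S) powr p)) * indicator S x \<partial>M)"
    using top_tent_eq S by (intro nn_integral_mono) (auto simp: indicator_def)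
  also have "\<dots> \<le> ennreal B * emeasure M S" using exp_osc S by blast
  finally show ?thesis .
qed

text \<open>Markov's inequality is applied to the square of the bound in \<open>osc_op_le\<close>,
  whence 16 and \<open>growth ^ 4\<close>. The number \<open>32 * B + D\<close> dominates both Schur
  constants: \<open>32 * B\<close> for the outer weight and \<open>B + D\<close> for
  \<open>W\<close>.\<close>

lemma weak_type_bounded_averages:
  assumes avg: "\<And>k S. S \<in> T k \<Longrightarrow> (\<integral>\<^sup>+x. ennreal (llog \<epsilon> (F x)) * indicator S x \<partial>M) \<le> ennreal D * emeasure M S"
  shows "emeasure M {x \<in> space M. 1 < osc_op F x} \<le>
    ennreal (16 * growth ^ 4 * c\<^sub>a ^ 4 * (32 * B + D)\<^sup>2) * (\<integral>\<^sup>+x. ennreal (llog \<epsilon> (F x)) \<partial>M)"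
proof -
  let ?\<psi> = "\<lambda>x. ennreal (1 + top_osc x) * tent_op (\<lambda>y. W y * h y) x"
  let ?\<beta> = "\<lambda>x. ennreal (1 + top_osc x)"
  have ll: "0 \<le> llog \<epsilon> (F y)" for y using F_nonneg llog_nonneg by blast
  have B': "ennreal (32 * B) + ennreal D = ennreal (32 * B + D)"
    using B_nonneg D_ge_1 by (simp add: ennreal_plus[symmetric] del: ennreal_plus)
  have ca: "0 \<le> c\<^sub>a" using a_gt_1 by (simp add: power_one_over field_simps)
  have \<beta>: "(\<integral>\<^sup>+x. (?\<beta> x)\<^sup>2 * indicator (S \<inter> {x. g x = k}) x \<partial>M) \<le> ennreal (32 * B + D) * emeasure M S"
    if S: "S \<in> T k" for k S
  proof -
    have [measurable]: "S \<in> sets M" using S sets_T by blast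
    have "(\<integral>\<^sup>+x. (?\<beta> x)\<^sup>2 * indicator (S \<inter> {x. g x = k}) x \<partial>M)
        \<le> (\<integral>\<^sup>+x. ennreal 32 * (ennreal (exp (top_osc x powr p)) * indicator (S \<inter> {x. g x = k}) x) \<partial>M)"
    proof (intro nn_integral_mono)
      fix x
      have "(?\<beta> x)\<^sup>2 \<le> ennreal (32 * exp (top_osc x powr p))"
        using one_plus_sq_le_exp[of "top_osc x" p] p_ge_1 by (subst ennreal_power) (auto intro!: ennreal_leI)
      then show "(?\<beta> x)\<^sup>2 * indicator (S \<inter> {x. g x = k}) x
          \<le> ennreal 32 * (ennreal (exp (top_osc x powr p)) * indicator (S \<inter> {x. g x = k}) x)"
        by (auto simp: indicator_def ennreal_mult simp del: ennreal_plus)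
    qed
    also have "\<dots> = ennreal 32 * (\<integral>\<^sup>+x. ennreal (exp (top_osc x powr p)) * indicator (S \<inter> {x. g x = k}) x \<partial>M)"
      by (intro nn_integral_cmult) measurable
    also have "\<dots> \<le> ennreal 32 * (ennreal B * emeasure M S)"
      by (intro mult_left_mono top_exp_integral S) auto
    also have "\<dots> = ennreal (32 * B) * emeasure M S"
      using B_nonneg by (simp add: ennreal_mult mult.assoc)
    also have "\<dots> \<le> ennreal (32 * B + D) * emeasure M S"
      using D_ge_1 by (intro mult_right_mono ennreal_leI) auto
    finally show ?thesis .
  qed
  have W: "(\<integral>\<^sup>+x. (W x)\<^sup>2 * indicator (S \<inter> {x. g x = k}) x \<partial>M) \<le> ennreal (32 * B + D) * emeasure M S"
    if S: "S \<in> T k" for k S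
  proof -
    have [measurable]: "S \<in> sets M" using S sets_T by blast
    have "(\<integral>\<^sup>+x. (W x)\<^sup>2 * indicator (S \<inter> {x. g x = k}) x \<partial>M)
        \<le> (\<integral>\<^sup>+x. ennreal (llog \<epsilon> (F x)) * indicator S x + ennreal (exp (top_osc x powr p)) * indicator (S \<inter> {x. g x = k}) x \<partial>M)"
      using ll by (intro nn_integral_mono)
        (auto simp: indicator_def ennreal_power add_nonneg_nonneg)
    also have "\<dots> = (\<integral>\<^sup>+x. ennreal (llog \<epsilon> (F x)) * indicator S x \<partial>M) + (\<integral>\<^sup>+x. ennreal (exp (top_osc x powr p)) * indicator (S \<inter> {x. g x = k}) x \<partial>M)"
      by (intro nn_integral_add) measurable
    also have "\<dots> \<le> ennreal D * emeasure M S + ennreal B * emeasure M S"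
      using avg[OF S] top_exp_integral[OF S] by (rule add_mono)
    also have "\<dots> \<le> ennreal D * emeasure M S + ennreal (32 * B) * emeasure M S"
      using B_nonneg by (intro add_mono mult_right_mono ennreal_leI) auto
    finally show ?thesis by (simp only: B'[symmetric] distrib_right add.commute[of "ennreal D * _"])
  qed
  have collect: "ennreal k * (ennreal c * (ennreal c * ennreal e * (ennreal c * ennreal e * (ennreal c * X))))
      = ennreal (k * (c * (c * e * (c * e * c)))) * X" if "0 \<le> k" "0 \<le> c" "0 \<le> e" for k c e :: real and X :: ennreal
    using that by (simp add: ennreal_mult mult.assoc)
  have "emeasure M {x \<in> space M. 1 < osc_op F x} \<le> emeasure M {x \<in> space M. 1 \<le> ennreal (16 * growth ^ 4) * (?\<psi> x)\<^sup>2}"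
  proof (intro emeasure_mono subsetI)
    fix x assume "x \<in> {x \<in> space M. 1 < osc_op F x}"
    then have x: "x \<in> space M" "1 \<le> osc_op F x" by auto
    have "1 \<le> ennreal (4 * growth\<^sup>2) * ?\<psi> x" using osc_op_le[OF x(1)] x(2) by (rule order_trans[rotated])
    then have "1\<^sup>2 \<le> (ennreal (4 * growth\<^sup>2) * ?\<psi> x)\<^sup>2" by (rule power_mono) auto
    also have "\<dots> = ennreal (16 * growth ^ 4) * (?\<psi> x)\<^sup>2"
      by (simp add: power_mult_distrib ennreal_power power_mult[symmetric] del: ennreal_plus)
    finally show "x \<in> {x \<in> space M. 1 \<le> ennreal (16 * growth ^ 4) * (?\<psi> x)\<^sup>2}" using x by simp
  qed measurable
  also have "\<dots> \<le> ennreal (16 * growth ^ 4) * (\<integral>\<^sup>+x. (?\<psi> x)\<^sup>2 * indicator (space M) x \<partial>M)"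
    using nn_integral_Markov_inequality[of "\<lambda>x. (?\<psi> x)\<^sup>2" "space M" M "ennreal (16 * growth ^ 4)"]
    by simp
  also have "(\<integral>\<^sup>+x. (?\<psi> x)\<^sup>2 * indicator (space M) x \<partial>M) = (\<integral>\<^sup>+x. (?\<psi> x)\<^sup>2 \<partial>M)"
    by (intro nn_integral_cong) simp
  also have "\<dots> \<le> ennreal c\<^sub>a * (ennreal c\<^sub>a * ennreal (32 * B + D) * (ennreal c\<^sub>a * ennreal (32 * B + D) * (ennreal c\<^sub>a * (\<integral>\<^sup>+x. (h x)\<^sup>2 \<partial>M))))"
    using \<beta> W by (intro tent_op_Schur) auto
  also have "(\<integral>\<^sup>+x. (h x)\<^sup>2 \<partial>M) = (\<integral>\<^sup>+x. ennreal (llog \<epsilon> (F x)) \<partial>M)"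
    using ll by (simp add: ennreal_power)
  also have "ennreal (16 * growth ^ 4) * (ennreal c\<^sub>a * (ennreal c\<^sub>a * ennreal (32 * B + D) * (ennreal c\<^sub>a * ennreal (32 * B + D) * (ennreal c\<^sub>a * (\<integral>\<^sup>+x. ennreal (llog \<epsilon> (F x)) \<partial>M)))))
     = ennreal (16 * growth ^ 4 * (c\<^sub>a * (c\<^sub>a * (32 * B + D) * (c\<^sub>a * (32 * B + D) * c\<^sub>a)))) * (\<integral>\<^sup>+x. ennreal (llog \<epsilon> (F x)) \<partial>M)"
    using ca B_nonneg D_ge_1 by (intro collect) (auto simp: growth_def)
  also have "16 * growth ^ 4 * (c\<^sub>a * (c\<^sub>a * (32 * B + D) * (c\<^sub>a * (32 * B + D) * c\<^sub>a))) = 16 * growth ^ 4 * c\<^sub>a ^ 4 * (32 * B + D)\<^sup>2"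
    by (simp only: power2_eq_square power4_eq_xxxx mult_ac)
  finally show ?thesis by (simp add: mult_left_mono)
qed

end

end

section \<open>Stopping at heavy tents\<close>

context sparse_tree
begin

lemma ancestor:
  assumes "S \<in> T k" "j \<le> k"
  shows "\<exists>S'\<in>T j. S \<subseteq> S'"
  using assms
proof (induction k arbitrary: S)
  case (Suc k)
  show ?case
  proof (cases "j = Suc k")
    case False
    obtain S1 where "S1 \<in> T k" "S \<subseteq> S1" using parent Suc.prems by blast
    then show ?thesis using Suc.IH[of S1] False Suc.prems by auto
  qed (use Suc.prems in blast)
qed blast

lemma nested_T:
  assumes "S \<in> T k" "S' \<in> T j" "j \<le> k" "x \<in> S" "x \<in> S'"
  shows "S \<subseteq> S'"
  using ancestor[OF assms(1,3)] T_unique assms by blast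

context
  fixes G :: "'a \<Rightarrow> ennreal"
  assumes G_measurable [measurable]: "G \<in> borel_measurable M"
begin

text \<open>The stopped tree consists of the tents without a heavy proper ancestor. The averages of \<open>G\<close>
  over all of its tents are bounded, and outside the heavy tents it coincides with the full tree.\<close>

definition heavy :: "'a set \<Rightarrow> bool" where
  "heavy S \<longleftrightarrow> emeasure M S < (\<integral>\<^sup>+x. G x * indicator S x \<partial>M)"

definition heavy_at :: "'a \<Rightarrow> nat \<Rightarrow> bool" where
  "heavy_at x j \<longleftrightarrow> (\<exists>S\<in>T j. x \<in> S \<and> heavy S)"

text \<open>A heavy tent survives as the last tent of its points, hence the least heavy generation
  itself and not its predecessor.\<close>

definition stop_g :: "'a \<Rightarrow> nat" where
  "stop_g x = (if \<exists>j. heavy_at x j then LEAST j. heavy_at x j else g x)"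

definition stop_T :: "nat \<Rightarrow> 'a set set" where
  "stop_T k = {S \<in> T k. \<forall>j<k. \<forall>S'\<in>T j. S \<subseteq> S' \<longrightarrow> \<not> heavy S'}"

lemma heavy_at_le_g: "heavy_at x j \<Longrightarrow> j \<le> g x"
  using T_le_g by (auto simp: heavy_at_def)

lemma stop_g_le: "stop_g x \<le> g x"
  using heavy_at_le_g LeastI_ex[of "heavy_at x"] by (simp add: stop_g_def)

text \<open>Every tent of smaller generation through \<open>x\<close> contains \<open>S\<close>, so
  the heavy proper ancestors of \<open>S\<close> are exactly the heavy tents around \<open>x\<close>
  of generation below \<open>k\<close>. This links the two descriptions of the stopped tree, by
  tents and by points.\<close>

lemma stop_T_iff:
  assumes "S \<in> T k" "x \<in> S"
  shows "S \<in> stop_T k \<longleftrightarrow> k \<le> stop_g x"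
proof
  assume S: "S \<in> stop_T k"
  have "k \<le> j" if j: "heavy_at x j" for j
  proof (rule ccontr)
    assume "\<not> k \<le> j"
    moreover obtain S' where S': "S' \<in> T j" "x \<in> S'" "heavy S'"
      using j unfolding heavy_at_def by blast
    ultimately have "S \<subseteq> S'" "j < k"
      using nested_T[OF assms(1) S'(1) _ assms(2) S'(2)] by auto
    then show False using S S' unfolding stop_T_def by blast
  qed
  then show "k \<le> stop_g x"
    using T_le_g[OF assms] LeastI_ex[of "heavy_at x"] by (simp add: stop_g_def)
next
  assume k: "k \<le> stop_g x"
  have "\<not> heavy S'" if "j < k" "S' \<in> T j" "S \<subseteq> S'" for j S'
  proof
    assume "heavy S'"
    then have *: "heavy_at x j" using that assms by (auto simp: heavy_at_def)
    then have "stop_g x \<le> j" using Least_le[of "heavy_at x" j] by (auto simp: stop_g_def)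
    then show False using k that by simp
  qed
  then show "S \<in> stop_T k" using assms by (simp add: stop_T_def)
qed

lemma stop_T_subset: "stop_T k \<subseteq> T k"
  by (auto simp: stop_T_def)

text \<open>The same \<open>a\<close> and \<open>D\<close> work: stopping only lowers
  \<open>g\<close>, which shrinks the sets in the sparseness condition, and the parent of a
  surviving tent survives.\<close>

lemma sparse_tree_stop: "sparse_tree M stop_g stop_T a D"
proof
  show "finite (stop_T k)" for k using finite_T stop_T_subset finite_subset by blast
  show "disjoint (stop_T k)" for k using disjoint_T stop_T_subset pairwise_subset by blast
  show "\<Union>(stop_T k) = {x \<in> space M. k \<le> stop_g x}" for k
  proof (intro subset_antisym subsetI)
    fix x assume "x \<in> \<Union>(stop_T k)"
    then show "x \<in> {x \<in> space M. k \<le> stop_g x}"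
      using stop_T_iff T_in_space stop_T_subset by blast
  next
    fix x assume x: "x \<in> {x \<in> space M. k \<le> stop_g x}"
    then have "k \<le> g x" using stop_g_le order_trans by blast
    then obtain S where "S \<in> T k" "x \<in> S" using x T_cover by blast
    then show "x \<in> \<Union>(stop_T k)" using x stop_T_iff by blast
  qed
  show "S \<in> sets M" "0 < measure M S" if "S \<in> stop_T k" for S k
    using that stop_T_subset sets_T measure_T_pos by blast+
  show "\<exists>S'\<in>stop_T k. S \<subseteq> S' \<and> measure M S' \<le> D * measure M S" if S: "S \<in> stop_T (Suc k)" for S k
  proof -
    obtain S' where S': "S' \<in> T k" "S \<subseteq> S'" "measure M S' \<le> D * measure M S"
      using parent S stop_T_subset by blast
    have "\<not> heavy S''" if "j < k" "S'' \<in> T j" "S' \<subseteq> S''" for j S''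
    proof -
      have "j < Suc k" "S \<subseteq> S''" using that S'(2) by auto
      then show ?thesis using S that(2) unfolding stop_T_def by blast
    qed
    then have "S' \<in> stop_T k" using S'(1) unfolding stop_T_def by blast
    then show ?thesis using S' by blast
  qed
  show "a ^ 8 * measure M (S \<inter> {x. Suc k \<le> stop_g x}) \<le> measure M S" if S: "S \<in> stop_T k" for S k
  proof -
    have S': "S \<in> T k" using S stop_T_subset by blast
    have "S \<inter> {x. Suc k \<le> g x} = S \<inter> {x \<in> space M. Suc k \<le> g x}"
      using T_in_space S' by blast
    also have "\<dots> \<in> sets M" using sets_T[OF S'] by measurable
    finally have "measure M (S \<inter> {x. Suc k \<le> stop_g x}) \<le> measure M (S \<inter> {x. Suc k \<le> g x})"
      using order_trans[OF _ stop_g_le] by (intro finite_measure_mono) blast+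
    then have "a ^ 8 * measure M (S \<inter> {x. Suc k \<le> stop_g x}) \<le> a ^ 8 * measure M (S \<inter> {x. Suc k \<le> g x})"
      using a_gt_1 by (intro mult_left_mono) auto
    then show ?thesis using sparse[OF S'] by linarith
  qed
qed (fact a_gt_1 D_ge_1)+

text \<open>The parent of a surviving tent is not heavy, and passing from it to the child costs
  \<open>D\<close>. A tent of generation 0 has no parent, hence the separate assumption on the
  roots.\<close>

lemma average_stop_T:
  assumes "\<And>S. S \<in> T 0 \<Longrightarrow> \<not> heavy S" and S: "S \<in> stop_T k"
  shows "(\<integral>\<^sup>+x. G x * indicator S x \<partial>M) \<le> ennreal D * emeasure M S"
proof (cases k)
  case 0
  then have "(\<integral>\<^sup>+x. G x * indicator S x \<partial>M) \<le> 1 * emeasure M S"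
    using assms(1)[of S] S stop_T_subset[of 0] by (auto simp: heavy_def not_less)
  also have "\<dots> \<le> ennreal D * emeasure M S"
    using D_ge_1 by (intro mult_right_mono) (auto simp: ennreal_1[symmetric] intro!: ennreal_leI simp del: ennreal_1)
  finally show ?thesis .
next
  case (Suc j)
  obtain S' where S': "S' \<in> T j" "S \<subseteq> S'" "measure M S' \<le> D * measure M S"
    using parent S Suc stop_T_subset by blast
  have "(\<integral>\<^sup>+x. G x * indicator S x \<partial>M) \<le> (\<integral>\<^sup>+x. G x * indicator S' x \<partial>M)"
    using S' by (intro nn_integral_mono mult_left_mono) (auto simp: indicator_def)
  also have "\<dots> \<le> emeasure M S'"
  proof -
    have "\<not> heavy S'" using S S'(1,2) Suc unfolding stop_T_def by blast
    then show ?thesis by (simp add: heavy_def not_less)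
  qed
  also have "\<dots> \<le> ennreal D * emeasure M S"
    using S' D_ge_1 by (simp add: emeasure_eq_measure ennreal_mult[symmetric] ennreal_leI)
  finally show ?thesis .
qed

text \<open>The heavy tents of the stopped tree are the maximal ones, as none has a heavy proper
  ancestor. They are disjoint also across generations, because \<open>stop_g\<close> recovers the
  generation, so the defining inequalities of heaviness can be added.\<close>

lemma stopped_region:
  shows "{x \<in> space M. \<exists>j. heavy_at x j} \<in> sets M"
    and "emeasure M {x \<in> space M. \<exists>j. heavy_at x j} \<le> (\<integral>\<^sup>+x. G x \<partial>M)"
proof -
  let ?E = "{x \<in> space M. \<exists>j. heavy_at x j}"
  define E where "E k = \<Union>{S \<in> stop_T k. heavy S}" for k
  have E_iff: "x \<in> E k \<longleftrightarrow> x \<in> ?E \<and> stop_g x = k" for x k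
  proof
    assume "x \<in> E k"
    then obtain S where S: "S \<in> stop_T k" "heavy S" "x \<in> S" by (auto simp: E_def)
    then have "S \<in> T k" using stop_T_subset by blast
    then have h: "heavy_at x k" and x: "x \<in> space M" using S T_in_space unfolding heavy_at_def by blast+
    have "k \<le> stop_g x" using S stop_T_iff \<open>S \<in> T k\<close> by blast
    moreover have "stop_g x \<le> k" using Least_le[of "heavy_at x" k] h by (auto simp: stop_g_def)
    ultimately show "x \<in> ?E \<and> stop_g x = k" using h x by auto
  next
    assume x: "x \<in> ?E \<and> stop_g x = k"
    then have "heavy_at x k" using LeastI_ex[of "heavy_at x"] by (auto simp: stop_g_def)
    then obtain S where "S \<in> T k" "x \<in> S" "heavy S" by (auto simp: heavy_at_def)
    then show "x \<in> E k" using x stop_T_iff by (auto simp: E_def)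
  qed
  have E_sets: "E k \<in> sets M" for k
    unfolding E_def using finite_T[of k] stop_T_subset[of k] sets_T
    by (intro sets.finite_Union) (auto intro: finite_subset)
  have E_un: "?E = (\<Union>k. E k)" using E_iff by blast
  show "?E \<in> sets M" unfolding E_un using E_sets by blast
  have disj: "disjoint_family E" by (auto simp: disjoint_family_on_def E_iff)
  have "emeasure M (E k) \<le> (\<integral>\<^sup>+x. G x * indicator (E k) x \<partial>M)" for k
  proof -
    have sub: "{S \<in> stop_T k. heavy S} \<subseteq> T k" using stop_T_subset by blast
    have "emeasure M (E k) = (\<integral>\<^sup>+x. 1 * indicator (E k) x \<partial>M)" using E_sets by simp
    also have "\<dots> = (\<Sum>S\<in>{S \<in> stop_T k. heavy S}. \<integral>\<^sup>+x. 1 * indicator S x \<partial>M)"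
      unfolding E_def by (rule nn_integral_Union_T[OF sub]) simp
    also have "\<dots> \<le> (\<Sum>S\<in>{S \<in> stop_T k. heavy S}. \<integral>\<^sup>+x. G x * indicator S x \<partial>M)"
    proof (intro sum_mono)
      fix S assume S: "S \<in> {S \<in> stop_T k. heavy S}"
      then have "S \<in> sets M" using sub sets_T by blast
      then show "(\<integral>\<^sup>+x. 1 * indicator S x \<partial>M) \<le> (\<integral>\<^sup>+x. G x * indicator S x \<partial>M)"
        using S by (simp add: heavy_def less_imp_le)
    qed
    also have "\<dots> = (\<integral>\<^sup>+x. G x * indicator (E k) x \<partial>M)"
      unfolding E_def by (rule nn_integral_Union_T[OF sub, symmetric]) simp
    finally show ?thesis .
  qed
  then have "(\<Sum>k. emeasure M (E k)) \<le> (\<Sum>k. \<integral>\<^sup>+x. G x * indicator (E k) x \<partial>M)"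
    by (intro suminf_le) auto
  also have "\<dots> = (\<integral>\<^sup>+x. (\<Sum>k. G x * indicator (E k) x) \<partial>M)"
    using E_sets by (intro nn_integral_suminf[symmetric]) auto
  also have "\<dots> = (\<integral>\<^sup>+x. G x * indicator ?E x \<partial>M)"
    unfolding E_un ennreal_suminf_cmult suminf_indicator[OF disj] ..
  also have "\<dots> \<le> (\<integral>\<^sup>+x. G x \<partial>M)"
    by (intro nn_integral_mono) (auto simp: indicator_def)
  finally show "emeasure M ?E \<le> (\<integral>\<^sup>+x. G x \<partial>M)"
    unfolding E_un using E_sets disj by (simp add: suminf_emeasure image_subset_iff)
qed

text \<open>A point in no heavy tent keeps its generation, so every tent containing it survives; the
  other tents contribute 0.\<close>

lemma sum_stop_T:
  fixes \<phi> :: "'a set \<Rightarrow> ennreal"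
  assumes "\<nexists>j. heavy_at x j"
  shows "(\<Sum>S\<in>stop_T k. indicator S x * \<phi> S) = (\<Sum>S\<in>T k. indicator S x * \<phi> S)"
proof (rule sum.mono_neutral_left)
  show "\<forall>S\<in>T k - stop_T k. indicator S x * \<phi> S = 0"
  proof
    fix S assume S: "S \<in> T k - stop_T k"
    have "x \<notin> S"
    proof
      assume "x \<in> S"
      moreover have "stop_g x = g x" using assms by (simp add: stop_g_def)
      ultimately show False using S stop_T_iff[of S k x] T_le_g[of S k x] by auto
    qed
    then show "indicator S x * \<phi> S = 0" by simp
  qed
qed (use finite_T stop_T_subset in auto)

end

end

section \<open>Weak type on the full tree\<close>

context oscillation_on_tree
begin

lemma osc_op_measurable [measurable]:
  assumes [measurable]: "F \<in> borel_measurable M"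
  shows "osc_op F \<in> borel_measurable M"
proof -
  have "(\<lambda>x. \<integral>\<^sup>+y. ennreal (norm (b x - b y) * F y) * indicator S y \<partial>M) \<in> borel_measurable M"
    if "S \<in> T k" for S k
  proof -
    have [measurable]: "S \<in> sets M" using that sets_T by blast
    show ?thesis by measurable
  qed
  then show ?thesis
    unfolding osc_op_def
    by (intro borel_measurable_suminf_order borel_measurable_sum borel_measurable_times_ennreal
        borel_measurable_divide_ennreal borel_measurable_indicator borel_measurable_const sets_T)
qed

text \<open>The summand 1 pays for the stopped region, the rest for the stopped tree. Only
  \<open>a\<close>, \<open>D\<close> and \<open>B\<close> enter, which later makes the constant
  independent of \<open>b\<close> and \<open>f\<close>.\<close>

definition weak_const :: real where
  "weak_const = 1 + 16 * growth ^ 4 * c\<^sub>a ^ 4 * (32 * B + D)\<^sup>2"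

proposition osc_op_weak_type:
  assumes T_0: "T 0 = {space M}"
    and F [measurable]: "F \<in> borel_measurable M" and F_nonneg: "\<And>x. 0 \<le> F x"
    and \<epsilon>: "0 < \<epsilon>" "\<epsilon> \<le> 1" "p = 1 / \<epsilon>"
  shows "emeasure M {x \<in> space M. 1 < osc_op F x}
    \<le> ennreal weak_const * (\<integral>\<^sup>+x. ennreal (llog \<epsilon> (F x)) \<partial>M)"
proof -
  define G where "G x = ennreal (llog \<epsilon> (F x))" for x
  have [measurable]: "G \<in> borel_measurable M" unfolding G_def by measurable
  let ?K = "16 * growth ^ 4 * c\<^sub>a ^ 4 * (32 * B + D)\<^sup>2"
  have K: "0 \<le> ?K" by simp
  have const: "ennreal weak_const * I = I + ennreal ?K * I" for I
    unfolding weak_const_def using K by (simp add: distrib_right)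
  show ?thesis
  proof (cases "heavy G (space M)")
    \<comment> \<open>A heavy root makes the integral exceed the measure of the whole space, so
      there is nothing to estimate.\<close>
    case True
    have "emeasure M {x \<in> space M. 1 < osc_op F x} \<le> emeasure M (space M)"
      by (intro emeasure_mono) auto
    also have "\<dots> \<le> (\<integral>\<^sup>+x. G x * indicator (space M) x \<partial>M)"
      using True heavy_def[of G] by simp
    also have "\<dots> = (\<integral>\<^sup>+x. G x \<partial>M)" by (intro nn_integral_cong) simp
    also have "\<dots> \<le> ennreal weak_const * (\<integral>\<^sup>+x. G x \<partial>M)" unfolding const by simp
    finally show ?thesis by (simp add: G_def)
  next
    case False
    interpret stop: sparse_tree M "stop_g G" "stop_T G" a D
      by (rule sparse_tree_stop) simp
    interpret stop: oscillation_on_tree M "stop_g G" "stop_T G" a D b m p B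
      using stop_T_subset[of G] exp_osc by unfold_locales (auto simp: p_ge_1 B_nonneg subset_iff)
    let ?E = "{x \<in> space M. \<exists>j. heavy_at G x j}"
    have "(\<integral>\<^sup>+x. G x * indicator S x \<partial>M) \<le> ennreal D * emeasure M S" if "S \<in> stop_T G k" for S k
      using False average_stop_T[of G S k] T_0 that by simp
    then have "emeasure M {x \<in> space M. 1 < stop.osc_op F x} \<le> ennreal ?K * (\<integral>\<^sup>+x. G x \<partial>M)"
      using stop.weak_type_bounded_averages[OF F F_nonneg \<epsilon>] by (simp add: G_def)
    moreover have "emeasure M ?E \<le> (\<integral>\<^sup>+x. G x \<partial>M)"
      by (rule stopped_region) simp
    moreover have "{x \<in> space M. 1 < osc_op F x} \<subseteq> ?E \<union> {x \<in> space M. 1 < stop.osc_op F x}"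
    proof
      fix x assume x: "x \<in> {x \<in> space M. 1 < osc_op F x}"
      \<comment> \<open>The integrals run over whole tents, including the stopped parts, so the two
        operators have identical summands over surviving tents.\<close>
      have "stop.osc_op F x = osc_op F x" if "\<nexists>j. heavy_at G x j"
        unfolding osc_op_def stop.osc_op_def by (intro suminf_cong sum_stop_T that) measurable
      then show "x \<in> ?E \<union> {x \<in> space M. 1 < stop.osc_op F x}"
        using x by force
    qed
    then have "emeasure M {x \<in> space M. 1 < osc_op F x} \<le> emeasure M (?E \<union> {x \<in> space M. 1 < stop.osc_op F x})"
      using stopped_region(1)[of G] by (intro emeasure_mono) auto
    then have "emeasure M {x \<in> space M. 1 < osc_op F x} \<le> emeasure M ?E + emeasure M {x \<in> space M. 1 < stop.osc_op F x}"
      using emeasure_subadditive[of ?E M "{x \<in> space M. 1 < stop.osc_op F x}"] stopped_region(1)[of G]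
      by (auto intro: order_trans)
    ultimately show ?thesis
      unfolding const G_def[symmetric] by (meson add_mono order_trans)
  qed
qed

end

section \<open>Carleson tents and the Bergman kernel\<close>

text \<open>Packing instead of rotation invariance of the volume: translates of the set along a lattice
  adapted to the box are disjoint and stay in a ball of fixed radius.\<close>

lemma measure_le_orthogonal_box:
  fixes A :: "'a::euclidean_space set"
  assumes fin: "finite V" and orth: "pairwise orthogonal V" and "0 \<notin> V"
    and c: "\<And>v. v \<in> V \<Longrightarrow> 0 < c v"
    and ball: "A \<subseteq> cball x0 2"
    and box: "\<And>x v. x \<in> A \<Longrightarrow> v \<in> V \<Longrightarrow> \<bar>(x - x0) \<bullet> sgn v\<bar> \<le> c v"
  shows "measure lebesgue A \<le>
    unit_ball_vol (real DIM('a)) * (2 + 3 * real (card V)) ^ DIM('a) * (\<Prod>v\<in>V. c v)"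
proof (cases "A \<in> sets lebesgue")
  case True
  have mA: "A \<in> lmeasurable"
    using True ball bounded_cball bounded_set_imp_lmeasurable bounded_subset by blast
  \<comment> \<open>As many translates along \<open>v\<close> as keep
    \<open>c v * real (k v)\<close> at most 1; their number is at least \<open>1 / c v\<close>,
    which produces the product of the \<open>c v\<close> in the bound.\<close>
  define N where "N v = nat \<lceil>1 / c v\<rceil>" for v
  define P where "P = PiE V (\<lambda>v. {..<N v})"
  \<comment> \<open>The spacing \<open>3 * c v\<close> exceeds the width \<open>2 * c v\<close> of
    the box, so translates that differ in one index are disjoint.\<close>
  define sh where "sh k = (\<Sum>v\<in>V. (3 * c v * real (k v)) *\<^sub>R sgn v)" for k :: "'a \<Rightarrow> nat"
  let ?R = "2 + 3 * real (card V)"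
  have finP: "finite P" unfolding P_def using fin by (intro finite_PiE) auto
  have small: "c v * real (k v) \<le> 1" if "k \<in> P" "v \<in> V" for k v
  proof -
    have "k v < nat \<lceil>1 / c v\<rceil>" using that by (auto simp: P_def N_def dest: PiE_mem)
    then have "int (k v) < \<lceil>1 / c v\<rceil>" by linarith
    then have "real (k v) < 1 / c v" by (simp add: less_ceiling_iff)
    then show ?thesis using c[OF that(2)] by (simp add: field_simps)
  qed
  have inner_sh: "sh k \<bullet> sgn v = 3 * c v * real (k v)" if "v \<in> V" for k v
  proof -
    have "sh k \<bullet> sgn v = (\<Sum>w\<in>V. 3 * c w * real (k w) * (sgn w \<bullet> sgn v))"
      by (simp add: sh_def inner_sum_left)
    also have "\<dots> = (\<Sum>w\<in>{v}. 3 * c w * real (k w) * (sgn w \<bullet> sgn v))"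
      using orth that fin
      by (intro sum.mono_neutral_right) (auto simp: pairwise_def orthogonal_def sgn_div_norm)
    finally show ?thesis
      using that \<open>0 \<notin> V\<close> norm_eq_1[of "sgn v"] by (auto simp: norm_sgn split: if_splits)
  qed
  have disj: "pairwise (\<lambda>k k'. disjnt ((+) (sh k) ` A) ((+) (sh k') ` A)) P"
  proof (intro pairwiseI)
    fix k k' assume k: "k \<in> P" "k' \<in> P" "k \<noteq> k'"
    then obtain v where v: "v \<in> V" "k v \<noteq> k' v"
      unfolding P_def using PiE_ext[of k V _ k'] by blast
    show "disjnt ((+) (sh k) ` A) ((+) (sh k') ` A)"
      unfolding disjnt_def
    proof (rule ccontr)
      assume "(+) (sh k) ` A \<inter> (+) (sh k') ` A \<noteq> {}"
      then obtain x x' where x: "x \<in> A" "x' \<in> A" "sh k + x = sh k' + x'" by auto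
      then have "sh k - sh k' = (x' - x0) - (x - x0)" by (simp add: algebra_simps)
      then have "(sh k - sh k') \<bullet> sgn v = (x' - x0) \<bullet> sgn v - (x - x0) \<bullet> sgn v"
        by (simp only: inner_diff_left)
      then have "3 * c v * (real (k v) - real (k' v)) = (x' - x0) \<bullet> sgn v - (x - x0) \<bullet> sgn v"
        using v by (simp add: inner_diff_left inner_sh algebra_simps)
      then have "\<bar>3 * c v * (real (k v) - real (k' v))\<bar> \<le> 2 * c v"
        using box[OF x(1) v(1)] box[OF x(2) v(1)] by linarith
      moreover have "1 \<le> \<bar>real (k v) - real (k' v)\<bar>" using v(2) by linarith
      then have "3 * c v * 1 \<le> \<bar>3 * c v * (real (k v) - real (k' v))\<bar>"
        unfolding abs_mult using c[OF v(1)] by (intro mult_mono) auto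
      ultimately show False using c[OF v(1)] by linarith
    qed
  qed
  have "real (card P) * measure lebesgue A = (\<Sum>k\<in>P. measure lebesgue ((+) (sh k) ` A))"
    by (simp add: measure_translation)
  also have "\<dots> = measure lebesgue (\<Union>k\<in>P. (+) (sh k) ` A)"
    using finP mA disj by (intro measure_UNION'[symmetric] measurable_translation)
  also have "\<dots> \<le> measure lebesgue (cball x0 ?R)"
  proof (rule measure_mono_fmeasurable)
    show "(\<Union>k\<in>P. (+) (sh k) ` A) \<subseteq> cball x0 ?R"
    proof clarify
      fix k x assume k: "k \<in> P" and x: "x \<in> A"
      have "norm (sh k) \<le> (\<Sum>v\<in>V. norm ((3 * c v * real (k v)) *\<^sub>R sgn v))"
        unfolding sh_def by (rule norm_sum)
      also have "\<dots> \<le> (\<Sum>v\<in>V. 3)"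
      proof (rule sum_mono)
        fix v assume v: "v \<in> V"
        have "norm ((3 * c v * real (k v)) *\<^sub>R sgn v) = 3 * (c v * real (k v)) * norm (sgn v)"
          using c[OF v] by simp
        also have "\<dots> \<le> 3 * 1 * 1"
          using small[OF k v] c[OF v] by (intro mult_mono) (auto simp: norm_sgn)
        finally show "norm ((3 * c v * real (k v)) *\<^sub>R sgn v) \<le> 3" by simp
      qed
      finally have "norm (sh k) \<le> 3 * real (card V)" by simp
      moreover have "norm (x - x0) \<le> 2" using x ball by (auto simp: dist_norm norm_minus_commute)
      ultimately have "norm (sh k + (x - x0)) \<le> ?R" using norm_triangle_ineq[of "sh k" "x - x0"] by linarith
      then show "sh k + x \<in> cball x0 ?R" by (simp add: dist_norm norm_minus_commute add_diff_eq)
    qed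
    show "(\<Union>k\<in>P. (+) (sh k) ` A) \<in> sets lebesgue"
      using finP mA measurable_translation by (intro sets.finite_UN) auto
  qed simp
  also have "\<dots> = unit_ball_vol (real DIM('a)) * ?R ^ DIM('a)"
    by (simp add: content_cball)
  finally have le: "real (card P) * measure lebesgue A \<le> unit_ball_vol (real DIM('a)) * ?R ^ DIM('a)" .
  have pc: "0 < (\<Prod>v\<in>V. c v)" using c by (rule prod_pos)
  have "1 / (\<Prod>v\<in>V. c v) = (\<Prod>v\<in>V. 1 / c v)" by (simp add: prod_dividef)
  also have "\<dots> \<le> (\<Prod>v\<in>V. real (N v))"
    using c by (intro prod_mono) (auto simp: N_def less_imp_le real_nat_ceiling_ge)
  also have "\<dots> = real (card P)" using fin by (simp add: P_def card_PiE)
  finally have "1 / (\<Prod>v\<in>V. c v) * measure lebesgue A \<le> real (card P) * measure lebesgue A"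
    by (intro mult_right_mono) auto
  then have "measure lebesgue A \<le> (\<Prod>v\<in>V. c v) * (real (card P) * measure lebesgue A)"
    using pc by (simp add: field_simps)
  also have "\<dots> \<le> (\<Prod>v\<in>V. c v) * (unit_ball_vol (real DIM('a)) * ?R ^ DIM('a))"
    using le pc by (intro mult_left_mono) auto
  finally show ?thesis by (simp only: mult_ac)
next
  \<comment> \<open>A nonmeasurable set has \<open>measure\<close> 0 by convention.\<close>
  case False
  moreover have "0 \<le> (\<Prod>v\<in>V. c v)" using c by (intro prod_nonneg) (auto simp: less_imp_le)
  ultimately show ?thesis by (simp add: measure_notin_sets)
qed

section \<open>The Hermitian form in terms of the real inner product\<close>

lemma Re_herm: "Re (herm x y) = x \<bullet> y"
  by (simp add: herm_def inner_vec_def inner_complex_def)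

lemma herm_scaleR_left: "herm (r *\<^sub>R x) y = of_real r * herm x y"
  by (simp add: herm_def sum_distrib_left mult.assoc scaleR_conv_of_real[where 'a = complex])

lemma herm_smult_left: "herm (c *s x) y = c * herm x y"
  by (simp add: herm_def sum_distrib_left mult.assoc)

lemma herm_self: "herm x x = of_real ((norm x)\<^sup>2)"
proof (rule complex_eqI)
  show "Im (herm x x) = Im (of_real ((norm x)\<^sup>2))"
    by (simp add: herm_def)
qed (simp add: Re_herm dot_square_norm)

lemma norm_herm_le: "norm (herm x y) \<le> norm x * norm y"
proof -
  have "norm (herm x y) \<le> (\<Sum>i\<in>UNIV. \<bar>norm (x $ i)\<bar> * \<bar>norm (y $ i)\<bar>)"
    unfolding herm_def by (rule order_trans[OF norm_sum]) (simp add: norm_mult)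
  also have "\<dots> \<le> norm x * norm y"
    unfolding norm_vec_def by (rule L2_set_mult_ineq)
  finally show ?thesis .
qed

text \<open>The direction \<open>\<i> *s e\<close> sees the imaginary part as \<open>e\<close> sees
  the real part, so the complex condition of a Carleson tent yields two real slabs.\<close>

lemma inner_imaginary: "w \<bullet> (\<i> *s e) = - Im (herm e w)"
proof -
  have "w \<bullet> (\<i> *s e) = Re (herm (\<i> *s e) w)" by (simp add: Re_herm inner_commute)
  then show ?thesis by (simp add: herm_smult_left)
qed

lemma norm_smult_vec: "norm (c *s x) = norm c * norm (x :: complex^'n)"
proof -
  have "(norm (c *s x))\<^sup>2 = (norm c * norm x)\<^sup>2"
    by (simp add: norm_vec_def L2_set_def sum_nonneg norm_mult power_mult_distrib sum_distrib_left)
  then show ?thesis by (simp add: power2_eq_iff_nonneg)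
qed

text \<open>The tent fits into a box of half-width \<open>\<epsilon> = 1 - norm u\<close> in the two
  real directions of the complex line through \<open>u\<close> and
  \<open>sqrt (2 * \<epsilon>)\<close> in the remaining \<open>2 * (CARD('n) - 1)\<close>, which
  gives the exponent \<open>2 + (CARD('n) - 1)\<close>. The measure of the ball in the constant
  covers \<open>u = 0\<close>.\<close>

lemma carleson_tent_measure:
  obtains C where "0 < C"
    "\<And>u :: complex^'n::finite. norm u < 1 \<Longrightarrow>
      measure lebesgue (carleson_tent u) \<le> C * (1 - norm u) ^ (CARD('n) + 1)"
proof
  let ?n = "CARD('n)"
  let ?d = "DIM(complex^'n)"
  have d: "?d = 2 * ?n" by simp
  let ?K = "unit_ball_vol (real ?d) * (2 + 3 * real ?d) ^ ?d * 2 ^ ?n"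
  show "0 < ?K + measure lebesgue (ball (0 :: complex^'n) 1)"
    by (intro add_pos_nonneg mult_pos_pos zero_less_power) auto
  fix u :: "complex^'n" assume u: "norm u < 1"
  show "measure lebesgue (carleson_tent u) \<le> (?K + measure lebesgue (ball (0 :: complex^'n) 1)) * (1 - norm u) ^ (?n + 1)"
  proof (cases "u = 0")
    case True
    have "0 \<le> ?K" by simp
    then show ?thesis using True by (simp add: carleson_tent_def)
  next
    case False
    define \<epsilon> where "\<epsilon> = 1 - norm u"
    define e where "e = sgn u"
    have \<epsilon>: "0 < \<epsilon>" "\<epsilon> < 1" using u False by (auto simp: \<epsilon>_def)
    have e: "norm e = 1" using False by (simp add: e_def norm_sgn)
    have ie: "norm (\<i> *s e) = 1" using e by (simp add: norm_smult_vec)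
    have eie: "e \<bullet> (\<i> *s e) = 0" by (simp add: inner_imaginary herm_self)
    then have "pairwise orthogonal {e, \<i> *s e}"
      by (auto simp: pairwise_def orthogonal_def inner_commute)
    then obtain U where U: "U \<inter> insert 0 {e, \<i> *s e} = {}" "pairwise orthogonal ({e, \<i> *s e} \<union> U)"
        "span ({e, \<i> *s e} \<union> U) = span ({e, \<i> *s e} \<union> UNIV)"
      using orthogonal_extension_strong by blast
    let ?V = "{e, \<i> *s e} \<union> U"
    have zero: "0 \<notin> ?V" using U(1) e ie by auto
    have ind: "independent ?V" using U(2) zero by (rule pairwise_orthogonal_independent)
    then have finV: "finite ?V" by (rule independent_imp_finite)
    have "dim (UNIV :: (complex^'n) set) = card ?V"
      using U(3) ind by (intro dim_eq_card) (simp_all add: span_UNIV)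
    then have cardV: "card ?V = ?d" by (simp only: dim_UNIV)
    have "e \<noteq> \<i> *s e" using eie e by (metis norm_eq_1 zero_neq_one)
    then have "card ?V = card {e, \<i> *s e} + card U"
      using finV U(1) by (intro card_Un_disjoint) auto
    then have cardU: "card U = 2 * (?n - 1)"
      using cardV d \<open>e \<noteq> \<i> *s e\<close> by simp
    define c where "c v = (if v \<in> U then sqrt (2 * \<epsilon>) else \<epsilon>)" for v
    have T: "w \<in> ball 0 1 \<and> cmod (1 - herm e w) < \<epsilon>" if "w \<in> carleson_tent u" for w
    proof -
      have "herm u w / of_real (norm u) = herm e w"
        by (simp add: e_def sgn_div_norm herm_scaleR_left divide_inverse mult.commute)
      then show ?thesis using that False by (simp add: carleson_tent_def \<epsilon>_def)
    qed
    have "measure lebesgue (carleson_tent u)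
        \<le> unit_ball_vol (real ?d) * (2 + 3 * real (card ?V)) ^ ?d * (\<Prod>v\<in>?V. c v)"
    proof (rule measure_le_orthogonal_box)
      show "carleson_tent u \<subseteq> cball e 2"
      proof
        fix w assume "w \<in> carleson_tent u"
        then have "norm w < 1" using T by simp
        then show "w \<in> cball e 2" using norm_triangle_ineq4[of e w] e by (simp add: dist_norm)
      qed
      fix w v assume w: "w \<in> carleson_tent u" and v: "v \<in> ?V"
      have hw: "cmod (1 - herm e w) < \<epsilon>" and nw: "norm w < 1" using T[OF w] by auto
      have re: "\<bar>1 - w \<bullet> e\<bar> < \<epsilon>"
        using hw abs_Re_le_cmod[of "1 - herm e w"] by (simp add: Re_herm inner_commute)
      show "\<bar>(w - e) \<bullet> sgn v\<bar> \<le> c v"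
      proof (cases "v \<in> U")
        case True
        define s where "s = sgn v"
        have "v \<noteq> 0" using True U(1) by auto
        then have s: "norm s = 1" by (simp add: s_def norm_sgn)
        have "v \<noteq> e" using True U(1) by auto
        then have "v \<bullet> e = 0" using U(2) True by (auto simp: pairwise_def orthogonal_def)
        then have se: "e \<bullet> s = 0" by (simp add: s_def sgn_div_norm inner_commute)
        have ss: "s \<bullet> s = 1" "e \<bullet> e = 1" using s e norm_eq_1 by auto
        \<comment> \<open>Bessel's inequality for the orthonormal pair \<open>e\<close>,
          \<open>s\<close>. As \<open>w \<bullet> e\<close> is within \<open>\<epsilon>\<close> of 1
          and \<open>norm w < 1\<close>, little room is left in the direction
          \<open>s\<close>.\<close>
        have "0 \<le> (w - (w \<bullet> e) *\<^sub>R e - (w \<bullet> s) *\<^sub>R s) \<bullet> (w - (w \<bullet> e) *\<^sub>R e - (w \<bullet> s) *\<^sub>R s)"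
          by simp
        also have "\<dots> = w \<bullet> w - (w \<bullet> e)\<^sup>2 - (w \<bullet> s)\<^sup>2"
          using se ss by (simp add: inner_diff_left inner_diff_right inner_commute[of s w] inner_commute[of s e] inner_commute[of e w] power2_eq_square algebra_simps)
        finally have bes: "(w \<bullet> e)\<^sup>2 + (w \<bullet> s)\<^sup>2 \<le> (norm w)\<^sup>2" by (simp add: dot_square_norm)
        have "(norm w)\<^sup>2 \<le> 1" using nw by (simp add: power_le_one)
        moreover have "(1 - \<epsilon>)\<^sup>2 \<le> (w \<bullet> e)\<^sup>2" using re \<epsilon> by (intro power_mono) auto
        ultimately have "(w \<bullet> s)\<^sup>2 \<le> 1 - (1 - \<epsilon>)\<^sup>2" using bes by linarith
        also have "\<dots> \<le> 2 * \<epsilon>" by (simp add: power2_eq_square algebra_simps)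
        finally have "\<bar>w \<bullet> s\<bar> \<le> sqrt (2 * \<epsilon>)" by (simp add: real_le_rsqrt)
        then show ?thesis using True se by (simp add: c_def inner_diff_left s_def)
      next
        case False
        have sgn1: "sgn e = e" "sgn (\<i> *s e) = \<i> *s e" using e ie by (simp_all add: sgn_div_norm)
        from False v consider "v = e" | "v = \<i> *s e" by auto
        then show ?thesis
        proof cases
          case 1
          have "e \<bullet> e = 1" using e norm_eq_1 by auto
          then show ?thesis using 1 False sgn1 re by (simp add: c_def inner_diff_left abs_minus_commute)
        next
          case 2
          have "\<bar>w \<bullet> (\<i> *s e)\<bar> < \<epsilon>"
            using hw abs_Im_le_cmod[of "1 - herm e w"] by (simp add: inner_imaginary)
          then show ?thesis using 2 False sgn1 eie by (simp add: c_def inner_diff_left)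
        qed
      qed
    qed (use finV U(2) zero \<epsilon> in \<open>auto simp: c_def\<close>)
    also have "(\<Prod>v\<in>?V. c v) = (\<Prod>v\<in>{e, \<i> *s e}. c v) * (\<Prod>v\<in>U. c v)"
      using finV U(1) by (intro prod.union_disjoint) auto
    also have "(\<Prod>v\<in>{e, \<i> *s e}. c v) = \<epsilon>\<^sup>2"
      using \<open>e \<noteq> \<i> *s e\<close> U(1) by (simp add: c_def power2_eq_square)
    also have "(\<Prod>v\<in>U. c v) = (sqrt (2 * \<epsilon>)) ^ (2 * (?n - 1))"
      by (simp add: c_def cardU)
    also have "\<dots> = (2 * \<epsilon>) ^ (?n - 1)" using \<epsilon> by (simp add: power_mult)
    also have "\<epsilon>\<^sup>2 * (2 * \<epsilon>) ^ (?n - 1) = 2 ^ (?n - 1) * \<epsilon> ^ (?n + 1)"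
    proof -
      have "?n + 1 = 2 + (?n - 1)" by (simp add: Suc_leI)
      then show ?thesis by (simp only: power_add power_mult_distrib) (simp only: mult_ac)
    qed
    also have "unit_ball_vol (real ?d) * (2 + 3 * real (card ?V)) ^ ?d * (2 ^ (?n - 1) * \<epsilon> ^ (?n + 1))
        \<le> unit_ball_vol (real ?d) * (2 + 3 * real (card ?V)) ^ ?d * (2 ^ ?n * \<epsilon> ^ (?n + 1))"
      using \<epsilon> by (intro mult_left_mono mult_right_mono power_increasing) auto
    also have "\<dots> = ?K * \<epsilon> ^ (?n + 1)" by (simp only: cardV mult_ac)
    also have "\<dots> \<le> (?K + measure lebesgue (ball (0 :: complex^'n) 1)) * \<epsilon> ^ (?n + 1)"
      using \<epsilon> by (intro mult_right_mono) auto
    finally show ?thesis by (simp add: \<epsilon>_def)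
  qed
qed

text \<open>With \<open>D\<close> the modulus of \<open>1 - herm z w\<close>, the vertex
  \<open>u\<close> lies on the ray of \<open>z\<close> at depth \<open>3 * D\<close>. The point
  \<open>z\<close> passes because \<open>1 - norm z \<le> D\<close>; for \<open>w\<close>,
  normalising \<open>z\<close> costs at most another \<open>1 - norm z\<close>, so the modulus is at
  most \<open>2 * D\<close>. If \<open>3 * D \<ge> 1\<close>, the whole ball serves.\<close>

lemma carleson_tent_through_points:
  fixes z w :: "complex^'n::finite"
  assumes z: "norm z < 1" and w: "norm w < 1"
  obtains u where "norm u < 1" "z \<in> carleson_tent u" "w \<in> carleson_tent u"
    "1 - norm u \<le> 3 * cmod (1 - herm z w)"
proof -
  define D where "D = cmod (1 - herm z w)"
  have "1 - norm z * norm w \<le> D"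
    using norm_triangle_ineq2[of 1 "herm z w"] norm_herm_le[of z w] by (simp add: D_def)
  moreover have "norm z * norm w \<le> norm z" using w by (simp add: mult_left_le)
  ultimately have zD: "1 - norm z \<le> D" by linarith
  then have D0: "0 < D" using z by linarith
  show ?thesis
  proof (cases "3 * D < 1")
    case True
    have z0: "z \<noteq> 0" using zD D0 True by auto
    define u where "u = (1 - 3 * D) *\<^sub>R sgn z"
    have nu: "norm u = 1 - 3 * D" using z0 True by (simp add: u_def norm_sgn)
    have u0: "u \<noteq> 0" using nu True by auto
    have hu: "herm u x / of_real (norm u) = herm z x / of_real (norm z)" for x
    proof -
      have "herm u x = of_real (1 - 3 * D) * (herm z x / of_real (norm z))"
        unfolding u_def sgn_div_norm herm_scaleR_left by (simp add: divide_inverse mult.commute)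
      moreover have "complex_of_real (1 - 3 * D) \<noteq> 0" using True by (simp only: of_real_eq_0_iff)
      ultimately show ?thesis unfolding nu by (metis nonzero_mult_div_cancel_left)
    qed
    show thesis
    proof
      show "norm u < 1" using nu D0 by simp
      show "1 - norm u \<le> 3 * cmod (1 - herm z w)" using nu by (simp add: D_def)
      have "herm z z / of_real (norm z) = of_real (norm z)"
        using z0 by (simp add: herm_self power2_eq_square)
      then have "cmod (1 - herm z z / of_real (norm z)) = cmod (of_real (1 - norm z))" by simp
      also have "\<dots> = 1 - norm z" using z by (subst norm_of_real) simp
      finally have "cmod (1 - herm u z / of_real (norm u)) < 1 - norm u"
        unfolding hu using zD D0 nu by linarith
      then show "z \<in> carleson_tent u"
        using z u0 by (simp add: carleson_tent_def)
      have "1 - herm z w / of_real (norm z) = (1 - herm z w) - herm z w * of_real (1 / norm z - 1)"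
        by (simp add: algebra_simps)
      then have "cmod (1 - herm z w / of_real (norm z)) \<le> D + cmod (herm z w) * \<bar>1 / norm z - 1\<bar>"
        unfolding D_def by (metis norm_mult norm_of_real norm_triangle_ineq4)
      also have "\<dots> \<le> D + norm z * 1 * \<bar>1 / norm z - 1\<bar>"
      proof -
        have "norm z * norm w \<le> norm z * 1" using w by (intro mult_left_mono) auto
        then show ?thesis using norm_herm_le[of z w] by (intro add_left_mono mult_right_mono) auto
      qed
      also have "\<dots> = D + (1 - norm z)"
        using z z0 by (simp add: field_simps)
      also have "\<dots> < 1 - norm u" using zD D0 nu by linarith
      finally have "cmod (1 - herm u w / of_real (norm u)) < 1 - norm u"
        unfolding hu .
      then show "w \<in> carleson_tent u"
        using w u0 by (simp add: carleson_tent_def)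
    qed
  next
    case False
    show thesis
    proof
      show "z \<in> carleson_tent 0" "w \<in> carleson_tent 0" using z w by (simp_all add: carleson_tent_def)
    qed (use False in \<open>auto simp: D_def\<close>)
  qed
qed

lemma (in bergman_dyadic) tent_through_points:
  obtains C where "0 < C"
    "\<And>z w :: complex^'n. norm z < 1 \<Longrightarrow> norm w < 1 \<Longrightarrow> \<exists>l<N. \<exists>S\<in>tents \<theta> (\<Q> l) (cen l).
      z \<in> S \<and> w \<in> S \<and> measure lebesgue S \<le> C * cmod (1 - herm z w) ^ (CARD('n) + 1)"
proof -
  obtain C where C: "0 < C" "\<And>u :: complex^'n. norm u < 1 \<Longrightarrow>
      measure lebesgue (carleson_tent u) \<le> C * (1 - norm u) ^ (CARD('n) + 1)"
    using carleson_tent_measure[where ?'n = 'n] by blast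
  obtain A where A: "0 < A" "\<And>z. z \<in> ball 0 1 \<Longrightarrow> \<exists>l<N. \<exists>S\<in>tents \<theta> (\<Q> l) (cen l).
      carleson_tent z \<subseteq> S \<and> comparable A (measure lebesgue (carleson_tent z)) (measure lebesgue S)"
    using carleson_in_tent by blast
  show thesis
  proof
    show "0 < A * C * 3 ^ (CARD('n) + 1)" using A C by simp
    fix z w :: "complex^'n" assume "norm z < 1" "norm w < 1"
    then obtain u where u: "norm u < 1" "z \<in> carleson_tent u" "w \<in> carleson_tent u"
        "1 - norm u \<le> 3 * cmod (1 - herm z w)"
      by (rule carleson_tent_through_points)
    then obtain l S where S: "l < N" "S \<in> tents \<theta> (\<Q> l) (cen l)" "carleson_tent u \<subseteq> S"
        "comparable A (measure lebesgue (carleson_tent u)) (measure lebesgue S)"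
      using A(2)[of u] by auto
    have "measure lebesgue S \<le> A * measure lebesgue (carleson_tent u)"
      using S(4) by (simp add: comparable_def)
    also have "\<dots> \<le> A * (C * (1 - norm u) ^ (CARD('n) + 1))"
      using C(2)[OF u(1)] A(1) by (intro mult_left_mono) auto
    also have "\<dots> \<le> A * (C * (3 * cmod (1 - herm z w)) ^ (CARD('n) + 1))"
      using A(1) C(1) u by (intro mult_left_mono power_mono) auto
    finally have "measure lebesgue S \<le> A * C * 3 ^ (CARD('n) + 1) * cmod (1 - herm z w) ^ (CARD('n) + 1)"
      by (simp only: power_mult_distrib mult_ac)
    then show "\<exists>l<N. \<exists>S\<in>tents \<theta> (\<Q> l) (cen l). z \<in> S \<and> w \<in> S \<and>
        measure lebesgue S \<le> A * C * 3 ^ (CARD('n) + 1) * cmod (1 - herm z w) ^ (CARD('n) + 1)"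
      using S u by blast
  qed
qed

section \<open>The tents of a dyadic system form a sparse tree\<close>

lemma bergman_dist_0: "bergman_dist w 0 = artanh (norm w)"
proof -
  have "ball_aut w 0 = w" by (simp add: ball_aut_def herm_def Let_def)
  then show ?thesis by (simp add: bergman_dist_def artanh_def)
qed

lemma artanh_nonneg_real: "0 \<le> (x::real) \<Longrightarrow> x < 1 \<Longrightarrow> 0 \<le> artanh x"
  by (simp add: artanh_def)

lemma tanh_artanh_real:
  assumes "0 \<le> (x::real)" "x < 1"
  shows "tanh (artanh x) = x"
proof -
  have "exp (- 2 * artanh x) = exp (- ln ((1 + x) / (1 - x)))" by (simp add: artanh_def)
  also have "\<dots> = (1 - x) / (1 + x)" using assms by (simp add: exp_minus)
  finally have e: "exp (- 2 * artanh x) = (1 - x) / (1 + x)" .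
  show ?thesis unfolding tanh_real_altdef e using assms by (simp add: field_simps)
qed

text \<open>The \<open>THE\<close> in the projection is justified: since \<open>artanh\<close> and
  \<open>tanh\<close> are inverse here, the only point of the ray at distance
  \<open>real k * \<theta>\<close> is the one of norm
  \<open>tanh (real k * \<theta>)\<close>.\<close>

lemma radial_proj_dist:
  assumes "z \<noteq> 0" "0 \<le> \<theta>"
  shows "radial_proj \<theta> k z \<in> ball 0 1" "bergman_dist (radial_proj \<theta> k z) 0 = real k * \<theta>"
proof -
  let ?r = "tanh (real k * \<theta>)"
  have r: "0 \<le> ?r" "?r < 1" using assms by (simp_all add: tanh_real_lt_1)
  let ?P = "\<lambda>w. w \<in> ball 0 1 \<and> (\<exists>t\<ge>0. w = t *\<^sub>R z) \<and> bergman_dist w 0 = real k * \<theta>"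
  have "?P ((?r / norm z) *\<^sub>R z)"
  proof (intro conjI exI)
    show "(?r / norm z) *\<^sub>R z \<in> ball 0 1" using r assms by simp
    show "bergman_dist ((?r / norm z) *\<^sub>R z) 0 = real k * \<theta>"
      using r assms by (simp add: bergman_dist_0 artanh_tanh_real)
    show "0 \<le> ?r / norm z" using r by simp
  qed simp
  moreover have "w = (?r / norm z) *\<^sub>R z" if "?P w" for w
  proof -
    obtain t where t: "0 \<le> t" "w = t *\<^sub>R z" "norm w < 1" "artanh (norm w) = real k * \<theta>"
      using \<open>?P w\<close> by (auto simp: bergman_dist_0)
    have "norm w = ?r" using t(3,4) using tanh_artanh_real[of "norm w"] by simp
    then have "t = ?r / norm z" using t assms by (simp add: field_simps)
    then show ?thesis using t by simp
  qed
  ultimately have "?P (radial_proj \<theta> k z)"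
    unfolding radial_proj_def by (rule theI)
  then show "radial_proj \<theta> k z \<in> ball 0 1" "bergman_dist (radial_proj \<theta> k z) 0 = real k * \<theta>"
    by auto
qed

definition kube_generation :: "real \<Rightarrow> (nat \<Rightarrow> (complex^'n::finite) set set) \<Rightarrow> complex^'n \<Rightarrow> nat" where
  "kube_generation \<theta> \<Q> x = (THE k. \<exists>K\<in>kubes \<theta> \<Q> k. x \<in> K)"

definition tents_of_generation :: "real \<Rightarrow> (nat \<Rightarrow> (complex^'n::finite) set set) \<Rightarrow>
    ((complex^'n) set \<Rightarrow> complex^'n) \<Rightarrow> nat \<Rightarrow> (complex^'n) set set" where
  "tents_of_generation \<theta> \<Q> cen k = tent \<theta> \<Q> cen ` kubes \<theta> \<Q> k"

lemma tents_eq_Union: "tents \<theta> \<Q> cen = (\<Union>k. tents_of_generation \<theta> \<Q> cen k)"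
  by (auto simp: tents_def tents_of_generation_def)

context bergman_dyadic
begin

lemma kube_dist:
  assumes "K \<in> kubes \<theta> (\<Q> l) k" "x \<in> K"
  shows "x \<in> ball 0 1" "real k * \<theta> \<le> bergman_dist x 0" "bergman_dist x 0 < (real k + 1) * \<theta>"
  using assms by (auto simp: kubes_def bergman_dist_0 artanh_nonneg_real split: if_splits)

lemma generation_unique:
  assumes "real j * \<theta> \<le> d" "d < (real j + 1) * \<theta>" "real k * \<theta> \<le> d" "d < (real k + 1) * \<theta>"
  shows "j = k"
proof -
  have "real j * \<theta> < (real k + 1) * \<theta>" "real k * \<theta> < (real j + 1) * \<theta>" using assms by linarith+
  then have "real j < real k + 1" "real k < real j + 1" using theta_pos by simp_all
  then show ?thesis by linarith
qed

context
  fixes l assumes l: "l < N"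
begin

abbreviation "Kb \<equiv> kubes \<theta> (\<Q> l)"
abbreviation "child \<equiv> kube_child \<theta> (\<Q> l) (cen l)"
abbreviation "tnt \<equiv> tent \<theta> (\<Q> l) (cen l)"

lemma kube_cover:
  assumes "x \<in> ball 0 1"
  obtains k K where "K \<in> Kb k" "x \<in> K"
  using assms partition_onD1[OF kubes_partition[OF l]] by blast

lemma kube_unique:
  assumes "K \<in> Kb k" "K' \<in> Kb k'" "x \<in> K" "x \<in> K'"
  shows "K = K'" "k = k'"
  using disjointD[OF partition_onD2[OF kubes_partition[OF l]], of K K'] assms
    generation_unique[of k "bergman_dist x 0" k'] kube_dist[OF assms(1,3)] kube_dist[OF assms(2,4)]
  by auto

lemma kube_nonempty: "K \<in> Kb k \<Longrightarrow> K \<noteq> {}"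
  using partition_onD3[OF kubes_partition[OF l]] by blast

lemma kube_level_unique: "K \<in> Kb k \<Longrightarrow> K \<in> Kb k' \<Longrightarrow> k = k'"
  using kube_nonempty kube_unique(2) by blast

lemma child_exists:
  assumes "J \<in> Kb (Suc k)"
  obtains K where "K \<in> Kb k" "(J, K) \<in> child"
proof -
  have "real (Suc k) * \<theta> \<le> bergman_dist (cen l J) 0"
    using kube_dist[OF assms cen_in[OF l assms]] by simp
  moreover have "0 < real (Suc k) * \<theta>" using theta_pos by simp
  ultimately have "cen l J \<noteq> 0" by (auto simp: bergman_dist_0)
  then have p: "radial_proj \<theta> k (cen l J) \<in> ball 0 1" "bergman_dist (radial_proj \<theta> k (cen l J)) 0 = real k * \<theta>"
    using radial_proj_dist[OF _ less_imp_le[OF theta_pos]] by blast+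
  obtain i K where K: "K \<in> Kb i" "radial_proj \<theta> k (cen l J) \<in> K" using kube_cover[OF p(1)] by blast
  \<comment> \<open>The projected center sits on the closed inner edge of the half-open annulus of
    generation \<open>k\<close>, which fixes the generation of its kube.\<close>
  have "i = k"
    using generation_unique[of i "real k * \<theta>" k] kube_dist[OF K] p(2) theta_pos by (simp add: algebra_simps)
  then show thesis using that K assms by (auto simp: kube_child_def)
qed

lemma childD:
  assumes "(J, K) \<in> child"
  obtains k where "K \<in> Kb k" "J \<in> Kb (Suc k)" "radial_proj \<theta> k (cen l J) \<in> K"
  using assms by (auto simp: kube_child_def)

lemma child_unique:
  assumes "(J, K) \<in> child" "(J, K') \<in> child"
  shows "K = K'"
proof -
  obtain k where k: "K \<in> Kb k" "J \<in> Kb (Suc k)" "radial_proj \<theta> k (cen l J) \<in> K" using assms(1) by (rule childD)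
  obtain k' where k': "K' \<in> Kb k'" "J \<in> Kb (Suc k')" "radial_proj \<theta> k' (cen l J) \<in> K'" using assms(2) by (rule childD)
  have "k = k'" using kube_level_unique k(2) k'(2) by blast
  then show ?thesis using k k' kube_unique(1) by blast
qed

lemma descendant_generation:
  assumes "(J, K) \<in> child\<^sup>*" "J \<in> Kb j"
  shows "\<exists>i\<le>j. K \<in> Kb i"
  using assms
proof (induction rule: rtrancl_induct)
  case (step K K')
  then obtain i where i: "i \<le> j" "K \<in> Kb i" by blast
  obtain k where "K' \<in> Kb k" "K \<in> Kb (Suc k)" using step.hyps(2) by (rule childD)
  then show ?case using kube_level_unique i by (metis Suc_leD)
qed blast

lemma ancestor_exists:
  assumes "J \<in> Kb j" "k \<le> j"
  shows "\<exists>K\<in>Kb k. (J, K) \<in> child\<^sup>*"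
  using assms
proof (induction j arbitrary: J)
  case (Suc j)
  show ?case
  proof (cases "k = Suc j")
    case False
    obtain J' where J': "J' \<in> Kb j" "(J, J') \<in> child" using child_exists Suc.prems by blast
    then obtain K where "K \<in> Kb k" "(J', K) \<in> child\<^sup>*" using Suc.IH False Suc.prems by (metis le_SucE)
    then show ?thesis using J' by (meson converse_rtrancl_into_rtrancl)
  qed (use Suc.prems in blast)
qed blast

lemma ancestor_unique:
  assumes "(J, K) \<in> child\<^sup>*" "(J, K') \<in> child\<^sup>*" "J \<in> Kb j" "K \<in> Kb k" "K' \<in> Kb k"
  shows "K = K'"
  using assms
proof (induction j arbitrary: J rule: less_induct)
  case (less j)
  \<comment> \<open>Each step of \<open>child\<close> lowers the generation by exactly one, so a
    chain that starts and ends in the same generation is trivial.\<close>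
  have stay: "X = Y" if "(X, Y) \<in> child\<^sup>*" "X \<in> Kb k" "Y \<in> Kb k" for X Y
    using that(1)
  proof (cases rule: converse_rtranclE)
    case (step X')
    obtain i where "X' \<in> Kb i" "X \<in> Kb (Suc i)" using step(1) by (rule childD)
    moreover have "\<exists>i'\<le>i. Y \<in> Kb i'" using descendant_generation step(2) \<open>X' \<in> Kb i\<close> by blast
    ultimately show ?thesis using that kube_level_unique by (metis Suc_n_not_le_n)
  qed simp
  show ?case
  proof (cases "J \<in> Kb k")
    case True
    then show ?thesis using stay less.prems by metis
  next
    case False
    then have "J \<noteq> K" "J \<noteq> K'" using less.prems by auto
    then obtain J1 J2 where J: "(J, J1) \<in> child" "(J1, K) \<in> child\<^sup>*" "(J, J2) \<in> child" "(J2, K') \<in> child\<^sup>*"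
      using less.prems(1,2) by (meson converse_rtranclE)
    then have "J1 = J2" using child_unique by blast
    obtain i where i: "J1 \<in> Kb i" "J \<in> Kb (Suc i)" using J(1) by (rule childD)
    then have "i < j" using kube_level_unique less.prems(3) by blast
    then show ?thesis using less.IH[of i J1] i J \<open>J1 = J2\<close> less.prems by blast
  qed
qed

lemma descendant_kube: "(J, K) \<in> child\<^sup>* \<Longrightarrow> K \<in> Kb k \<Longrightarrow> \<exists>j. J \<in> Kb j"
  by (erule converse_rtranclE) (auto elim: childD)

text \<open>The kubes partition the ball, so the kube of \<open>x\<close> is the only possible
  descendant through \<open>x\<close>. Questions about tents thus become questions about the
  relation \<open>child\<close>.\<close>

lemma mem_tent_iff:
  assumes "J \<in> Kb j" "x \<in> J" "K \<in> Kb k"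
  shows "x \<in> tnt K \<longleftrightarrow> (J, K) \<in> child\<^sup>*"
proof
  assume "x \<in> tnt K"
  then obtain J' where J': "(J', K) \<in> child\<^sup>*" "x \<in> J'" by (auto simp: tent_def)
  then obtain j' where "J' \<in> Kb j'" using descendant_kube assms by blast
  then show "(J, K) \<in> child\<^sup>*" using J' assms kube_unique(1) by blast
qed (use assms in \<open>auto simp: tent_def\<close>)

lemma kube_subset_tent: "K \<subseteq> tnt K"
  by (auto simp: tent_def)

lemma tent_subset_ball:
  assumes "K \<in> Kb k"
  shows "tnt K \<subseteq> ball 0 1"
  unfolding tent_def using assms descendant_kube kube_dist(1) by blast

lemma kube_generation_eq:
  assumes "J \<in> Kb j" "x \<in> J"
  shows "kube_generation \<theta> (\<Q> l) x = j"
  unfolding kube_generation_def using assms kube_unique(2) by (intro the_equality) blast+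

text \<open>There is one root, every kube has finitely many children, and every kube of a later
  generation has a parent.\<close>

lemma finite_kubes: "finite (Kb k)"
proof (induction k)
  case (Suc k)
  have "Kb (Suc k) \<subseteq> (\<Union>K\<in>Kb k. {J. (J, K) \<in> child})"
    using child_exists by blast
  moreover have "finite {J. (J, K) \<in> child}" if "K \<in> Kb k" for K
    using children_bound that l by blast
  ultimately show ?case using Suc by (meson finite_UN finite_subset)
qed (simp add: kubes_def)

lemma tents_of_generation_cover:
  "\<Union>(tents_of_generation \<theta> (\<Q> l) (cen l) k) = {x \<in> ball 0 1. k \<le> kube_generation \<theta> (\<Q> l) x}"
proof (intro subset_antisym subsetI)
  fix x assume "x \<in> \<Union>(tents_of_generation \<theta> (\<Q> l) (cen l) k)"
  then obtain K where K: "K \<in> Kb k" "x \<in> tnt K" by (auto simp: tents_of_generation_def)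
  then have x: "x \<in> ball 0 1" using tent_subset_ball by blast
  then obtain j J where J: "J \<in> Kb j" "x \<in> J" by (rule kube_cover)
  then have "(J, K) \<in> child\<^sup>*" using mem_tent_iff K by blast
  then have "k \<le> j" using descendant_generation J K kube_level_unique by blast
  then show "x \<in> {x \<in> ball 0 1. k \<le> kube_generation \<theta> (\<Q> l) x}"
    using x kube_generation_eq[OF J] by simp
next
  fix x assume x: "x \<in> {x \<in> ball 0 1. k \<le> kube_generation \<theta> (\<Q> l) x}"
  then obtain j J where J: "J \<in> Kb j" "x \<in> J" using kube_cover by blast
  then have "k \<le> j" using x kube_generation_eq by simp
  then obtain K where "K \<in> Kb k" "(J, K) \<in> child\<^sup>*" using ancestor_exists J by blast
  then show "x \<in> \<Union>(tents_of_generation \<theta> (\<Q> l) (cen l) k)"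
    using mem_tent_iff J by (auto simp: tents_of_generation_def)
qed

end

text \<open>A kube occupies a fixed fraction of its tent, and the rest of the tent consists of kubes of
  later generations.\<close>

proposition sparse_tree_tents:
  obtains a D where "\<And>l. l < N \<Longrightarrow> sparse_tree (lebesgue_on (ball 0 1))
      (kube_generation \<theta> (\<Q> l)) (tents_of_generation \<theta> (\<Q> l) (cen l)) a D"
proof -
  obtain A0 where A0: "0 < A0" "\<And>l k K. l < N \<Longrightarrow> K \<in> kubes \<theta> (\<Q> l) k \<Longrightarrow>
        comparable A0 (measure lebesgue (tent \<theta> (\<Q> l) (cen l) K)) (measure lebesgue K) \<and>
        comparable A0 (measure lebesgue K) (exp (- 2 * (real CARD('n) + 1) * \<theta> * real k))"
    using tent_measure by blast
  \<comment> \<open>The 2 keeps \<open>A - 1\<close> positive for the definition of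
    \<open>a\<close>.\<close>
  define A where "A = max 2 A0"
  define E where "E k = exp (- 2 * (real CARD('n) + 1) * \<theta> * real k)" for k
  have A: "2 \<le> A" by (simp add: A_def)
  have le: "measure lebesgue (tent \<theta> (\<Q> l) (cen l) K) \<le> A * measure lebesgue K"
      "measure lebesgue K \<le> A * measure lebesgue (tent \<theta> (\<Q> l) (cen l) K)"
      "measure lebesgue K \<le> A * E k" "E k \<le> A * measure lebesgue K"
    if "l < N" "K \<in> kubes \<theta> (\<Q> l) k" for l k K
  proof -
    have up: "u \<le> A0 * v \<Longrightarrow> 0 \<le> v \<Longrightarrow> u \<le> A * v" for u v :: real
      using mult_right_mono[of A0 A v] by (simp add: A_def)
    show "measure lebesgue (tent \<theta> (\<Q> l) (cen l) K) \<le> A * measure lebesgue K"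
      "measure lebesgue K \<le> A * measure lebesgue (tent \<theta> (\<Q> l) (cen l) K)"
      "measure lebesgue K \<le> A * E k" "E k \<le> A * measure lebesgue K"
      using A0(2)[OF that] by (auto simp: comparable_def E_def intro!: up)
  qed
  have Epos: "0 < E k" for k by (simp add: E_def)
  have kpos: "0 < measure lebesgue K" if "l < N" "K \<in> kubes \<theta> (\<Q> l) k" for l k K
    using le(4)[OF that] Epos[of k] A by (smt (verit) mult_nonneg_nonpos)
  have tpos: "0 < measure lebesgue (tent \<theta> (\<Q> l) (cen l) K)" if "l < N" "K \<in> kubes \<theta> (\<Q> l) k" for l k K
    using le(2)[OF that] kpos[OF that] A by (smt (verit) mult_nonneg_nonpos)
  \<comment> \<open>A kube fills at least the fraction \<open>1 / A\<close> of its tent, so the rest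
    is at most \<open>(A - 1) / A\<close> of it, the reciprocal of \<open>a ^ 8\<close>.\<close>
  define a where "a = root 8 (A / (A - 1))"
  have a8: "a ^ 8 = A / (A - 1)" using A by (simp add: a_def)
  have a1: "1 < a" using A by (simp add: a_def)
  \<comment> \<open>Two comparisons lead from the parent's tent to the model size
    \<open>E k\<close>, two more from \<open>E (Suc k)\<close> to the child's tent; the exponential
    is the ratio of the model sizes.\<close>
  define D where "D = A ^ 4 * exp (2 * (real CARD('n) + 1) * \<theta>)"
  have meas: "measure (lebesgue_on (ball 0 1)) S = measure lebesgue S" if "S \<subseteq> ball 0 1" for S :: "(complex^'n) set"
    using that by (intro measure_restrict_space) auto
  show thesis
  proof (rule that)
    fix l assume l: "l < N"
    let ?T = "tents_of_generation \<theta> (\<Q> l) (cen l)"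
    let ?g = "kube_generation \<theta> (\<Q> l)"
    let ?t = "tent \<theta> (\<Q> l) (cen l)"
    let ?M = "lebesgue_on (ball (0 :: complex^'n) 1)"
    \<comment> \<open>Measurability is read off from positivity, since \<open>measure\<close> is 0
      on nonmeasurable sets.\<close>
    have tsets: "?t K \<in> sets lebesgue" if "K \<in> kubes \<theta> (\<Q> l) k" for K k
      using tpos[OF l that] measure_notin_sets by force
    have ksets: "K \<in> sets lebesgue" if "K \<in> kubes \<theta> (\<Q> l) k" for K k
      using kpos[OF l that] measure_notin_sets by force
    note tball = tent_subset_ball[OF l]
    have tfm: "?t K \<in> lmeasurable" if "K \<in> kubes \<theta> (\<Q> l) k" for K k
      using tsets[OF that] tball[OF that] bounded_ball bounded_set_imp_lmeasurable bounded_subset by blast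
    interpret finite_measure ?M
      using emeasure_lborel_ball_finite[of "0 :: complex^'n" 1]
      by (intro finite_measureI) (simp add: emeasure_restrict_space less_top)
    show "sparse_tree ?M ?g ?T a D"
    proof
      show "1 < a" by (fact a1)
      have "1 * 1 \<le> A ^ 4 * exp (2 * (real CARD('n) + 1) * \<theta>)"
        using A theta_pos by (intro mult_mono one_le_power) auto
      then show "1 \<le> D" by (simp add: D_def)
      show "finite (?T k)" for k unfolding tents_of_generation_def using finite_kubes[OF l] by blast
      show "disjoint (?T k)" for k
      proof (rule disjointI)
        fix S S' assume S: "S \<in> ?T k" "S' \<in> ?T k" "S \<noteq> S'"
        then obtain K K' where K: "K \<in> kubes \<theta> (\<Q> l) k" "S = ?t K" "K' \<in> kubes \<theta> (\<Q> l) k" "S' = ?t K'"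
          by (auto simp: tents_of_generation_def)
        show "S \<inter> S' = {}"
        proof (rule ccontr)
          assume "S \<inter> S' \<noteq> {}"
          then obtain x where x: "x \<in> ?t K" "x \<in> ?t K'" using K by blast
          then have "x \<in> ball 0 1" using tball K(1) by blast
          then obtain j J where J: "J \<in> kubes \<theta> (\<Q> l) j" "x \<in> J" using kube_cover[OF l] by blast
          have "K = K'"
            using ancestor_unique[OF l _ _ J(1) K(1) K(3)] mem_tent_iff[OF l J] K x by blast
          then show False using S(3) K by simp
        qed
      qed
      show "\<Union>(?T k) = {x \<in> space ?M. k \<le> ?g x}" for k
        using tents_of_generation_cover[OF l, of k] by simp
      show "S \<in> sets ?M" if S: "S \<in> ?T k" for S k
      proof -
        obtain K where K: "K \<in> kubes \<theta> (\<Q> l) k" "S = ?t K" using S by (auto simp: tents_of_generation_def)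
        have "S \<subseteq> ball 0 1" "S \<in> sets lebesgue" using tsets[OF K(1)] tball[OF K(1)] K(2) by auto
        then show ?thesis by (subst sets_restrict_space_iff) auto
      qed
      show "0 < measure ?M S" if "S \<in> ?T k" for S k
        using that tpos[OF l] tball by (auto simp: tents_of_generation_def meas)
      show "\<exists>S'\<in>?T k. S \<subseteq> S' \<and> measure ?M S' \<le> D * measure ?M S" if S: "S \<in> ?T (Suc k)" for S k
      proof -
        obtain J where J: "J \<in> kubes \<theta> (\<Q> l) (Suc k)" "S = ?t J" using S by (auto simp: tents_of_generation_def)
        then obtain K where K: "K \<in> kubes \<theta> (\<Q> l) k" "(J, K) \<in> kube_child \<theta> (\<Q> l) (cen l)"
          using child_exists[OF l] by blast
        have "measure lebesgue (?t K) \<le> A * (A * E k)"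
          using le(1,3)[OF l K(1)] A by (meson mult_left_mono order_trans zero_le_numeral)
        also have "E k = exp (2 * (real CARD('n) + 1) * \<theta>) * E (Suc k)"
          unfolding E_def by (simp add: exp_add[symmetric] algebra_simps)
        also have "A * (A * (exp (2 * (real CARD('n) + 1) * \<theta>) * E (Suc k)))
            \<le> A * (A * (exp (2 * (real CARD('n) + 1) * \<theta>) * (A * (A * measure lebesgue (?t J)))))"
        proof -
          have "E (Suc k) \<le> A * (A * measure lebesgue (?t J))"
            using le(2,4)[OF l J(1)] A by (meson mult_left_mono order_trans zero_le_numeral)
          then show ?thesis using A by (intro mult_left_mono) auto
        qed
        also have "\<dots> = D * measure lebesgue (?t J)" by (simp add: D_def power4_eq_xxxx)
        finally have "measure ?M (?t K) \<le> D * measure ?M S"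
          using meas[OF tball[OF K(1)]] meas[OF tball[OF J(1)]] J(2) by simp
        moreover have "S \<subseteq> ?t K" unfolding J(2) tent_def using K(2) by (blast intro: rtrancl_trans)
        ultimately show ?thesis using K by (auto simp: tents_of_generation_def)
      qed
      show "a ^ 8 * measure ?M (S \<inter> {x. Suc k \<le> ?g x}) \<le> measure ?M S" if S: "S \<in> ?T k" for S k
      proof -
        obtain K where K: "K \<in> kubes \<theta> (\<Q> l) k" "S = ?t K" using S by (auto simp: tents_of_generation_def)
        let ?R = "S \<inter> {x. Suc k \<le> ?g x}"
        have "?R \<subseteq> ?t K - K" using K kube_generation_eq[OF l K(1)] by auto
        moreover have "?t K - K \<in> lmeasurable" using tfm[OF K(1)] ksets[OF K(1)] by (rule fmeasurable_Diff)
        ultimately have "measure lebesgue ?R \<le> measure lebesgue (?t K - K)"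
          by (cases "?R \<in> sets lebesgue") (auto intro: measure_mono_fmeasurable simp: measure_notin_sets)
        also have "\<dots> = measure lebesgue (?t K) - measure lebesgue K"
          using tfm[OF K(1)] ksets[OF K(1)] kube_subset_tent[OF l] by (intro measurable_measure_Diff) auto
        also have "\<dots> \<le> measure lebesgue (?t K) - measure lebesgue (?t K) / A"
          using le(1)[OF l K(1)] A by (simp add: field_simps)
        also have "\<dots> = measure lebesgue (?t K) / a ^ 8"
          using A by (simp add: a8 field_simps)
        finally have "a ^ 8 * measure lebesgue ?R \<le> measure lebesgue (?t K)"
          using a1 by (simp add: field_simps)
        moreover have "?R \<subseteq> ball 0 1" using tball[OF K(1)] K(2) by blast
        ultimately show ?thesis using meas[of ?R] meas[OF tball[OF K(1)]] K(2) by simp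
      qed
    qed
  qed
qed

end

text \<open>Moves the level and all constants into \<open>F\<close>, so that the weak-type estimate
  at level 1 is enough.\<close>

lemma (in oscillation_on_tree) osc_op_cmult:
  assumes [measurable]: "F \<in> borel_measurable M" and "0 \<le> \<kappa>" "x \<in> space M"
  shows "osc_op (\<lambda>y. \<kappa> * F y) x = ennreal \<kappa> * osc_op F x"
proof -
  have "(\<integral>\<^sup>+y. ennreal (norm (b x - b y) * (\<kappa> * F y)) * indicator S y \<partial>M)
      = ennreal \<kappa> * (\<integral>\<^sup>+y. ennreal (norm (b x - b y) * F y) * indicator S y \<partial>M)" if "S \<in> T k" for S k
  proof -
    have [measurable]: "S \<in> sets M" using that sets_T by blast
    have "ennreal (norm (b x - b y) * (\<kappa> * F y)) = ennreal \<kappa> * ennreal (norm (b x - b y) * F y)" for y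
      using \<open>0 \<le> \<kappa>\<close> by (subst ennreal_mult'[symmetric]) (simp_all add: mult_ac)
    then show ?thesis by (simp add: mult.assoc nn_integral_cmult)
  qed
  then have "osc_op (\<lambda>y. \<kappa> * F y) x = (\<Sum>k. \<Sum>S\<in>T k. ennreal \<kappa> * (indicator S x *
     ((\<integral>\<^sup>+y. ennreal (norm (b x - b y) * F y) * indicator S y \<partial>M) / emeasure M S)))"
    unfolding osc_op_def by (intro suminf_cong sum.cong) (auto simp: ennreal_times_divide mult.left_commute)
  then show ?thesis
    by (simp only: osc_op_def ennreal_suminf_cmult sum_distrib_left[symmetric])
qed

section \<open>The commutator\<close>

text \<open>Outside the ball \<open>b\<close> and \<open>f\<close> are arbitrary, so measurability
  and integrability are available for the restricted measure only.\<close>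

abbreviation unit_ball_measure :: "(complex^'n::finite) measure" where
  "unit_ball_measure \<equiv> lebesgue_on (ball 0 1)"

lemma nn_integral_unit_ball:
  "(\<integral>\<^sup>+x. f x \<partial>unit_ball_measure) = (\<integral>\<^sup>+x\<in>ball 0 1. f x \<partial>lebesgue)"
  by (rule nn_integral_restrict_space) simp

lemma set_integral_unit_ball:
  fixes f :: "complex^'n::finite \<Rightarrow> complex"
  shows "(LINT x:ball 0 1|lebesgue. f x) = (\<integral>x. f x \<partial>unit_ball_measure)"
  unfolding set_lebesgue_integral_def by (rule integral_restrict_space[symmetric]) simp

text \<open>Integrability on compact sets gives measurability on each closed ball of radius below 1,
  and these exhaust the open ball.\<close>

lemma locally_integrable_ball_measurable:
  fixes b :: "complex^'n::finite \<Rightarrow> complex"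
  assumes "locally_integrable_ball b"
  shows "b \<in> borel_measurable unit_ball_measure"
proof -
  define r where "r n = 1 - inverse (real (Suc n))" for n
  have r1: "r n < 1" for n by (simp add: r_def)
  have meas: "(\<lambda>x. indicator (cball 0 (r n)) x *\<^sub>R b x) \<in> borel_measurable lebesgue" for n
  proof -
    have "cball 0 (r n) \<subseteq> ball (0 :: complex^'n) 1" using r1[of n] by auto
    then have "set_integrable lebesgue (cball 0 (r n)) b"
      using assms by (auto simp: locally_integrable_ball_def)
    then show ?thesis unfolding set_integrable_def by (rule borel_measurable_integrable)
  qed
  have "(\<lambda>x. indicator (ball 0 1) x *\<^sub>R b x) \<in> borel_measurable lebesgue"
  proof (rule borel_measurable_LIMSEQ_metric[OF meas])
    fix x :: "complex^'n"
    show "(\<lambda>n. indicator (cball 0 (r n)) x *\<^sub>R b x) \<longlonglongrightarrow> indicator (ball 0 1) x *\<^sub>R b x"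
    proof (cases "norm x < 1")
      case True
      have "r \<longlonglongrightarrow> 1 - 0"
        unfolding r_def by (intro tendsto_diff tendsto_const LIMSEQ_inverse_real_of_nat)
      then have "r \<longlonglongrightarrow> 1" by simp
      then have "eventually (\<lambda>n. norm x < r n) sequentially" using True by (rule order_tendstoD(1))
      then have "eventually (\<lambda>n. indicator (cball 0 (r n)) x *\<^sub>R b x = indicator (ball 0 1) x *\<^sub>R b x) sequentially"
        by eventually_elim (use True in auto)
      then show ?thesis by (rule tendsto_eventually)
    next
      case False
      then have "indicator (cball 0 (r n)) x = (0::real)" for n using r1[of n] by (auto simp: indicator_def)
      then show ?thesis using False by (simp add: indicator_def)
    qed
  qed
  then show ?thesis by (subst borel_measurable_restrict_space_iff) auto
qed

lemma herm_continuous: "continuous_on UNIV (\<lambda>w. herm z w)"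
  unfolding herm_def by (intro continuous_intros)

lemma one_minus_herm_ge:
  fixes z w :: "complex^'n::finite"
  assumes "norm w < 1"
  shows "1 - norm z \<le> cmod (1 - herm z w)"
proof -
  have "norm z * norm w \<le> norm z * 1" using assms by (intro mult_left_mono) auto
  then show ?thesis
    using norm_triangle_ineq2[of 1 "herm z w"] norm_herm_le[of z w] by simp
qed

text \<open>For fixed \<open>z\<close> the kernel is bounded in \<open>w\<close>, by
  \<open>one_minus_herm_ge\<close>.\<close>

lemma integrable_bergman_kernel:
  fixes h :: "complex^'n::finite \<Rightarrow> complex"
  assumes h: "integrable unit_ball_measure h" and z: "norm z < 1"
  shows "integrable unit_ball_measure (\<lambda>w. h w / (1 - herm z w) ^ k)"
proof (rule Bochner_Integration.integrable_bound)
  show "integrable unit_ball_measure (\<lambda>w. (1 / (1 - norm z)) ^ k * norm (h w))"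
    using h by simp
  have [measurable]: "herm z \<in> borel_measurable unit_ball_measure"
    by (rule measurable_restrict_space1, rule measurable_completion)
      (simp add: borel_measurable_continuous_onI herm_continuous)
  have [measurable]: "h \<in> borel_measurable unit_ball_measure" using h by simp
  show "(\<lambda>w. h w / (1 - herm z w) ^ k) \<in> borel_measurable unit_ball_measure" by measurable
  show "AE w in unit_ball_measure. norm (h w / (1 - herm z w) ^ k) \<le> norm ((1 / (1 - norm z)) ^ k * norm (h w))"
  proof (rule AE_I2)
    fix w :: "complex^'n" assume "w \<in> space unit_ball_measure"
    then have "1 - norm z \<le> cmod (1 - herm z w)" using one_minus_herm_ge by simp
    then have "(1 - norm z) ^ k \<le> cmod (1 - herm z w) ^ k" using z by (intro power_mono) auto
    then have "norm (h w) / cmod (1 - herm z w) ^ k \<le> norm (h w) / (1 - norm z) ^ k"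
      using zero_less_power[of "1 - norm z" k] z by (intro divide_left_mono mult_pos_pos) (linarith | simp)+
    then show "norm (h w / (1 - herm z w) ^ k) \<le> norm ((1 / (1 - norm z)) ^ k * norm (h w))"
      using z by (simp add: norm_divide norm_power norm_mult power_one_over divide_simps)
  qed
qed

text \<open>The product is integrable because \<open>f\<close> is bounded and vanishes off a compact
  set, on which \<open>b\<close> is integrable.\<close>

lemma commutator_integrable:
  fixes b :: "complex^'n::finite \<Rightarrow> complex"
  assumes b: "locally_integrable_ball b" and f: "bounded_compact_support f"
  shows "integrable unit_ball_measure f" "integrable unit_ball_measure (\<lambda>w. cnj (b w) * f w)"
proof -
  have fm [measurable]: "f \<in> borel_measurable unit_ball_measure" using f by (simp add: bounded_compact_support_def)
  have bm [measurable]: "b \<in> borel_measurable unit_ball_measure" using locally_integrable_ball_measurable[OF b] .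
  obtain K where K: "\<And>w. w \<in> ball 0 1 \<Longrightarrow> norm (f w) \<le> K"
    using f unfolding bounded_compact_support_def bounded_iff by blast
  obtain S where S: "compact S" "S \<subseteq> ball 0 1" "\<And>z. z \<in> ball 0 1 - S \<Longrightarrow> f z = 0"
    using f unfolding bounded_compact_support_def by blast
  interpret finite_measure "unit_ball_measure :: (complex^'n) measure"
    using emeasure_lborel_ball_finite[of "0 :: complex^'n" 1]
    by (intro finite_measureI) (simp add: emeasure_restrict_space less_top)
  show "integrable unit_ball_measure f"
    using K by (intro integrable_const_bound[where B = K]) auto
  have "integrable lebesgue (\<lambda>x. indicator S x *\<^sub>R b x)"
    using b S by (auto simp: locally_integrable_ball_def set_integrable_def)
  moreover have "indicator (ball 0 1) x *\<^sub>R (indicator S x *\<^sub>R b x) = indicator S x *\<^sub>R b x" for x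
    using S by (auto simp: indicator_def)
  ultimately have int: "integrable unit_ball_measure (\<lambda>x. indicator S x *\<^sub>R b x)"
    by (subst integrable_restrict_space) (simp_all only: sets.Int_space_eq2 lborelD borel_open sets_completionI_sets open_ball sets_lborel)
  have [measurable]: "(\<lambda>w. cnj (b w)) \<in> borel_measurable unit_ball_measure"
    using measurable_compose[OF bm borel_measurable_continuous_onI[OF continuous_on_cnj[OF continuous_on_id]]] by simp
  show "integrable unit_ball_measure (\<lambda>w. cnj (b w) * f w)"
  proof (rule Bochner_Integration.integrable_bound)
    show "integrable unit_ball_measure (\<lambda>x. K * norm (indicator S x *\<^sub>R b x))"
      by (rule integrable_mult_right[OF integrable_norm[OF int]])
    show "AE x in unit_ball_measure. norm (cnj (b x) * f x) \<le> norm (K * norm (indicator S x *\<^sub>R b x))"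
    proof (rule AE_I2)
      fix x :: "complex^'n" assume "x \<in> space unit_ball_measure"
      then have x: "x \<in> ball 0 1" by simp
      have "0 \<le> K" using K[OF x] norm_ge_zero order_trans by blast
      then show "norm (cnj (b x) * f x) \<le> norm (K * norm (indicator S x *\<^sub>R b x))"
        using mult_left_mono[OF K[OF x] norm_ge_zero[of "b x"]] S(3)[of x] x
        by (cases "x \<in> S") (auto simp: norm_mult mult.commute)
    qed
  qed measurable
qed

text \<open>Integrability of both parts allows them to be merged into one integral with the factor
  \<open>cnj (b z - b w)\<close>. After taking absolute values only the size of the kernel
  matters.\<close>

lemma commutator_le:
  fixes z :: "complex^'n::finite"
  assumes b: "locally_integrable_ball b" and f: "bounded_compact_support f" and z: "norm z < 1"
  shows "ennreal (norm (bergman_commutator (\<lambda>w. cnj (b w)) f z)) \<le> ennreal (fact CARD('n) / pi ^ CARD('n)) *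
    (\<integral>\<^sup>+w. ennreal (norm (b z - b w) * norm (f w) * (1 / cmod (1 - herm z w) ^ (CARD('n) + 1))) \<partial>unit_ball_measure)"
proof -
  let ?m = "CARD('n) + 1" and ?cc = "fact CARD('n) / pi ^ CARD('n) :: real"
  let ?k = "\<lambda>w. (1 - herm z w) ^ ?m"
  have i1: "integrable unit_ball_measure (\<lambda>w. f w / ?k w)"
    and i2: "integrable unit_ball_measure (\<lambda>w. (cnj (b w) * f w) / ?k w)"
    using commutator_integrable[OF b f] z by (auto intro!: integrable_bergman_kernel simp del: power_Suc)
  have "bergman_commutator (\<lambda>w. cnj (b w)) f z
      = of_real ?cc * (cnj (b z) * (\<integral>w. f w / ?k w \<partial>unit_ball_measure) - (\<integral>w. (cnj (b w) * f w) / ?k w \<partial>unit_ball_measure))"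
    unfolding bergman_commutator_def bergman_proj_def set_integral_unit_ball by (simp only: right_diff_distrib mult_ac)
  also have "cnj (b z) * (\<integral>w. f w / ?k w \<partial>unit_ball_measure) - (\<integral>w. (cnj (b w) * f w) / ?k w \<partial>unit_ball_measure)
      = (\<integral>w. cnj (b z) * (f w / ?k w) - (cnj (b w) * f w) / ?k w \<partial>unit_ball_measure)"
    using i1 i2 by (simp only: Bochner_Integration.integral_diff[OF integrable_mult_right[OF i1] i2] integral_mult_right_zero)
  finally have "norm (bergman_commutator (\<lambda>w. cnj (b w)) f z)
      = ?cc * norm (\<integral>w. cnj (b z) * (f w / ?k w) - (cnj (b w) * f w) / ?k w \<partial>unit_ball_measure)"
    by (simp only: norm_mult norm_of_real) simp
  then have "ennreal (norm (bergman_commutator (\<lambda>w. cnj (b w)) f z))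
      = ennreal ?cc * ennreal (norm (\<integral>w. cnj (b z) * (f w / ?k w) - (cnj (b w) * f w) / ?k w \<partial>unit_ball_measure))"
    by (simp only: ennreal_mult' [of ?cc] pi_ge_zero divide_nonneg_nonneg fact_ge_zero zero_le_power)
  also have "\<dots> \<le> ennreal ?cc * (\<integral>\<^sup>+w. ennreal (norm (cnj (b z) * (f w / ?k w) - (cnj (b w) * f w) / ?k w)) \<partial>unit_ball_measure)"
    using i1 i2 by (intro mult_left_mono integral_norm_bound_ennreal Bochner_Integration.integrable_diff integrable_mult_right) auto
  also have "(\<lambda>w. norm (cnj (b z) * (f w / ?k w) - (cnj (b w) * f w) / ?k w))
      = (\<lambda>w. norm (b z - b w) * norm (f w) * (1 / cmod (1 - herm z w) ^ ?m))"
  proof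
    fix w
    have "cnj (b z) * (f w / ?k w) - (cnj (b w) * f w) / ?k w = cnj (b z - b w) * f w * (1 / ?k w)"
      by (simp add: left_diff_distrib diff_divide_distrib)
    then show "norm (cnj (b z) * (f w / ?k w) - (cnj (b w) * f w) / ?k w)
      = norm (b z - b w) * norm (f w) * (1 / cmod (1 - herm z w) ^ ?m)"
      by (simp only: norm_mult norm_divide norm_power norm_one complex_mod_cnj)
  qed
  finally show ?thesis .
qed

section \<open>From the commutator to the tree operators\<close>

context bergman_dyadic
begin

abbreviation "gen l \<equiv> kube_generation \<theta> (\<Q> l)"
abbreviation "tree l \<equiv> tents_of_generation \<theta> (\<Q> l) (cen l)"

lemma tree_0:
  assumes l: "l < N"
  shows "tree l 0 = {space unit_ball_measure}"
proof -
  have "kubes \<theta> (\<Q> l) 0 = {{z \<in> ball 0 1. bergman_dist z 0 < \<theta>}}" by (simp add: kubes_def)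
  then obtain S where S: "tree l 0 = {S}" by (auto simp: tents_of_generation_def)
  then have "S = ball 0 1" using tents_of_generation_cover[OF l, of 0] by auto
  then show ?thesis using S by simp
qed

lemma oscillation_on_tents:
  assumes tree: "sparse_tree unit_ball_measure (gen l) (tree l) a D" and l: "l < N"
    and b: "locally_integrable_ball b" and p: "1 \<le> p"
    and osc: "\<And>S. S \<in> all_tents \<theta> N \<Q> cen \<Longrightarrow>
      (\<integral>\<^sup>+w\<in>S. ennreal (exp (norm (b w - mean_on S b) powr p)) \<partial>lebesgue) \<le> 2 * emeasure lebesgue S"
  shows "oscillation_on_tree unit_ball_measure (gen l) (tree l) a D b (\<lambda>S. mean_on S b) p 2"
proof -
  interpret sparse_tree unit_ball_measure "gen l" "tree l" a D by (fact tree)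
  show ?thesis
  proof
    show "b \<in> borel_measurable unit_ball_measure" using b by (rule locally_integrable_ball_measurable)
    show "1 \<le> p" "0 \<le> (2::real)" using p by auto
    fix S k assume S: "S \<in> tree l k"
    have sub: "S \<subseteq> ball 0 1" using T_in_space[OF S] by auto
    have "S \<in> all_tents \<theta> N \<Q> cen" using S l by (auto simp: all_tents_def tents_eq_Union)
    note osc[OF this]
    moreover have "(\<integral>\<^sup>+x. ennreal (exp (norm (b x - mean_on S b) powr p)) * indicator S x \<partial>unit_ball_measure)
        = (\<integral>\<^sup>+w\<in>S. ennreal (exp (norm (b w - mean_on S b) powr p)) \<partial>lebesgue)"
      unfolding nn_integral_unit_ball using sub by (intro nn_integral_cong) (auto simp: indicator_def)
    moreover have "emeasure unit_ball_measure S = emeasure lebesgue S"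
      using sub by (intro emeasure_restrict_space) auto
    ultimately show "(\<integral>\<^sup>+x. ennreal (exp (norm (b x - mean_on S b) powr p)) * indicator S x \<partial>unit_ball_measure)
        \<le> ennreal 2 * emeasure unit_ball_measure S" by simp
  qed
qed

text \<open>A single tent through both points suffices; passing to the sum over all tents and
  systems removes the dependence of the bound on the choice of that tent.\<close>

lemma bergman_kernel_le_tents:
  assumes tree: "\<And>l. l < N \<Longrightarrow> sparse_tree unit_ball_measure (gen l) (tree l) a D"
  obtains C where "0 < C"
    "\<And>z w. norm z < 1 \<Longrightarrow> norm w < 1 \<Longrightarrow> ennreal (1 / cmod (1 - herm z w) ^ (CARD('n) + 1)) \<le>
      ennreal C * (\<Sum>l<N. \<Sum>k. \<Sum>S\<in>tree l k. indicator S z * (indicator S w / emeasure unit_ball_measure S))"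
proof -
  obtain C where C: "0 < C"
    "\<And>z w :: complex^'n. norm z < 1 \<Longrightarrow> norm w < 1 \<Longrightarrow> \<exists>l<N. \<exists>S\<in>tents \<theta> (\<Q> l) (cen l).
      z \<in> S \<and> w \<in> S \<and> measure lebesgue S \<le> C * cmod (1 - herm z w) ^ (CARD('n) + 1)"
    using tent_through_points by blast
  show thesis
  proof (rule that[OF C(1)])
    fix z w :: "complex^'n" assume zw: "norm z < 1" "norm w < 1"
    let ?D = "cmod (1 - herm z w) ^ (CARD('n) + 1)"
    let ?t = "\<lambda>S. indicator S z * (indicator S w / emeasure unit_ball_measure S) :: ennreal"
    obtain l S where lS: "l < N" "S \<in> tents \<theta> (\<Q> l) (cen l)" "z \<in> S" "w \<in> S" "measure lebesgue S \<le> C * ?D"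
      using C(2)[OF zw] by blast
    then obtain k where k: "S \<in> tree l k" by (auto simp: tents_eq_Union)
    interpret sparse_tree unit_ball_measure "gen l" "tree l" a D using tree lS(1) .
    have sub: "S \<subseteq> ball 0 1" using T_in_space[OF k] by auto
    then have m: "measure unit_ball_measure S = measure lebesgue S"
      by (intro measure_restrict_space) auto
    have pos: "0 < measure lebesgue S" using measure_T_pos[OF k] m by simp
    have "0 < cmod (1 - herm z w)" using one_minus_herm_ge[OF zw(2), of z] zw(1) by linarith
    then have D: "0 < ?D" by (rule zero_less_power)
    have "1 / ?D \<le> C * (1 / measure lebesgue S)"
      using lS(5) pos D by (simp add: field_simps)
    then have "ennreal (1 / ?D) \<le> ennreal (C * (1 / measure lebesgue S))" by (rule ennreal_leI)
    also have "\<dots> = ennreal C * ?t S"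
    proof -
      have "?t S = 1 / ennreal (measure lebesgue S)" using lS(3,4) by (simp add: emeasure_eq_measure m)
      also have "\<dots> = ennreal (1 / measure lebesgue S)" using pos divide_ennreal[of 1 "measure lebesgue S"] by simp
      finally show ?thesis using C(1) pos by (simp only: ennreal_mult' [of C] less_imp_le)
    qed
    also have "?t S \<le> (\<Sum>S\<in>tree l k. ?t S)"
      using k finite_T by (intro member_le_sum) auto
    also have "\<dots> \<le> (\<Sum>k. \<Sum>S\<in>tree l k. ?t S)"
      using sum_le_suminf[of "\<lambda>k. \<Sum>S\<in>tree l k. ?t S" "{k}"] by simp
    also have "\<dots> \<le> (\<Sum>l<N. \<Sum>k. \<Sum>S\<in>tree l k. ?t S)"
      using lS(1) by (intro member_le_sum[of l]) auto
    finally show "ennreal (1 / ?D) \<le> ennreal C * (\<Sum>l<N. \<Sum>k. \<Sum>S\<in>tree l k. ?t S)"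
      by (simp add: mult_left_mono)
  qed
qed

text \<open>Once the kernel is replaced by the sum over tents, all terms are nonnegative and
  integral and sums may be exchanged.\<close>

lemma commutator_le_osc_op:
  assumes osc: "\<And>l. l < N \<Longrightarrow>
      oscillation_on_tree unit_ball_measure (gen l) (tree l) a D b (\<lambda>S. mean_on S b) p B"
    and kernel: "\<And>z w. norm z < 1 \<Longrightarrow> norm w < 1 \<Longrightarrow> ennreal (1 / cmod (1 - herm z w) ^ (CARD('n) + 1)) \<le>
      ennreal C * (\<Sum>l<N. \<Sum>k. \<Sum>S\<in>tree l k. indicator S z * (indicator S w / emeasure unit_ball_measure S))"
    and C: "0 \<le> C" and b: "locally_integrable_ball b" and f: "bounded_compact_support f" and z: "norm z < 1"
  shows "ennreal (norm (bergman_commutator (\<lambda>w. cnj (b w)) f z)) \<le>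
    ennreal (fact CARD('n) / pi ^ CARD('n) * C) *
      (\<Sum>l<N. oscillation_on_tree.osc_op unit_ball_measure (tree l) b (\<lambda>w. norm (f w)) z)"
proof -
  let ?M = "unit_ball_measure :: (complex^'n) measure"
  have [measurable]: "f \<in> borel_measurable ?M" using f by (simp add: bounded_compact_support_def)
  have [measurable]: "b \<in> borel_measurable ?M" using b by (rule locally_integrable_ball_measurable)
  let ?h = "\<lambda>w. ennreal (norm (b z - b w) * norm (f w))"
  have S: "S \<in> sets ?M" if "l < N" "S \<in> tree l k" for l k S
  proof -
    interpret oscillation_on_tree ?M "gen l" "tree l" a D b "\<lambda>S. mean_on S b" p B using osc that(1) .
    show ?thesis using sets_T that(2) .
  qed
  have m1: "(\<lambda>w. indicator S z * (?h w * indicator S w / emeasure ?M S)) \<in> borel_measurable ?M"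
    if "l < N" "S \<in> tree l k" for l k S
    using S[OF that] by measurable
  have "(\<integral>\<^sup>+w. ennreal (norm (b z - b w) * norm (f w) * (1 / cmod (1 - herm z w) ^ (CARD('n) + 1))) \<partial>?M)
      \<le> (\<integral>\<^sup>+w. ennreal C * (\<Sum>l<N. \<Sum>k. \<Sum>S\<in>tree l k. indicator S z * (?h w * indicator S w / emeasure ?M S)) \<partial>?M)"
  proof (intro nn_integral_mono)
    fix w :: "complex^'n" assume "w \<in> space ?M"
    then have w: "norm w < 1" by simp
    have "ennreal (norm (b z - b w) * norm (f w) * (1 / cmod (1 - herm z w) ^ (CARD('n) + 1)))
        = ?h w * ennreal (1 / cmod (1 - herm z w) ^ (CARD('n) + 1))"
      by (intro ennreal_mult) auto
    also have "\<dots> \<le> ?h w * (ennreal C * (\<Sum>l<N. \<Sum>k. \<Sum>S\<in>tree l k. indicator S z * (indicator S w / emeasure ?M S)))"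
      by (intro mult_left_mono kernel z w) auto
    also have "\<dots> = ennreal C * (\<Sum>l<N. \<Sum>k. \<Sum>S\<in>tree l k. ?h w * (indicator S z * (indicator S w / emeasure ?M S)))"
      by (simp only: mult.left_commute[of "?h w" "ennreal C"] sum_distrib_left[symmetric] ennreal_suminf_cmult)
    also have "\<dots> = ennreal C * (\<Sum>l<N. \<Sum>k. \<Sum>S\<in>tree l k. indicator S z * (?h w * indicator S w / emeasure ?M S))"
      by (simp add: mult.left_commute ennreal_times_divide)
    finally show "ennreal (norm (b z - b w) * norm (f w) * (1 / cmod (1 - herm z w) ^ (CARD('n) + 1)))
        \<le> ennreal C * (\<Sum>l<N. \<Sum>k. \<Sum>S\<in>tree l k. indicator S z * (?h w * indicator S w / emeasure ?M S))" .
  qed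
  also have "\<dots> = ennreal C * (\<Sum>l<N. \<integral>\<^sup>+w. (\<Sum>k. \<Sum>S\<in>tree l k. indicator S z * (?h w * indicator S w / emeasure ?M S)) \<partial>?M)"
    using m1 by (subst nn_integral_cmult, (intro borel_measurable_sum borel_measurable_suminf_order; simp)[1],
        subst nn_integral_sum) (auto intro!: borel_measurable_suminf_order borel_measurable_sum)
  also have "(\<Sum>l<N. \<integral>\<^sup>+w. (\<Sum>k. \<Sum>S\<in>tree l k. indicator S z * (?h w * indicator S w / emeasure ?M S)) \<partial>?M)
      = (\<Sum>l<N. oscillation_on_tree.osc_op ?M (tree l) b (\<lambda>w. norm (f w)) z)"
  proof (intro sum.cong refl)
    fix l assume "l \<in> {..<N}"
    then have l: "l < N" by simp
    interpret oscillation_on_tree ?M "gen l" "tree l" a D b "\<lambda>S. mean_on S b" p B using osc l .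
    have "(\<integral>\<^sup>+w. (\<Sum>k. \<Sum>S\<in>tree l k. indicator S z * (?h w * indicator S w / emeasure ?M S)) \<partial>?M)
        = (\<Sum>k. \<integral>\<^sup>+w. (\<Sum>S\<in>tree l k. indicator S z * (?h w * indicator S w / emeasure ?M S)) \<partial>?M)"
      using m1[OF l] by (intro nn_integral_suminf borel_measurable_sum) auto
    also have "\<dots> = (\<Sum>k. \<Sum>S\<in>tree l k. \<integral>\<^sup>+w. indicator S z * (?h w * indicator S w / emeasure ?M S) \<partial>?M)"
      using m1[OF l] by (intro suminf_cong nn_integral_sum) auto
    also have "\<dots> = osc_op (\<lambda>w. norm (f w)) z"
      unfolding osc_op_def
    proof (intro suminf_cong sum.cong refl)
      fix k S assume "S \<in> tree l k"
      then have [measurable]: "S \<in> sets ?M" using sets_T by blast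
      show "(\<integral>\<^sup>+w. indicator S z * (?h w * indicator S w / emeasure ?M S) \<partial>?M)
        = indicator S z * ((\<integral>\<^sup>+w. ?h w * indicator S w \<partial>?M) / emeasure ?M S)"
        by (subst nn_integral_cmult, measurable) (subst nn_integral_divide, auto)
    qed
    finally show "(\<integral>\<^sup>+w. (\<Sum>k. \<Sum>S\<in>tree l k. indicator S z * (?h w * indicator S w / emeasure ?M S)) \<partial>?M)
      = osc_op (\<lambda>w. norm (f w)) z" .
  qed
  finally have *: "(\<integral>\<^sup>+w. ennreal (norm (b z - b w) * norm (f w) * (1 / cmod (1 - herm z w) ^ (CARD('n) + 1))) \<partial>?M)
      \<le> ennreal C * (\<Sum>l<N. oscillation_on_tree.osc_op ?M (tree l) b (\<lambda>w. norm (f w)) z)" .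
  have "ennreal (norm (bergman_commutator (\<lambda>w. cnj (b w)) f z)) \<le> ennreal (fact CARD('n) / pi ^ CARD('n)) *
    (\<integral>\<^sup>+w. ennreal (norm (b z - b w) * norm (f w) * (1 / cmod (1 - herm z w) ^ (CARD('n) + 1))) \<partial>?M)"
    by (rule commutator_le[OF b f z])
  also have "\<dots> \<le> ennreal (fact CARD('n) / pi ^ CARD('n)) * (ennreal C * (\<Sum>l<N. oscillation_on_tree.osc_op ?M (tree l) b (\<lambda>w. norm (f w)) z))"
    by (intro mult_left_mono *) simp
  also have "\<dots> = ennreal (fact CARD('n) / pi ^ CARD('n) * C) * (\<Sum>l<N. oscillation_on_tree.osc_op ?M (tree l) b (\<lambda>w. norm (f w)) z)"
    using C by (simp only: ennreal_mult''[of C] mult.assoc)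
  finally show ?thesis .
qed

text \<open>Pigeonhole over the \<open>N\<close> systems: if every rescaled operator were at most 1
  at \<open>z\<close>, each unscaled one would be at most \<open>s / (N * c)\<close>, and their sum
  could not push the commutator above \<open>s\<close>.\<close>

lemma commutator_superlevel_subset:
  assumes osc: "\<And>l. l < N \<Longrightarrow>
      oscillation_on_tree unit_ball_measure (gen l) (tree l) a D b (\<lambda>S. mean_on S b) p B"
    and le: "ennreal (norm (bergman_commutator (\<lambda>w. cnj (b w)) f z)) \<le> ennreal c *
      (\<Sum>l<N. oscillation_on_tree.osc_op unit_ball_measure (tree l) b (\<lambda>w. norm (f w)) z)"
    and c: "0 < c" "0 < N" and s: "0 < s" and f: "bounded_compact_support f" and z: "norm z < 1"
    and big: "s < norm (bergman_commutator (\<lambda>w. cnj (b w)) f z)"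
  shows "\<exists>l<N. 1 < oscillation_on_tree.osc_op unit_ball_measure (tree l) b (\<lambda>w. real N * c * (norm (f w) / s)) z"
proof (rule ccontr)
  let ?O = "\<lambda>l. oscillation_on_tree.osc_op unit_ball_measure (tree l) b"
  let ?\<kappa> = "real N * c / s"
  have \<kappa>: "0 < ?\<kappa>" using c s by simp
  assume *: "\<not> ?thesis"
  have small: "?O l (\<lambda>w. real N * c * (norm (f w) / s)) z \<le> 1" if "l < N" for l
    using * that not_less by blast
  have "?O l (\<lambda>w. norm (f w)) z \<le> ennreal (1 / ?\<kappa>)" if l: "l < N" for l
  proof -
    interpret oscillation_on_tree unit_ball_measure "gen l" "tree l" a D b "\<lambda>S. mean_on S b" p B using osc l .
    have [measurable]: "f \<in> borel_measurable unit_ball_measure" using f by (simp add: bounded_compact_support_def)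
    have "osc_op (\<lambda>w. ?\<kappa> * norm (f w)) z = ennreal ?\<kappa> * osc_op (\<lambda>w. norm (f w)) z"
      using \<kappa> z by (intro osc_op_cmult) auto
    then have le1: "ennreal ?\<kappa> * osc_op (\<lambda>w. norm (f w)) z \<le> 1"
      using small[OF l] by (simp add: mult_ac)
    have "1 / ?\<kappa> * ?\<kappa> = 1" using \<kappa> by (metis less_irrefl nonzero_eq_divide_eq)
    then have "osc_op (\<lambda>w. norm (f w)) z = ennreal (1 / ?\<kappa> * ?\<kappa>) * osc_op (\<lambda>w. norm (f w)) z"
      by (simp only: ennreal_1 mult_1)
    also have "\<dots> = ennreal (1 / ?\<kappa>) * (ennreal ?\<kappa> * osc_op (\<lambda>w. norm (f w)) z)"
      using c s by (subst ennreal_mult) (auto simp: mult.assoc)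
    also have "\<dots> \<le> ennreal (1 / ?\<kappa>) * 1" by (intro mult_left_mono le1) simp
    finally show ?thesis by simp
  qed
  then have "(\<Sum>l<N. ?O l (\<lambda>w. norm (f w)) z) \<le> (\<Sum>l<N. ennreal (1 / ?\<kappa>))" by (intro sum_mono) auto
  also have "\<dots> = ennreal (\<Sum>l<N. 1 / ?\<kappa>)" using c s by (intro sum_ennreal) auto
  also have "(\<Sum>l<N. 1 / ?\<kappa>) = s / c" using c by simp
  finally have "ennreal c * (\<Sum>l<N. ?O l (\<lambda>w. norm (f w)) z) \<le> ennreal c * ennreal (s / c)"
    by (intro mult_left_mono) auto
  also have "\<dots> = ennreal s" using c s by (simp add: ennreal_mult[symmetric])
  finally have "ennreal (norm (bergman_commutator (\<lambda>w. cnj (b w)) f z)) \<le> ennreal s" using le by (rule order_trans[rotated])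
  then show False using big s by (simp add: ennreal_le_iff)
qed

text \<open>Applied at the origin, \<open>carleson_in_tent\<close> provides an index below
  \<open>N\<close>.\<close>

lemma N_pos: "0 < N"
  using carleson_in_tent by (metis centre_in_ball gr0I not_less_zero zero_less_one)

proposition commutator_weak_type_normalised:
  assumes \<epsilon>: "0 < \<epsilon>" "\<epsilon> \<le> 1"
  obtains C where "0 < C"
    "\<And>b f s. locally_integrable_ball b \<Longrightarrow>
      (\<And>S. S \<in> all_tents \<theta> N \<Q> cen \<Longrightarrow>
        (\<integral>\<^sup>+w\<in>S. ennreal (exp (norm (b w - mean_on S b) powr (1 / \<epsilon>))) \<partial>lebesgue) \<le> 2 * emeasure lebesgue S) \<Longrightarrow>
      bounded_compact_support f \<Longrightarrow> 0 < s \<Longrightarrow>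
      emeasure lebesgue {z \<in> ball 0 1. s < norm (bergman_commutator (\<lambda>w. cnj (b w)) f z)} \<le>
        ennreal C * (\<integral>\<^sup>+z\<in>ball 0 1. ennreal (llog \<epsilon> (norm (f z) / s)) \<partial>lebesgue)"
proof -
  let ?M = "unit_ball_measure :: (complex^'n) measure"
  obtain a D where tree: "\<And>l. l < N \<Longrightarrow> sparse_tree ?M (gen l) (tree l) a D"
    using sparse_tree_tents by blast
  obtain C0 where C0: "0 < C0"
    "\<And>z w :: complex^'n. norm z < 1 \<Longrightarrow> norm w < 1 \<Longrightarrow> ennreal (1 / cmod (1 - herm z w) ^ (CARD('n) + 1)) \<le>
      ennreal C0 * (\<Sum>l<N. \<Sum>k. \<Sum>S\<in>tree l k. indicator S z * (indicator S w / emeasure ?M S))"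
    using bergman_kernel_le_tents[OF tree] by blast
  define c where "c = fact CARD('n) / pi ^ CARD('n) * C0"
  have c: "0 < c" using C0(1) by (simp add: c_def)
  \<comment> \<open>The maximum with 1 makes \<open>llog_mult_le\<close> applicable.\<close>
  define \<kappa> where "\<kappa> = max 1 (real N * c)"
  \<comment> \<open>One number for all systems and all \<open>b\<close>, since the constant involves
    only \<open>a\<close>, \<open>D\<close> and the bound 2. Later \<open>\<bar>K\<bar> + 1\<close>
    provides a positive constant without inspecting it.\<close>
  define K where "K = oscillation_on_tree.weak_const a D 2"
  have p: "1 \<le> 1 / \<epsilon>" using \<epsilon> by simp
  show thesis
  proof (rule that)
    show "0 < real N * (\<bar>K\<bar> + 1) * \<kappa>\<^sup>2"
      using N_pos by (intro mult_pos_pos) (auto simp: \<kappa>_def)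
    fix b :: "complex^'n \<Rightarrow> complex" and f :: "complex^'n \<Rightarrow> complex" and s :: real
    assume b: "locally_integrable_ball b" and f: "bounded_compact_support f" and s: "0 < s"
      and osc: "\<And>S. S \<in> all_tents \<theta> N \<Q> cen \<Longrightarrow>
        (\<integral>\<^sup>+w\<in>S. ennreal (exp (norm (b w - mean_on S b) powr (1 / \<epsilon>))) \<partial>lebesgue) \<le> 2 * emeasure lebesgue S"
    have fm [measurable]: "f \<in> borel_measurable ?M" using f by (simp add: bounded_compact_support_def)
    note ot = oscillation_on_tents[OF tree _ b p osc]
    let ?F = "\<lambda>w. real N * c * (norm (f w) / s)"
    let ?O = "\<lambda>l. oscillation_on_tree.osc_op ?M (tree l) b"
    let ?I = "\<integral>\<^sup>+z. ennreal (llog \<epsilon> (norm (f z) / s)) \<partial>?M"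
    let ?E = "{z \<in> ball 0 1. s < norm (bergman_commutator (\<lambda>w. cnj (b w)) f z)}"
    have Om: "{z \<in> space ?M. 1 < ?O l ?F z} \<in> sets ?M" if l: "l < N" for l
    proof -
      interpret oscillation_on_tree ?M "gen l" "tree l" a D b "\<lambda>S. mean_on S b" "1 / \<epsilon>" 2 using ot l by blast
      show ?thesis by measurable
    qed
    have sub: "?E \<subseteq> (\<Union>l<N. {z \<in> space ?M. 1 < ?O l ?F z})"
    proof
      fix z assume z: "z \<in> ?E"
      have "ennreal (norm (bergman_commutator (\<lambda>w. cnj (b w)) f z)) \<le> ennreal c * (\<Sum>l<N. ?O l (\<lambda>w. norm (f w)) z)"
        unfolding c_def using z C0(1) b f by (intro commutator_le_osc_op[OF ot C0(2)]) auto
      then have "\<exists>l<N. 1 < ?O l ?F z"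
        using z by (intro commutator_superlevel_subset[OF ot _ c N_pos s f]) auto
      then show "z \<in> (\<Union>l<N. {z \<in> space ?M. 1 < ?O l ?F z})" using z by auto
    qed
    have weak: "emeasure ?M {z \<in> space ?M. 1 < ?O l ?F z} \<le> ennreal ((\<bar>K\<bar> + 1) * \<kappa>\<^sup>2) * ?I" if l: "l < N" for l
    proof -
      interpret oscillation_on_tree ?M "gen l" "tree l" a D b "\<lambda>S. mean_on S b" "1 / \<epsilon>" 2 using ot l by blast
      have "emeasure ?M {z \<in> space ?M. 1 < osc_op ?F z} \<le> ennreal weak_const * (\<integral>\<^sup>+x. ennreal (llog \<epsilon> (?F x)) \<partial>?M)"
        using tree_0[OF l] c s \<epsilon> by (intro osc_op_weak_type) auto
      also have "\<dots> \<le> ennreal (\<bar>K\<bar> + 1) * (\<integral>\<^sup>+x. ennreal (\<kappa>\<^sup>2) * ennreal (llog \<epsilon> (norm (f x) / s)) \<partial>?M)"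
      proof (intro mult_mono nn_integral_mono ennreal_leI)
        show "weak_const \<le> \<bar>K\<bar> + 1" by (simp add: K_def)
        fix x
        let ?u = "norm (f x) / s"
        have u: "0 \<le> ?u" using s by simp
        have mono: "llog \<epsilon> (?F x) \<le> llog \<epsilon> (\<kappa> * ?u)"
        proof -
          have Fle: "?F x \<le> \<kappa> * ?u" using u by (intro mult_right_mono) (auto simp: \<kappa>_def)
          moreover have "0 \<le> ?F x" using u c by (intro mult_nonneg_nonneg) auto
          ultimately show ?thesis using \<epsilon> by (intro llog_mono) auto
        qed
        also have "\<dots> \<le> \<kappa>\<^sup>2 * llog \<epsilon> ?u" using u \<epsilon> by (intro llog_mult_le) (auto simp: \<kappa>_def)
        finally have "ennreal (llog \<epsilon> (?F x)) \<le> ennreal (\<kappa>\<^sup>2 * llog \<epsilon> ?u)" by (rule ennreal_leI)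
        then show "ennreal (llog \<epsilon> (?F x)) \<le> ennreal (\<kappa>\<^sup>2) * ennreal (llog \<epsilon> ?u)"
          using u llog_nonneg by (simp add: ennreal_mult)
      qed auto
      also have "\<dots> = ennreal (\<bar>K\<bar> + 1) * (ennreal (\<kappa>\<^sup>2) * ?I)"
        by (subst nn_integral_cmult) auto
      also have "\<dots> = ennreal ((\<bar>K\<bar> + 1) * \<kappa>\<^sup>2) * ?I"
        by (subst ennreal_mult) (auto simp: mult.assoc)
      finally show ?thesis .
    qed
    \<comment> \<open>Measurability of the superlevel set is not established;
      \<open>emeasure_mono\<close> asks for it only on the covering set.\<close>
    have "emeasure lebesgue ?E = emeasure ?M ?E" by (rule emeasure_restrict_space[symmetric]) auto
    also have "\<dots> \<le> emeasure ?M (\<Union>l<N. {z \<in> space ?M. 1 < ?O l ?F z})"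
      using Om by (intro emeasure_mono sub) auto
    also have "\<dots> \<le> (\<Sum>l<N. emeasure ?M {z \<in> space ?M. 1 < ?O l ?F z})"
      using Om by (intro emeasure_subadditive_finite) auto
    also have "\<dots> \<le> (\<Sum>l<N. ennreal ((\<bar>K\<bar> + 1) * \<kappa>\<^sup>2) * ?I)" using weak by (intro sum_mono) auto
    also have "\<dots> = ennreal (real N) * (ennreal ((\<bar>K\<bar> + 1) * \<kappa>\<^sup>2) * ?I)" by (simp add: ennreal_of_nat_eq_real_of_nat)
    also have "\<dots> = ennreal (real N * (\<bar>K\<bar> + 1) * \<kappa>\<^sup>2) * ?I"
      by (simp add: ennreal_mult mult.assoc del: ennreal_plus)
    finally show "emeasure lebesgue ?E \<le> ennreal (real N * (\<bar>K\<bar> + 1) * \<kappa>\<^sup>2) * (\<integral>\<^sup>+z\<in>ball 0 1. ennreal (llog \<epsilon> (norm (f z) / s)) \<partial>lebesgue)"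
      by (simp only: nn_integral_unit_ball)
  qed
qed

end

section \<open>The oscillation norm\<close>

text \<open>The set whose infimum is the norm; the estimates are proved for each of its elements
  before the infimum is considered.\<close>

definition osc_admissible ::
    "real \<Rightarrow> (complex^'n::finite) set set \<Rightarrow> (complex^'n \<Rightarrow> complex) \<Rightarrow> real set" where
  "osc_admissible r \<T> b = {c. 0 < c \<and>
    (SUP S\<in>\<T>.
        (\<integral>\<^sup>+w\<in>S. ennreal (exp ((norm (b w - mean_on S b) / c) powr r) - 1) \<partial>lebesgue)
          / emeasure lebesgue S) \<le> 1}"

lemma osc_exp_norm_eq: "osc_exp_norm r \<T> b = Inf (osc_admissible r \<T> b)"
  by (simp add: osc_exp_norm_def osc_admissible_def)

lemma osc_admissible_mono:
  assumes "c \<in> osc_admissible r \<T> b" "c \<le> c'" "0 < r"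
  shows "c' \<in> osc_admissible r \<T> b"
proof -
  have c: "0 < c" using assms by (simp add: osc_admissible_def)
  have "exp ((norm (b w - mean_on S b) / c') powr r) - 1 \<le> exp ((norm (b w - mean_on S b) / c) powr r) - 1" for w S
    using c assms by (simp add: powr_mono2 divide_left_mono)
  then have "(SUP S\<in>\<T>. (\<integral>\<^sup>+w\<in>S. ennreal (exp ((norm (b w - mean_on S b) / c') powr r) - 1) \<partial>lebesgue) / emeasure lebesgue S)
    \<le> (SUP S\<in>\<T>. (\<integral>\<^sup>+w\<in>S. ennreal (exp ((norm (b w - mean_on S b) / c) powr r) - 1) \<partial>lebesgue) / emeasure lebesgue S)"
    by (intro SUP_mono' divide_right_mono_ennreal nn_integral_mono mult_right_mono ennreal_leI) auto
  also have "\<dots> \<le> 1" using assms by (simp add: osc_admissible_def)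
  finally show ?thesis using c assms by (simp add: osc_admissible_def)
qed

text \<open>Convexity of \<open>exp\<close> between 0 and \<open>y\<close>. Dividing the exponent by
  \<open>t\<close> thus divides the excess over 1 by at least \<open>t\<close>, which brings a
  finite supremum below 1.\<close>

lemma exp_div_minus_one_le:
  assumes "1 \<le> (t::real)"
  shows "exp (y / t) - 1 \<le> (exp y - 1) / t"
proof -
  have "exp ((1 - 1 / t) *\<^sub>R 0 + (1 / t) *\<^sub>R y) \<le> (1 - 1 / t) * exp 0 + (1 / t) * exp y"
    using assms by (intro convex_onD[OF exp_convex]) auto
  then show ?thesis using assms by (simp add: field_simps)
qed

lemma set_nn_integral_unit_ball:
  "S \<subseteq> ball 0 1 \<Longrightarrow> (\<integral>\<^sup>+w\<in>S. h w \<partial>lebesgue) = (\<integral>\<^sup>+w\<in>S. h w \<partial>unit_ball_measure)"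
  unfolding nn_integral_unit_ball by (intro nn_integral_cong) (auto simp: indicator_def)

lemma set_nn_integral_exp_minus_one:
  fixes b :: "complex^'n::finite \<Rightarrow> complex"
  assumes b: "b \<in> borel_measurable unit_ball_measure" and S: "S \<in> sets lebesgue" "S \<subseteq> ball 0 1"
  shows "(\<integral>\<^sup>+w\<in>S. ennreal (exp ((norm (b w - m) / c) powr r)) \<partial>lebesgue)
    = (\<integral>\<^sup>+w\<in>S. ennreal (exp ((norm (b w - m) / c) powr r) - 1) \<partial>lebesgue) + emeasure lebesgue S"
proof -
  have [measurable]: "b \<in> borel_measurable unit_ball_measure" by (fact b)
  have S': "S \<in> sets (unit_ball_measure :: (complex^'n) measure)"
    using S by (subst sets_restrict_space_iff) auto
  then have [measurable]: "S \<in> sets unit_ball_measure" .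
  have "(\<integral>\<^sup>+w\<in>S. ennreal (exp ((norm (b w - m) / c) powr r)) \<partial>unit_ball_measure)
    = (\<integral>\<^sup>+w. ennreal (exp ((norm (b w - m) / c) powr r) - 1) * indicator S w + indicator S w \<partial>unit_ball_measure)"
  proof (intro nn_integral_cong)
    fix w
    have "ennreal (exp y) = ennreal (exp y - 1) + 1" if "0 \<le> y" for y :: real
      using that ennreal_plus[of "exp y - 1" 1] by simp
    then show "ennreal (exp ((norm (b w - m) / c) powr r)) * indicator S w
        = ennreal (exp ((norm (b w - m) / c) powr r) - 1) * indicator S w + indicator S w"
      by (simp add: indicator_def)
  qed
  also have "\<dots> = (\<integral>\<^sup>+w\<in>S. ennreal (exp ((norm (b w - m) / c) powr r) - 1) \<partial>unit_ball_measure) + emeasure unit_ball_measure S"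
    by (subst nn_integral_add) auto
  also have "emeasure unit_ball_measure S = emeasure lebesgue S" using S by (intro emeasure_restrict_space) auto
  finally show ?thesis by (simp only: set_nn_integral_unit_ball[OF S(2)])
qed

context bergman_dyadic
begin

lemma all_tents_measure:
  assumes "S \<in> all_tents \<theta> N \<Q> cen"
  shows "S \<in> sets lebesgue" "S \<subseteq> ball 0 1" "0 < emeasure lebesgue S" "emeasure lebesgue S < \<infinity>"
proof -
  obtain l where l: "l < N" and St: "S \<in> tents \<theta> (\<Q> l) (cen l)" using assms by (auto simp: all_tents_def)
  obtain k where k: "S \<in> tree l k" using St by (auto simp: tents_eq_Union)
  obtain a D where "\<And>l. l < N \<Longrightarrow> sparse_tree unit_ball_measure (gen l) (tree l) a D"
    using sparse_tree_tents by blast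
  then interpret sparse_tree unit_ball_measure "gen l" "tree l" a D using l .
  show sub: "S \<subseteq> ball 0 1" using T_in_space[OF k] by auto
  have "S \<in> sets unit_ball_measure" using sets_T[OF k] .
  then show "S \<in> sets lebesgue" by (subst (asm) sets_restrict_space_iff) auto
  have "emeasure unit_ball_measure S = emeasure lebesgue S" using sub by (intro emeasure_restrict_space) auto
  then show "0 < emeasure lebesgue S" "emeasure lebesgue S < \<infinity>"
    using emeasure_T_pos[OF k] emeasure_finite[of S] by (auto simp: less_top)
qed

text \<open>Origin of the oscillation constant 2: the integral of the exponential minus 1 is at most
  the measure of \<open>S\<close>, and restoring the 1 adds that measure once more.\<close>

lemma osc_admissible_exp_le:
  assumes b: "locally_integrable_ball b" and c: "c \<in> osc_admissible r (all_tents \<theta> N \<Q> cen) b"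
    and S: "S \<in> all_tents \<theta> N \<Q> cen"
  shows "(\<integral>\<^sup>+w\<in>S. ennreal (exp ((norm (b w - mean_on S b) / c) powr r)) \<partial>lebesgue) \<le> 2 * emeasure lebesgue S"
proof -
  let ?I = "\<integral>\<^sup>+w\<in>S. ennreal (exp ((norm (b w - mean_on S b) / c) powr r) - 1) \<partial>lebesgue"
  note m = all_tents_measure[OF S]
  have "?I / emeasure lebesgue S \<le> (SUP S\<in>all_tents \<theta> N \<Q> cen.
        (\<integral>\<^sup>+w\<in>S. ennreal (exp ((norm (b w - mean_on S b) / c) powr r) - 1) \<partial>lebesgue)
          / emeasure lebesgue S)"
    by (rule SUP_upper[OF S])
  also have "\<dots> \<le> 1" using c by (simp add: osc_admissible_def)
  finally have "?I / emeasure lebesgue S * emeasure lebesgue S \<le> 1 * emeasure lebesgue S"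
    by (intro mult_right_mono) auto
  moreover have "?I / emeasure lebesgue S * emeasure lebesgue S = ?I"
    using m(3,4) by (simp add: ennreal_divide_times ennreal_mult_divide_eq less_top[symmetric] zero_less_iff_neq_zero)
  ultimately have "?I \<le> emeasure lebesgue S" by simp
  then have "?I + emeasure lebesgue S \<le> emeasure lebesgue S + emeasure lebesgue S" by (rule add_right_mono)
  then show ?thesis
    using set_nn_integral_exp_minus_one[OF locally_integrable_ball_measurable[OF b] m(1,2)]
    by (simp add: mult_2)
qed

text \<open>The space asks for a finite supremum at some \<open>c0\<close>, the norm for a supremum
  at most 1. Enlarging \<open>c0\<close> by \<open>t powr (1 / r)\<close>, with \<open>t\<close> at
  least the supremum, divides the exponent by \<open>t\<close>, and
  \<open>exp_div_minus_one_le\<close> does the rest.\<close>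

lemma osc_admissible_nonempty:
  assumes b: "b \<in> osc_exp r (all_tents \<theta> N \<Q> cen)" and r: "0 < r"
  shows "osc_admissible r (all_tents \<theta> N \<Q> cen) b \<noteq> {}"
proof -
  let ?\<T> = "all_tents \<theta> N \<Q> cen"
  obtain c0 where c0: "0 < c0" "(SUP S\<in>?\<T>.
        (\<integral>\<^sup>+w\<in>S. ennreal (exp ((norm (b w - mean_on S b) / c0) powr r)) \<partial>lebesgue)
          / emeasure lebesgue S) < \<infinity>" (is "?sup < _")
    using b by (auto simp: osc_exp_def)
  define t where "t = max 1 (enn2real ?sup)"
  have "?sup = ennreal (enn2real ?sup)" using c0(2) by simp
  also have "\<dots> \<le> ennreal t" by (intro ennreal_leI) (simp add: t_def)
  finally have t: "1 \<le> t" "?sup \<le> ennreal t" by (auto simp: t_def)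
  define c where "c = c0 * t powr (1 / r)"
  have c: "0 < c" using c0 t by (simp add: c_def)
  have "(\<integral>\<^sup>+w\<in>S. ennreal (exp ((norm (b w - mean_on S b) / c) powr r) - 1) \<partial>lebesgue) / emeasure lebesgue S \<le> 1"
    if S: "S \<in> ?\<T>" for S
  proof -
    note m = all_tents_measure[OF S]
    let ?y = "\<lambda>w. (norm (b w - mean_on S b) / c0) powr r"
    let ?I = "\<integral>\<^sup>+w\<in>S. ennreal (exp (?y w)) \<partial>lebesgue"
    have [measurable]: "b \<in> borel_measurable unit_ball_measure"
      using b by (intro locally_integrable_ball_measurable) (simp add: osc_exp_def)
    have "S \<in> sets unit_ball_measure"
      using m(1,2) by (subst sets_restrict_space_iff) auto
    then have [measurable]: "S \<in> sets unit_ball_measure" .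
    have "ennreal (exp ((norm (b w - mean_on S b) / c) powr r) - 1) \<le> ennreal (1 / t) * ennreal (exp (?y w))" for w
    proof -
      have "(norm (b w - mean_on S b) / c) powr r = ?y w / t"
        using c0 t r by (simp add: c_def powr_divide powr_mult powr_powr)
      then have "exp ((norm (b w - mean_on S b) / c) powr r) - 1 \<le> (exp (?y w) - 1) / t"
        using exp_div_minus_one_le[OF t(1), of "?y w"] by simp
      also have "\<dots> \<le> 1 / t * exp (?y w)" using t by (simp add: divide_right_mono)
      finally show ?thesis using t by (subst ennreal_mult'[symmetric]) (auto intro: ennreal_leI)
    qed
    then have "(\<integral>\<^sup>+w\<in>S. ennreal (exp ((norm (b w - mean_on S b) / c) powr r) - 1) \<partial>unit_ball_measure)
        \<le> (\<integral>\<^sup>+w. ennreal (1 / t) * (ennreal (exp (?y w)) * indicator S w) \<partial>unit_ball_measure)"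
      by (intro nn_integral_mono) (auto simp: indicator_def)
    also have "\<dots> = ennreal (1 / t) * (\<integral>\<^sup>+w\<in>S. ennreal (exp (?y w)) \<partial>unit_ball_measure)"
      by (intro nn_integral_cmult) measurable
    finally have "(\<integral>\<^sup>+w\<in>S. ennreal (exp ((norm (b w - mean_on S b) / c) powr r) - 1) \<partial>lebesgue) \<le> ennreal (1 / t) * ?I"
      by (simp only: set_nn_integral_unit_ball[OF m(2)])
    then have "(\<integral>\<^sup>+w\<in>S. ennreal (exp ((norm (b w - mean_on S b) / c) powr r) - 1) \<partial>lebesgue) / emeasure lebesgue S
        \<le> ennreal (1 / t) * ?I / emeasure lebesgue S"
      by (rule divide_right_mono_ennreal)
    also have "\<dots> = ennreal (1 / t) * (?I / emeasure lebesgue S)" by (simp only: ennreal_times_divide)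
    also have "?I / emeasure lebesgue S \<le> ?sup" by (rule SUP_upper[OF S])
    also have "ennreal (1 / t) * ?sup \<le> ennreal (1 / t) * ennreal t" by (intro mult_left_mono t) simp
    also have "\<dots> = 1" using t by (simp add: ennreal_mult[symmetric])
    finally show ?thesis by (simp add: mult_left_mono)
  qed
  then have "c \<in> osc_admissible r ?\<T> b" using c by (auto simp: osc_admissible_def intro!: SUP_least)
  then show ?thesis by blast
qed

lemma commutator_scale:
  fixes z :: "complex^'n"
  shows "bergman_commutator (\<lambda>w. cnj (b w / of_real c)) f z = bergman_commutator (\<lambda>w. cnj (b w)) f z / of_real c"
proof -
  have "bergman_proj (\<lambda>w. cnj (b w / of_real c) * f w) z = bergman_proj (\<lambda>w. cnj (b w) * f w) z / of_real c"
  proof -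
    have "(\<lambda>w. cnj (b w / of_real c) * f w / (1 - herm z w) ^ (CARD('n) + 1))
      = (\<lambda>w. cnj (b w) * f w / (1 - herm z w) ^ (CARD('n) + 1) / of_real c)"
      by (auto simp: fun_eq_iff)
    then show ?thesis
      unfolding bergman_proj_def by (simp only: set_integral_divide_zero times_divide_eq_right)
  qed
  then show ?thesis by (simp add: bergman_commutator_def diff_divide_distrib)
qed

lemma mean_on_scale: "mean_on S (\<lambda>w. b w / of_real c) = mean_on S b / of_real c"
  unfolding mean_on_def by (simp add: scaleR_conv_of_real)

text \<open>The normalised estimate is applied to \<open>b / c\<close> at level
  \<open>s / c\<close>. It is stated for admissible \<open>c\<close>, which are positive, whereas
  the norm is an infimum that may be 0 and then cannot be divided by.\<close>

proposition commutator_weak_type: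
  assumes \<epsilon>: "0 < \<epsilon>" "\<epsilon> \<le> 1"
  obtains C where "0 < C"
    "\<And>b c f s. locally_integrable_ball b \<Longrightarrow> c \<in> osc_admissible (1 / \<epsilon>) (all_tents \<theta> N \<Q> cen) b \<Longrightarrow>
      bounded_compact_support f \<Longrightarrow> 0 < s \<Longrightarrow>
      emeasure lebesgue {z \<in> ball 0 1. s < norm (bergman_commutator (\<lambda>w. cnj (b w)) f z)} \<le>
        ennreal C * (\<integral>\<^sup>+z\<in>ball 0 1. ennreal (llog \<epsilon> (c * (norm (f z) / s))) \<partial>lebesgue)"
proof -
  obtain C where C: "0 < C"
    "\<And>b f s. locally_integrable_ball b \<Longrightarrow>
      (\<And>S. S \<in> all_tents \<theta> N \<Q> cen \<Longrightarrow>
        (\<integral>\<^sup>+w\<in>S. ennreal (exp (norm (b w - mean_on S b) powr (1 / \<epsilon>))) \<partial>lebesgue) \<le> 2 * emeasure lebesgue S) \<Longrightarrow>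
      bounded_compact_support f \<Longrightarrow> 0 < s \<Longrightarrow>
      emeasure lebesgue {z \<in> ball 0 1. s < norm (bergman_commutator (\<lambda>w. cnj (b w)) f z)} \<le>
        ennreal C * (\<integral>\<^sup>+z\<in>ball 0 1. ennreal (llog \<epsilon> (norm (f z) / s)) \<partial>lebesgue)"
    using commutator_weak_type_normalised[OF \<epsilon>] by blast
  show thesis
  proof (rule that[OF C(1)])
    fix b :: "complex^'n \<Rightarrow> complex" and f :: "complex^'n \<Rightarrow> complex" and c s :: real
    assume b: "locally_integrable_ball b" and c: "c \<in> osc_admissible (1 / \<epsilon>) (all_tents \<theta> N \<Q> cen) b"
      and f: "bounded_compact_support f" and s: "0 < s"
    have c0: "0 < c" using c by (simp add: osc_admissible_def)
    let ?b = "\<lambda>w. b w / of_real c"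
    have "locally_integrable_ball ?b"
      using b by (auto simp: locally_integrable_ball_def intro: set_integrable_divide)
    moreover have "(\<integral>\<^sup>+w\<in>S. ennreal (exp (norm (?b w - mean_on S ?b) powr (1 / \<epsilon>))) \<partial>lebesgue) \<le> 2 * emeasure lebesgue S"
      if S: "S \<in> all_tents \<theta> N \<Q> cen" for S
    proof -
      have "norm (?b w - mean_on S ?b) = norm (b w - mean_on S b) / c" for w
        using c0 by (simp add: mean_on_scale norm_divide flip: diff_divide_distrib)
      then show ?thesis using osc_admissible_exp_le[OF b c S] by simp
    qed
    ultimately have "emeasure lebesgue {z \<in> ball 0 1. s / c < norm (bergman_commutator (\<lambda>w. cnj (?b w)) f z)} \<le>
        ennreal C * (\<integral>\<^sup>+z\<in>ball 0 1. ennreal (llog \<epsilon> (norm (f z) / (s / c))) \<partial>lebesgue)"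
      using f s c0 by (intro C(2)) auto
    moreover have "{z \<in> ball 0 1. s / c < norm (bergman_commutator (\<lambda>w. cnj (?b w)) f z)}
        = {z \<in> ball 0 1. s < norm (bergman_commutator (\<lambda>w. cnj (b w)) f z)}"
      unfolding commutator_scale using c0 by (simp add: norm_divide divide_less_cancel)
    ultimately show "emeasure lebesgue {z \<in> ball 0 1. s < norm (bergman_commutator (\<lambda>w. cnj (b w)) f z)} \<le>
        ennreal C * (\<integral>\<^sup>+z\<in>ball 0 1. ennreal (llog \<epsilon> (c * (norm (f z) / s))) \<partial>lebesgue)"
      by (simp add: mult.commute)
  qed
qed

end

section \<open>Passage from admissible constants to the norm\<close>

theorem theorem5:
  fixes \<theta> \<epsilon> :: real
    and N :: nat
    and \<Q> :: "nat \<Rightarrow> nat \<Rightarrow> (complex^'n::finite) set set"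
    and cen :: "nat \<Rightarrow> (complex^'n) set \<Rightarrow> complex^'n"
  assumes "bergman_dyadic \<theta> N \<Q> cen"
    and "0 < \<epsilon>" and "\<epsilon> \<le> 1"
  shows "\<exists>C>0. \<forall>b \<in> osc_exp (1 / \<epsilon>) (all_tents \<theta> N \<Q> cen).
    \<forall>f. bounded_compact_support f \<longrightarrow> (\<forall>s>0.
      emeasure lebesgue {z \<in> ball 0 1. norm (bergman_commutator (\<lambda>w. cnj (b w)) f z) > s}
      \<le> ennreal (C * osc_exp_norm (1 / \<epsilon>) (all_tents \<theta> N \<Q> cen) b) *
        (\<integral>\<^sup>+z\<in>ball 0 1. ennreal (norm (f z) / s *
           (1 + log_plus (norm (f z) * osc_exp_norm (1 / \<epsilon>) (all_tents \<theta> N \<Q> cen) b / s)) powr \<epsilon>)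
           \<partial>lebesgue))"
proof -
  interpret bergman_dyadic \<theta> N \<Q> cen by fact
  let ?\<T> = "all_tents \<theta> N \<Q> cen"
  obtain C where C: "0 < C"
    "\<And>b c f s. locally_integrable_ball b \<Longrightarrow> c \<in> osc_admissible (1 / \<epsilon>) ?\<T> b \<Longrightarrow>
      bounded_compact_support f \<Longrightarrow> 0 < s \<Longrightarrow>
      emeasure lebesgue {z \<in> ball 0 1. s < norm (bergman_commutator (\<lambda>w. cnj (b w)) f z)} \<le>
        ennreal C * (\<integral>\<^sup>+z\<in>ball 0 1. ennreal (llog \<epsilon> (c * (norm (f z) / s))) \<partial>lebesgue)"
    using commutator_weak_type[OF assms(2,3)] by blast
  show ?thesis
  proof (intro exI[of _ "4 * C"] conjI ballI allI impI)
    show "0 < 4 * C" using C by simp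
    fix b f :: "complex^'n \<Rightarrow> complex" and s :: real
    assume b: "b \<in> osc_exp (1 / \<epsilon>) ?\<T>" and f: "bounded_compact_support f" and s: "0 < s"
    let ?V = "osc_admissible (1 / \<epsilon>) ?\<T> b"
    define \<nu> where "\<nu> = osc_exp_norm (1 / \<epsilon>) ?\<T> b"
    have bl: "locally_integrable_ball b" using b by (simp add: osc_exp_def)
    have ne: "?V \<noteq> {}" using osc_admissible_nonempty[OF b] assms by simp
    have \<nu>0: "0 \<le> \<nu>"
      unfolding \<nu>_def osc_exp_norm_eq by (rule cInf_greatest[OF ne]) (simp add: osc_admissible_def)
    have V: "c \<in> ?V" if c: "\<nu> < c" for c
    proof -
      obtain c' where "c' \<in> ?V" "c' < c"
        using cInf_lessD[OF ne, of c] c unfolding \<nu>_def osc_exp_norm_eq by blast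
      then show ?thesis using assms by (intro osc_admissible_mono[of c' _ _ _ c]) auto
    qed
    let ?E = "{z \<in> ball 0 1. norm (bergman_commutator (\<lambda>w. cnj (b w)) f z) > s}"
    let ?u = "\<lambda>z. norm (f z) / s"
    have fm [measurable]: "f \<in> borel_measurable unit_ball_measure" using f by (simp add: bounded_compact_support_def)
    show "emeasure lebesgue ?E \<le> ennreal (4 * C * osc_exp_norm (1 / \<epsilon>) ?\<T> b) *
        (\<integral>\<^sup>+z\<in>ball 0 1. ennreal (norm (f z) / s *
           (1 + log_plus (norm (f z) * osc_exp_norm (1 / \<epsilon>) ?\<T> b / s)) powr \<epsilon>) \<partial>lebesgue)"
      unfolding \<nu>_def[symmetric]
    proof (cases "\<nu> = 0")
      case False
      then have \<nu>: "0 < \<nu>" using \<nu>0 by simp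
      \<comment> \<open>Whether the infimum is admissible is left open; \<open>2 * \<nu>\<close>
        lies strictly above it and is. By \<open>llog_mult_le\<close> the doubling costs
        \<open>2\<^sup>2\<close>, the 4 in the constant.\<close>
      have "emeasure lebesgue ?E \<le> ennreal C * (\<integral>\<^sup>+z. ennreal (llog \<epsilon> ((2 * \<nu>) * ?u z)) \<partial>unit_ball_measure)"
        unfolding nn_integral_unit_ball using C(2)[OF bl V f s, of "2 * \<nu>"] \<nu> by simp
      also have "\<dots> \<le> ennreal C * (\<integral>\<^sup>+z. ennreal (4 * \<nu>) * ennreal (?u z * (1 + log_plus (norm (f z) * \<nu> / s)) powr \<epsilon>) \<partial>unit_ball_measure)"
      proof (intro mult_left_mono nn_integral_mono)
        fix z
        have "llog \<epsilon> (2 * (\<nu> * ?u z)) \<le> 2\<^sup>2 * llog \<epsilon> (\<nu> * ?u z)"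
          using assms \<nu> s by (intro llog_mult_le) auto
        also have "\<dots> = 4 * \<nu> * (?u z * (1 + log_plus (norm (f z) * \<nu> / s)) powr \<epsilon>)"
          by (simp add: llog_def mult_ac)
        finally have "ennreal (llog \<epsilon> ((2 * \<nu>) * ?u z)) \<le> ennreal (4 * \<nu> * (?u z * (1 + log_plus (norm (f z) * \<nu> / s)) powr \<epsilon>))"
          by (intro ennreal_leI) (simp only: mult.assoc)
        then show "ennreal (llog \<epsilon> ((2 * \<nu>) * ?u z)) \<le> ennreal (4 * \<nu>) * ennreal (?u z * (1 + log_plus (norm (f z) * \<nu> / s)) powr \<epsilon>)"
          using \<nu> by (simp add: ennreal_mult'[symmetric])
      qed auto
      also have "\<dots> = ennreal C * (ennreal (4 * \<nu>) * (\<integral>\<^sup>+z. ennreal (?u z * (1 + log_plus (norm (f z) * \<nu> / s)) powr \<epsilon>) \<partial>unit_ball_measure))"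
        by (subst nn_integral_cmult) auto
      also have "\<dots> = ennreal (4 * C * \<nu>) * (\<integral>\<^sup>+z. ennreal (?u z * (1 + log_plus (norm (f z) * \<nu> / s)) powr \<epsilon>) \<partial>unit_ball_measure)"
      proof -
        have "ennreal (4 * C * \<nu>) = ennreal C * ennreal (4 * \<nu>)"
          using C(1) \<nu> by (subst ennreal_mult[symmetric]) (auto simp: mult.left_commute)
        then show ?thesis by (simp only: mult.assoc)
      qed
      finally show "emeasure lebesgue ?E \<le> ennreal (4 * C * \<nu>) * (\<integral>\<^sup>+z\<in>ball 0 1. ennreal (?u z * (1 + log_plus (norm (f z) * \<nu> / s)) powr \<epsilon>) \<partial>lebesgue)"
        by (simp only: nn_integral_unit_ball)
    next
      \<comment> \<open>Now every positive \<open>c\<close> is admissible. As \<open>f\<close> is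
        bounded by \<open>K\<close>, the logarithm vanishes as soon as \<open>c \<le> s / K\<close>,
        and the bound becomes linear in \<open>c\<close>. Letting \<open>c\<close> tend to 0 shows
        that the superlevel set is null, as the vanishing right-hand side demands.\<close>
      case True
      obtain K where K: "0 < K" "\<And>z. z \<in> ball 0 1 \<Longrightarrow> norm (f z) \<le> K"
        using f unfolding bounded_compact_support_def bounded_pos by blast
      define R where "R = C * (K / s * measure lebesgue (ball (0 :: complex^'n) 1))"
      have small: "emeasure lebesgue ?E \<le> ennreal (c * R)" if c: "0 < c" "c \<le> s / K" for c
      proof -
        have "emeasure lebesgue ?E \<le> ennreal C * (\<integral>\<^sup>+z\<in>ball 0 1. ennreal (llog \<epsilon> (c * ?u z)) \<partial>lebesgue)"
          using C(2)[OF bl V f s, of c] c True by simp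
        also have "\<dots> \<le> ennreal C * (\<integral>\<^sup>+z. ennreal (c * (K / s)) * indicator (ball (0 :: complex^'n) 1) z \<partial>lebesgue)"
        proof (intro mult_left_mono nn_integral_mono)
          fix z :: "complex^'n"
          show "ennreal (llog \<epsilon> (c * ?u z)) * indicator (ball 0 1) z \<le> ennreal (c * (K / s)) * indicator (ball 0 1) z"
          proof (cases "z \<in> ball 0 1")
            case True
            have uK: "?u z \<le> K / s" using K(2)[OF True] s by (intro divide_right_mono) auto
            then have "c * ?u z \<le> c * (K / s)" using c by (intro mult_left_mono) auto
            moreover have "c * (K / s) \<le> 1" using c K(1) s by (simp add: field_simps)
            moreover have lp: "log_plus v = 0" if "0 \<le> v" "v \<le> 1" for v
              using that by (cases "v = 0") (auto simp: log_plus_def)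
            moreover have "0 \<le> c * ?u z" using c s by simp
            ultimately have "log_plus (c * ?u z) = 0" by (intro lp) linarith+
            then have "llog \<epsilon> (c * ?u z) = c * ?u z" unfolding llog_def by simp
            also note \<open>c * ?u z \<le> c * (K / s)\<close>
            finally have "llog \<epsilon> (c * ?u z) \<le> c * (K / s)" .
            then show ?thesis by (intro mult_right_mono ennreal_leI) auto
          qed simp
        qed simp
        also have "\<dots> = ennreal C * (ennreal (c * (K / s)) * emeasure lebesgue (ball (0 :: complex^'n) 1))"
          by (simp add: nn_integral_cmult_indicator)
        also have "\<dots> = ennreal (c * R)"
        proof -
          have "emeasure lebesgue (ball (0 :: complex^'n) 1) = ennreal (measure lebesgue (ball (0 :: complex^'n) 1))"
            using emeasure_lborel_ball_finite[of "0 :: complex^'n" 1]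
            by (intro emeasure_eq_measure2 fmeasurableI) auto
          moreover have "c * R = C * (c * (K / s) * measure lebesgue (ball (0 :: complex^'n) 1))"
            by (simp add: R_def)
          moreover have "0 \<le> c * (K / s)" using c K(1) s by simp
          ultimately show ?thesis
            using C(1) by (simp only: ennreal_mult' less_imp_le measure_nonneg)
        qed
        finally show ?thesis .
      qed
      have "((\<lambda>c. ennreal (c * R)) \<longlongrightarrow> ennreal (0 * R)) (at_right 0)"
        by (intro tendsto_intros)
      moreover have "eventually (\<lambda>c. emeasure lebesgue ?E \<le> ennreal (c * R)) (at_right 0)"
        using small K(1) s by (intro eventually_at_rightI[of 0 "s / K"]) auto
      ultimately have "emeasure lebesgue ?E \<le> ennreal (0 * R)"
        by (intro tendsto_lowerbound) auto
      then have "emeasure lebesgue ?E = 0" by simp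
      then show "emeasure lebesgue ?E \<le> ennreal (4 * C * \<nu>) * (\<integral>\<^sup>+z\<in>ball 0 1. ennreal (?u z * (1 + log_plus (norm (f z) * \<nu> / s)) powr \<epsilon>) \<partial>lebesgue)"
        by simp
    qed
  qed
qed

end
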